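(* Let $\Sigma=\{P_1,\dots,P_s\}$ be a differential system in the variables $X=\{x_1,\dots,x_n\}$, $s\le n$, and let $\eta$ be a point of the diffiety defined by $\Sigma$. If $Y\subset X$ with $\sharp Y=s$ satisfies $\hat{\mathcal O}_\Sigma=\mathcal O_{Y,\Sigma}=d$ with $d\in\mathbb N$, and $\nabla_{Y,\Sigma}(\eta)\neq0$, then the defect of $\Sigma$ at $\eta$ (i.e. of the diffiety defined by $\Sigma$) is at most $d$.
   Context: All functions are analytic. $\mathbf J(\mathbb R,\mathbb R^n)$ is the infinite jet space with coordinates $t$ and $x_j^{(k)}$ ($1\le j\le n$, $k\in\mathbb N$), with the coarsest topology making the coordinates continuous, and with derivation $d_t=\partial_t+\sum_{j,k}x_j^{(k+1)}\partial/\partial x_j^{(k)}$. A differential function is an analytic function of finitely many coordinates on an open set. A differential system $\Sigma=\{P_1,\dots,P_s\}$ in $X=\{x_1,\dots,x_n\}$ is a finite set of differential functions (equations $P_i=0$). The diffiety it defines near a point $\eta$ where all $d_t^kP_i$ vanish is the common zero set of all $d_t^kP_i$ with the derivation induced by $d_t$. In general a diffiety is a manifold of denumerable dimension with a derivation, and isomorphisms of diffieties are smooth bijections with smooth inverse compatible with the derivations. Defect. A representation of order $n_0$ of a diffiety at $\eta$ is an isomorphism of a neighborhood of $\eta$ with an open subset of $\mathbb R\times\mathbb R^{n_0}\times(\mathbb R^{\mathbb N})^m$ with coordinates $t$, $\xi_1,\dots,\xi_{n_0}$, $u_j^{(k)}$ ($1\le j\le m$, $k\in\mathbb N$) and derivation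 given by $t'=1$, $(u_j^{(k)})'=u_j^{(k+1)}$, $\xi_i'=f_i$, where $f_i$ is a function of $t$, $\xi$ (no derivatives of $\xi$) and finitely many $u_j^{(k)}$. The defect at $\eta$ is the smallest order $n_0$ of a representation at $\eta$. Jacobi numbers. $\mathrm{ord}_{x_j}P$ is the largest $k$ such that $P$ depends on $x_j^{(k)}$, and $-\infty$ if $P$ depends on none of them. Put $a_{i,j}=\mathrm{ord}_{x_j}P_i$. For $Y\subset X$ with $\sharp Y=s$, $\mathcal O_{Y,\Sigma}=\max_\sigma\sum_{i=1}^s a_{i,\sigma(i)}$ over bijections $\sigma:\{1,\dots,s\}\to Y$ (variables are identified with their indices). The saddle Jacobi number is $\hat{\mathcal O}_\Sigma=\min\{\mathcal O_{Y,\Sigma}: \sharp Y=s,\ \mathcal O_{Y,\Sigma}\ne-\infty\}$ ($-\infty$ if there is no such $Y$). Truncated determinant. For $Y$ with $\mathcal O_{Y,\Sigma}\neq-\infty$, consider the square matrix $(a_{i,j})_{1\le i\le s,\,j\in Y}$. A canon is a vector $\ell\in\mathbb N^s$ for which there is a bijection $\sigma_0:\{1,\dots,s\}\to Y$ with $a_{i,\sigma_0(i)}+\ell_i=\max_{i'}(a_{i',\sigma_0(i)}+\ell_{i'})$ for all $i$. There is a unique componentwise minimal canon $\lambda$. Put $\alpha_i=\max_k\lambda_k-\lambda_i$, $\beta_j=\max_i(a_{i,j}-\alpha_i)$. Then $\nabla_{Y,\Sigma}$ is the determinant of the matrix whose $(i,j)$ entry ($j\in Y$) is $\partial P_i/\partial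 x_j^{(\alpha_i+\beta_j)}$, i.e. $\partial P_i/\partial x_j^{(a_{i,j})}$ if $a_{i,j}=\alpha_i+\beta_j$ and $0$ otherwise. *)

theory Defs
  imports "HOL-Analysis.Analysis" "HOL-Library.Extended_Nat" "Jordan_Normal_Form.Determinant"
begin

section \<open>Coordinate spaces, differential functions, derivations\<close>

text \<open>
  The product topology on real-valued functions over a set \<open>C\<close> of coordinates is the coarsest
  topology for which the coordinates are continuous. Its points are extensional functions, i.e.
  they take the value \<^term>\<open>undefined\<close> outside \<open>C\<close>.
\<close>

abbreviation coord_space :: "'c set \<Rightarrow> ('c \<Rightarrow> real) topology" where
  "coord_space C \<equiv> product_topology (\<lambda>_. euclideanreal) C"

text \<open>
  An analytic function of finitely many coordinates on an open set: with one finite set \<open>F\<close> of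
  coordinates for all of \<open>U\<close>, around each point \<open>p\<close> of \<open>U\<close> the function is the sum of a power
  series in the differences \<open>q c - p c\<close> with \<open>c \<in> F\<close>; the multi-indices \<open>\<mu>\<close> range over the
  functions from \<open>F\<close> to the naturals. Only the coordinates in \<open>F\<close> of \<open>q\<close> are required to be close to
  those of \<open>p\<close>, so \<open>f\<close> factors on \<open>U\<close> through the projection to the coordinates in \<open>F\<close>.
\<close>

definition differential_function :: "'c set \<Rightarrow> ('c \<Rightarrow> real) set \<Rightarrow> (('c \<Rightarrow> real) \<Rightarrow> real) \<Rightarrow> bool" where
  "differential_function C U f \<longleftrightarrow>
     openin (coord_space C) U \<and>
     (\<exists>F. finite F \<and> F \<subseteq> C \<and>
       (\<forall>p\<in>U. \<exists>r>0. \<exists>a :: ('c \<Rightarrow> nat) \<Rightarrow> real. \<forall>q\<in>U. (\<forall>c\<in>F. \<bar>q c - p c\<bar> < r) \<longrightarrow>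
         ((\<lambda>\<mu>. a \<mu> * (\<Prod>c\<in>F. (q c - p c) ^ \<mu> c)) has_sum f q) (F \<rightarrow>\<^sub>E UNIV)))"

definition pdiff :: "'c \<Rightarrow> (('c \<Rightarrow> real) \<Rightarrow> real) \<Rightarrow> ('c \<Rightarrow> real) \<Rightarrow> real" where
  "pdiff c f p = deriv (\<lambda>s. f (p(c := s))) (p c)"

text \<open>
  The derivation with coefficients \<open>v\<close>, that is the sum of \<open>v c\<close> times the partial derivative with
  respect to \<open>c\<close> over all coordinates \<open>c\<close>. The sum is restricted to its nonzero terms because \<open>C\<close>
  may be infinite; for a differential function only finitely many remain.
\<close>

definition derivation ::
    "'c set \<Rightarrow> ('c \<Rightarrow> ('c \<Rightarrow> real) \<Rightarrow> real) \<Rightarrow> (('c \<Rightarrow> real) \<Rightarrow> real) \<Rightarrow> ('c \<Rightarrow> real) \<Rightarrow> real" where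
  "derivation C v f p = (\<Sum>c | c \<in> C \<and> pdiff c f p \<noteq> 0. v c p * pdiff c f p)"

section \<open>Diffieties\<close>

text \<open>
  Diffieties are represented as subsets of coordinate spaces, with the induced topology and with the
  derivation induced by the one of the ambient space (given by its values on the coordinates).
\<close>

record 'c diffiety =
  coords :: "'c set"
  points :: "('c \<Rightarrow> real) set"
  vfield :: "'c \<Rightarrow> ('c \<Rightarrow> real) \<Rightarrow> real"

text \<open>
  A map is smooth if each of its coordinates is locally the restriction of a differential function
  on the ambient space.
\<close>

definition smooth_map :: "'a diffiety \<Rightarrow> 'b diffiety \<Rightarrow> (('a \<Rightarrow> real) \<Rightarrow> ('b \<Rightarrow> real)) \<Rightarrow> bool" where
  "smooth_map D E \<phi> \<longleftrightarrow>
     \<phi> ` points D \<subseteq> points E \<and>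
     (\<forall>c\<in>coords E. \<forall>p\<in>points D. \<exists>O' f. p \<in> O' \<and> differential_function (coords D) O' f \<and>
        (\<forall>q\<in>points D \<inter> O'. f q = \<phi> q c))"

text \<open>
  Compatibility with the derivations: pulling back along \<open>\<phi>\<close> commutes with the derivations. It is
  required of all local differential functions \<open>f\<close>, \<open>g\<close> on the ambient spaces such that \<open>f\<close> restricts
  to the pullback of \<open>g\<close>. The condition is symmetric under replacing \<open>\<phi>\<close> by its inverse.
\<close>

definition diffiety_iso :: "'a diffiety \<Rightarrow> 'b diffiety \<Rightarrow> (('a \<Rightarrow> real) \<Rightarrow> ('b \<Rightarrow> real)) \<Rightarrow> bool" where
  "diffiety_iso D E \<phi> \<longleftrightarrow>
     bij_betw \<phi> (points D) (points E) \<and>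
     smooth_map D E \<phi> \<and>
     smooth_map E D (inv_into (points D) \<phi>) \<and>
     (\<forall>U f V g. differential_function (coords D) U f \<and> differential_function (coords E) V g \<and>
        (\<forall>p\<in>points D \<inter> U. \<phi> p \<in> V \<longrightarrow> f p = g (\<phi> p)) \<longrightarrow>
        (\<forall>p\<in>points D \<inter> U. \<phi> p \<in> V \<longrightarrow>
           derivation (coords D) (vfield D) f p = derivation (coords E) (vfield E) g (\<phi> p)))"

section \<open>The diffiety defined by a differential system\<close>

text \<open>\<open>Jet j k\<close> is the coordinate \<open>x\<^sub>j\<^sup>(\<^sup>k\<^sup>)\<close>; the variables are numbered from \<open>0\<close>.\<close>

datatype jet_coord = Time | Jet nat nat

definition jet_coords :: "nat \<Rightarrow> jet_coord set" where
  "jet_coords n = insert Time {Jet j k | j k. j < n}"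

fun jet_field :: "jet_coord \<Rightarrow> (jet_coord \<Rightarrow> real) \<Rightarrow> real" where
  "jet_field Time p = 1"
| "jet_field (Jet j k) p = p (Jet j (Suc k))"

definition d_t :: "nat \<Rightarrow> ((jet_coord \<Rightarrow> real) \<Rightarrow> real) \<Rightarrow> (jet_coord \<Rightarrow> real) \<Rightarrow> real" where
  "d_t n = derivation (jet_coords n) jet_field"

text \<open>
  A system in \<open>n\<close> variables consists of the functions \<open>P i\<close> for \<open>i < s\<close>, where \<open>P i\<close> has the open
  domain \<open>U i\<close>.
\<close>

definition system_diffiety ::
    "nat \<Rightarrow> nat \<Rightarrow> (nat \<Rightarrow> (jet_coord \<Rightarrow> real) set) \<Rightarrow> (nat \<Rightarrow> (jet_coord \<Rightarrow> real) \<Rightarrow> real) \<Rightarrow>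
     jet_coord diffiety" where
  "system_diffiety n s U P =
     \<lparr>coords = jet_coords n,
      points = {p \<in> topspace (coord_space (jet_coords n)).
                  \<forall>i<s. p \<in> U i \<and> (\<forall>k. (d_t n ^^ k) (P i) p = 0)},
      vfield = jet_field\<rparr>"

section \<open>Defect\<close>

text \<open>\<open>State i\<close> is the coordinate \<open>\<xi>\<^sub>i\<close> and \<open>Input j k\<close> is the coordinate \<open>u\<^sub>j\<^sup>(\<^sup>k\<^sup>)\<close>.\<close>

datatype rep_coord = RTime | State nat | Input nat nat

definition rep_coords :: "nat \<Rightarrow> nat \<Rightarrow> rep_coord set" where
  "rep_coords n\<^sub>0 m = insert RTime (State ` {..<n\<^sub>0} \<union> {Input j k | j k. j < m})"

fun rep_field ::
    "(nat \<Rightarrow> (rep_coord \<Rightarrow> real) \<Rightarrow> real) \<Rightarrow> rep_coord \<Rightarrow> (rep_coord \<Rightarrow> real) \<Rightarrow> real" where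
  "rep_field f RTime p = 1"
| "rep_field f (State i) p = f i p"
| "rep_field f (Input j k) p = p (Input j (Suc k))"

definition has_representation :: "'c diffiety \<Rightarrow> ('c \<Rightarrow> real) \<Rightarrow> nat \<Rightarrow> bool" where
  "has_representation D \<eta> n\<^sub>0 \<longleftrightarrow>
     (\<exists>m N W f \<phi>.
        openin (coord_space (coords D)) N \<and> \<eta> \<in> N \<and>
        openin (coord_space (rep_coords n\<^sub>0 m)) W \<and>
        (\<forall>i<n\<^sub>0. differential_function (rep_coords n\<^sub>0 m) W (f i)) \<and>
        diffiety_iso
          (D\<lparr>points := points D \<inter> N\<rparr>)
          \<lparr>coords = rep_coords n\<^sub>0 m, points = W, vfield = rep_field f\<rparr>
          \<phi>)"

text \<open>The defect is \<open>\<infinity>\<close> if there is no representation.\<close>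

definition defect :: "'c diffiety \<Rightarrow> ('c \<Rightarrow> real) \<Rightarrow> enat" where
  "defect D \<eta> = (INF n\<^sub>0 \<in> {n\<^sub>0. has_representation D \<eta> n\<^sub>0}. enat n\<^sub>0)"

section \<open>Jacobi numbers\<close>

text \<open>
  A function depends on a coordinate if the corresponding partial derivative does not vanish
  identically on its domain.
\<close>

definition jet_orders ::
    "(jet_coord \<Rightarrow> real) set \<Rightarrow> ((jet_coord \<Rightarrow> real) \<Rightarrow> real) \<Rightarrow> nat \<Rightarrow> nat set" where
  "jet_orders U P j = {k. \<exists>p\<in>U. pdiff (Jet j k) P p \<noteq> 0}"

definition jet_ord ::
    "(jet_coord \<Rightarrow> real) set \<Rightarrow> ((jet_coord \<Rightarrow> real) \<Rightarrow> real) \<Rightarrow> nat \<Rightarrow> ereal" where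
  "jet_ord U P j = (if jet_orders U P j = {} then -\<infinity> else ereal (real (Max (jet_orders U P j))))"

definition order_matrix ::
    "(nat \<Rightarrow> (jet_coord \<Rightarrow> real) set) \<Rightarrow> (nat \<Rightarrow> (jet_coord \<Rightarrow> real) \<Rightarrow> real) \<Rightarrow> nat \<Rightarrow> nat \<Rightarrow> ereal" where
  "order_matrix U P i j = jet_ord (U i) (P i) j"

definition jacobi_number :: "nat \<Rightarrow> (nat \<Rightarrow> nat \<Rightarrow> ereal) \<Rightarrow> nat set \<Rightarrow> ereal" where
  "jacobi_number s a Y = Max {\<Sum>i<s. a i (\<sigma> i) | \<sigma>. bij_betw \<sigma> {..<s} Y}"

definition saddle_jacobi_number :: "nat \<Rightarrow> nat \<Rightarrow> (nat \<Rightarrow> nat \<Rightarrow> ereal) \<Rightarrow> ereal" where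
  "saddle_jacobi_number n s a =
     (let \<Y> = {Y. Y \<subseteq> {..<n} \<and> card Y = s \<and> jacobi_number s a Y \<noteq> -\<infinity>}
      in if \<Y> = {} then -\<infinity> else Min (jacobi_number s a ` \<Y>))"

section \<open>Truncated determinant\<close>

definition is_canon :: "nat \<Rightarrow> (nat \<Rightarrow> nat \<Rightarrow> ereal) \<Rightarrow> nat set \<Rightarrow> (nat \<Rightarrow> nat) \<Rightarrow> bool" where
  "is_canon s a Y l \<longleftrightarrow>
     (\<exists>\<sigma>. bij_betw \<sigma> {..<s} Y \<and>
        (\<forall>i<s. a i (\<sigma> i) + ereal (real (l i)) = (MAX i'\<in>{..<s}. a i' (\<sigma> i) + ereal (real (l i')))))"

definition minimal_canon :: "nat \<Rightarrow> (nat \<Rightarrow> nat \<Rightarrow> ereal) \<Rightarrow> nat set \<Rightarrow> nat \<Rightarrow> nat" where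
  "minimal_canon s a Y =
     (THE l. l \<in> extensional {..<s} \<and> is_canon s a Y l \<and>
        (\<forall>l'. is_canon s a Y l' \<longrightarrow> (\<forall>i<s. l i \<le> l' i)))"

definition canon_alpha :: "nat \<Rightarrow> (nat \<Rightarrow> nat \<Rightarrow> ereal) \<Rightarrow> nat set \<Rightarrow> nat \<Rightarrow> nat" where
  "canon_alpha s a Y i = (MAX k\<in>{..<s}. minimal_canon s a Y k) - minimal_canon s a Y i"

definition canon_beta :: "nat \<Rightarrow> (nat \<Rightarrow> nat \<Rightarrow> ereal) \<Rightarrow> nat set \<Rightarrow> nat \<Rightarrow> ereal" where
  "canon_beta s a Y j = (MAX i\<in>{..<s}. a i j - ereal (real (canon_alpha s a Y i)))"

text \<open>
  The columns are the elements of \<open>Y\<close> in increasing order. In the first branch below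
  \<^term>\<open>Max (jet_orders (U i) (P i) j)\<close> is the order of \<open>P i\<close> in \<open>x\<^sub>j\<close> as a natural number.
\<close>

definition truncated_det ::
    "nat \<Rightarrow> (nat \<Rightarrow> (jet_coord \<Rightarrow> real) set) \<Rightarrow> (nat \<Rightarrow> (jet_coord \<Rightarrow> real) \<Rightarrow> real) \<Rightarrow> nat set \<Rightarrow>
     (jet_coord \<Rightarrow> real) \<Rightarrow> real" where
  "truncated_det s U P Y \<eta> =
     (let a = order_matrix U P in
      Determinant.det (Matrix.mat s s (\<lambda>(i, c).
        let j = sorted_list_of_set Y ! c in
        if a i j = ereal (real (canon_alpha s a Y i)) + canon_beta s a Y j
        then pdiff (Jet j (Max (jet_orders (U i) (P i) j))) (P i) \<eta>
        else 0)))"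

end

theory Submission
  imports Defs
begin

text \<open>
  Let \<open>\<alpha>\<close> and \<open>\<beta>\<close> be the numbers in the definition of the truncated determinant \<open>\<nabla>\<close>, so that \<open>P i\<close> has
  order at most \<open>\<alpha> i + \<beta> j\<close> in \<open>x_j\<close>. Give \<open>x_j^(k)\<close> the weight \<open>k - \<beta> j\<close> and the \<open>k\<close>-th derivative of
  the equation \<open>P i\<close> the weight \<open>k + \<alpha> i\<close>. Among the derivatives of variables in \<open>Y\<close>, an equation of
  weight \<open>w\<close> contains only those of weight at most \<open>w\<close>. Its partial derivatives with respect to those
  of weight exactly \<open>w\<close> are the entries of row \<open>i\<close> of the matrix with determinant \<open>\<nabla>\<close>: differentiating
  an equation shifts its top-weight part without changing the coefficients
  (\<open>pdiff_prolong_above\<close>, \<open>pdiff_prolong_top\<close>).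

  In weight \<open>w\<close> only the equations with \<open>\<alpha> i \<le> w\<close> are available. As \<open>\<nabla>(\<eta>) \<noteq> 0\<close>, there is a bijection \<open>\<sigma>\<close>
  from the equations to \<open>Y\<close> such that the rows with \<open>\<alpha> i \<le> w\<close> and the columns \<open>\<sigma> i\<close> of the same rows form
  a nonsingular block for every \<open>w\<close>, with \<open>\<alpha> i + \<beta> (\<sigma> i)\<close> equal to the order \<open>e i\<close> of \<open>P i\<close> in \<open>x_(\<sigma> i)\<close>
  (\<open>nested_nonsingular\<close>). Hence the equations of weight \<open>w\<close> determine the derivatives of weight \<open>w\<close> of
  the form \<open>x_(\<sigma> i)^(k)\<close> with \<open>k \<ge> e i\<close>, called leading below. The remaining
  coordinates are the time, all derivatives of the variables outside \<open>Y\<close>, which serve as inputs, and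
  the \<open>x_(\<sigma> i)^(k)\<close> with \<open>k < e i\<close>, which serve as states. The number of states is the sum of the \<open>e i\<close>,
  a sum of entries of the order matrix along a bijection, and so at most the Jacobi number of \<open>Y\<close>.

  Analytically, the finitely many equations up to some weight \<open>A\<close> are solved at once by an implicit
  function theorem (\<open>local_solution\<close>). The solution supplies the derivatives of the last states,
  hence a vector field on the space of states and inputs, and all higher leading derivatives are
  defined by iterating this field. By linear uniqueness in each weight (\<open>kernel_trivial\<close>) the
  iterates agree with the implicit functions up to weight \<open>A\<close>, so the equations hold,
  and all their derivatives hold because they are derivatives along the vector field. Conversely, beyond weight
  \<open>A\<close> the equations are affine in their derivatives of top weight, with a nonsingular matrix that only
  depends on lower ones; therefore no further shrinking of the neighbourhood occurs,
  although there are infinitely many equations (\<open>pts_unique\<close>).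

  The implicit function theorem itself is proved by a contraction in the Banach algebra of power
  series \<open>\<Sum> a \<mu> (q - p)^\<mu>\<close> with the norm \<open>\<Sum> \<bar>a \<mu>\<bar> r^\<bar>\<mu>\<bar>\<close>.
\<close>

section \<open>Majorized power series\<close>

definition mpow :: "'c set \<Rightarrow> ('c \<Rightarrow> real) \<Rightarrow> ('c \<Rightarrow> nat) \<Rightarrow> ('c \<Rightarrow> real) \<Rightarrow> real" where
  "mpow F p \<mu> q = (\<Prod>c\<in>F. (q c - p c) ^ \<mu> c)"

definition pbox :: "'c set \<Rightarrow> ('c \<Rightarrow> real) \<Rightarrow> real \<Rightarrow> ('c \<Rightarrow> real) set" where
  "pbox F p r = {q. \<forall>c\<in>F. \<bar>q c - p c\<bar> \<le> r}"

text \<open>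
  This is the ball of radius \<open>M\<close> in the Banach algebra of power series in the coordinates \<open>F\<close> about
  \<open>p\<close> with the weighted \<open>l\<^sup>1\<close> norm of radius \<open>r\<close>. The functions are defined on all points; nothing is
  said about them outside the polydisc \<open>pbox F p r\<close>.
\<close>

definition majorized ::
    "'c set \<Rightarrow> ('c \<Rightarrow> real) \<Rightarrow> real \<Rightarrow> real \<Rightarrow> (('c \<Rightarrow> real) \<Rightarrow> real) \<Rightarrow> bool" where
  "majorized F p r M g \<longleftrightarrow>
     (\<exists>a N. ((\<lambda>\<mu>. \<bar>a \<mu>\<bar> * r ^ sum \<mu> F) has_sum N) (F \<rightarrow>\<^sub>E UNIV) \<and> N \<le> M \<and>
        (\<forall>q\<in>pbox F p r. ((\<lambda>\<mu>. a \<mu> * mpow F p \<mu> q) has_sum g q) (F \<rightarrow>\<^sub>E UNIV)))"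

lemma abs_mpow_le:
  assumes "q \<in> pbox F p r"
  shows "\<bar>mpow F p \<mu> q\<bar> \<le> r ^ sum \<mu> F"
proof -
  have "\<bar>mpow F p \<mu> q\<bar> = (\<Prod>c\<in>F. \<bar>q c - p c\<bar> ^ \<mu> c)"
    by (simp add: mpow_def abs_prod power_abs)
  also have "\<dots> \<le> (\<Prod>c\<in>F. r ^ \<mu> c)"
    using assms by (intro prod_mono) (auto simp: pbox_def intro: power_mono)
  finally show ?thesis by (simp add: power_sum)
qed

lemma mpow_cong: "(\<And>c. c \<in> F \<Longrightarrow> \<mu> c = \<nu> c) \<Longrightarrow> mpow F p \<mu> q = mpow F p \<nu> q"
  unfolding mpow_def by (intro prod.cong) auto

lemma mpow_add: "mpow F p (\<lambda>c. \<mu> c + \<nu> c) q = mpow F p \<mu> q * mpow F p \<nu> q"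
  unfolding mpow_def by (simp add: power_add prod.distrib)

text \<open>
  A family of monomials may hit the same multi-index repeatedly, even infinitely often. Collecting
  the terms over the fibres of \<open>m\<close> does not increase the norm. Every closure property below reduces to
  such a rearrangement.
\<close>

lemma majorizedI:
  assumes F: "finite F" and r: "r > 0"
    and norm: "((\<lambda>k. \<bar>c k\<bar> * r ^ sum (m k) F) has_sum N) K" and NM: "N \<le> M"
    and val: "\<And>q. q \<in> pbox F p r \<Longrightarrow> ((\<lambda>k. c k * mpow F p (m k) q) has_sum g q) K"
  shows "majorized F p r M g"
proof -
  define m' where "m' k = restrict (m k) F" for k
  define fib where "fib \<mu> = {k\<in>K. m' k = \<mu>}" for \<mu>
  define E where "E = (F \<rightarrow>\<^sub>E (UNIV :: nat set))"
  define n where "n k = \<bar>c k\<bar> * r ^ sum (m k) F" for k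
  have m'E: "m' k \<in> E" for k by (auto simp: m'_def E_def)
  have sumeq: "sum (m k) F = sum \<mu> F" if "k \<in> fib \<mu>" for k \<mu>
    using that by (auto simp: fib_def m'_def intro: sum.cong)
  have nsum: "n summable_on K" using norm unfolding n_def by (rule has_sum_imp_summable)
  have nfib: "n summable_on fib \<mu>" for \<mu>
    using nsum by (rule summable_on_subset_banach) (auto simp: fib_def)
  have "(\<lambda>k. norm (c k)) summable_on fib \<mu>" for \<mu>
  proof -
    have "(\<lambda>k. n k * inverse (r ^ sum \<mu> F)) summable_on fib \<mu>"
      by (intro summable_on_cmult_left nfib)
    also have "?this \<longleftrightarrow> (\<lambda>k. norm (c k)) summable_on fib \<mu>"
      using r sumeq by (intro summable_on_cong) (auto simp: n_def)
    finally show ?thesis .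
  qed
  hence cfib: "(c has_sum infsum c (fib \<mu>)) (fib \<mu>)" for \<mu>
    by (intro has_sum_infsum) (rule abs_summable_summable)
  define a where "a \<mu> = infsum c (fib \<mu>)" for \<mu>
  define A where "A \<mu> = infsum n (fib \<mu>)" for \<mu>
  have A: "(n has_sum A \<mu>) (fib \<mu>)" for \<mu>
    unfolding A_def using nfib by (rule has_sum_infsum)
  have re: "((\<lambda>k. h k) has_sum S) K \<longleftrightarrow> ((\<lambda>(\<mu>, k). h k) has_sum S) (Sigma E fib)" for h :: "_ \<Rightarrow> real" and S
    by (rule has_sum_reindex_bij_witness[where i = snd and j = "\<lambda>k. (m' k, k)"])
       (auto simp: fib_def m'E)
  have AN: "(A has_sum N) E"
    by (rule has_sum_SigmaD[OF norm[folded n_def, unfolded re]]) (use A in auto)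
  have le: "\<bar>a \<mu>\<bar> * r ^ sum \<mu> F \<le> A \<mu>" for \<mu>
  proof -
    have "((\<lambda>k. c k * r ^ sum \<mu> F) has_sum a \<mu> * r ^ sum \<mu> F) (fib \<mu>)"
      unfolding a_def by (rule has_sum_cmult_left[OF cfib])
    from norm_infsum_le[OF this A[of \<mu>]] show ?thesis
      using r sumeq by (simp add: n_def abs_mult)
  qed
  have summ: "(\<lambda>\<mu>. \<bar>a \<mu>\<bar> * r ^ sum \<mu> F) summable_on E"
    by (rule summable_on_comparison_test[OF has_sum_imp_summable[OF AN]]) (use le r in auto)
  define N' where "N' = infsum (\<lambda>\<mu>. \<bar>a \<mu>\<bar> * r ^ sum \<mu> F) E"
  have N': "((\<lambda>\<mu>. \<bar>a \<mu>\<bar> * r ^ sum \<mu> F) has_sum N') E"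
    unfolding N'_def using summ by (rule has_sum_infsum)
  have "N' \<le> N" by (rule has_sum_mono[OF N' AN]) (rule le)
  moreover have "((\<lambda>\<mu>. a \<mu> * mpow F p \<mu> q) has_sum g q) E" if q: "q \<in> pbox F p r" for q
  proof (rule has_sum_SigmaD[OF val[OF q, unfolded re]])
    fix \<mu> assume "\<mu> \<in> E"
    have "((\<lambda>k. c k * mpow F p \<mu> q) has_sum a \<mu> * mpow F p \<mu> q) (fib \<mu>)"
      unfolding a_def by (rule has_sum_cmult_left[OF cfib])
    also have "?this \<longleftrightarrow> ((\<lambda>k. case (\<mu>, k) of (\<mu>, k) \<Rightarrow> c k * mpow F p (m k) q) has_sum a \<mu> * mpow F p \<mu> q) (fib \<mu>)"
      by (intro has_sum_cong) (auto simp: fib_def m'_def intro!: mpow_cong)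
    finally show "((\<lambda>k. case (\<mu>, k) of (\<mu>, k) \<Rightarrow> c k * mpow F p (m k) q) has_sum a \<mu> * mpow F p \<mu> q) (fib \<mu>)" .
  qed
  ultimately show ?thesis
    unfolding majorized_def using N' NM E_def by (meson order_trans)
qed

lemma majorized_bound:
  assumes "majorized F p r M g" "q \<in> pbox F p r"
  shows "\<bar>g q\<bar> \<le> M"
proof -
  obtain a N where a: "((\<lambda>\<mu>. \<bar>a \<mu>\<bar> * r ^ sum \<mu> F) has_sum N) (F \<rightarrow>\<^sub>E UNIV)" "N \<le> M"
    "((\<lambda>\<mu>. a \<mu> * mpow F p \<mu> q) has_sum g q) (F \<rightarrow>\<^sub>E UNIV)"
    using assms unfolding majorized_def by blast
  have "norm (g q) \<le> N"
    by (rule norm_infsum_le[OF a(3,1)]) (auto simp: abs_mult intro!: mult_left_mono abs_mpow_le assms)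
  thus ?thesis using a by simp
qed

lemma majorized_nonneg:
  assumes "majorized F p r M g" "r \<ge> 0"
  shows "M \<ge> 0"
proof -
  have "p \<in> pbox F p r" using assms(2) by (simp add: pbox_def)
  from majorized_bound[OF assms(1) this] show ?thesis by simp
qed

text \<open>
  Completeness of the algebra, in the form that absolutely convergent series of functions converge
  in norm.
\<close>

lemma majorized_has_sum:
  assumes F: "finite F" and r: "r > 0"
    and f: "\<And>k. k \<in> K \<Longrightarrow> majorized F p r (B k) (f k)"
    and B: "(B has_sum N) K" "N \<le> M"
    and g: "\<And>q. q \<in> pbox F p r \<Longrightarrow> ((\<lambda>k. f k q) has_sum g q) K"
  shows "majorized F p r M g"
proof -
  define E where "E = (F \<rightarrow>\<^sub>E (UNIV :: nat set))"
  have "\<exists>a N. ((\<lambda>\<mu>. \<bar>a \<mu>\<bar> * r ^ sum \<mu> F) has_sum N) E \<and> N \<le> B k \<and>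
        (\<forall>q\<in>pbox F p r. ((\<lambda>\<mu>. a \<mu> * mpow F p \<mu> q) has_sum f k q) E)" if "k \<in> K" for k
    using f[OF that] unfolding majorized_def E_def by blast
  then obtain z where z: "\<And>k. k \<in> K \<Longrightarrow> ((\<lambda>\<mu>. \<bar>fst (z k) \<mu>\<bar> * r ^ sum \<mu> F) has_sum snd (z k)) E \<and> snd (z k) \<le> B k \<and>
        (\<forall>q\<in>pbox F p r. ((\<lambda>\<mu>. fst (z k) \<mu> * mpow F p \<mu> q) has_sum f k q) E)"
  proof -
    assume *: "\<And>k. k \<in> K \<Longrightarrow> \<exists>a N. ((\<lambda>\<mu>. \<bar>a \<mu>\<bar> * r ^ sum \<mu> F) has_sum N) E \<and> N \<le> B k \<and>
        (\<forall>q\<in>pbox F p r. ((\<lambda>\<mu>. a \<mu> * mpow F p \<mu> q) has_sum f k q) E)"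
    have "\<forall>k\<in>K. \<exists>z. ((\<lambda>\<mu>. \<bar>fst z \<mu>\<bar> * r ^ sum \<mu> F) has_sum snd z) E \<and> snd z \<le> B k \<and>
        (\<forall>q\<in>pbox F p r. ((\<lambda>\<mu>. fst z \<mu> * mpow F p \<mu> q) has_sum f k q) E)"
      unfolding split_paired_Ex fst_conv snd_conv using * by blast
    from bchoice[OF this] show thesis using that by blast
  qed
  define a where "a k = fst (z k)" for k
  define L where "L k = snd (z k)" for k
  have a: "\<And>k. k \<in> K \<Longrightarrow> ((\<lambda>\<mu>. \<bar>a k \<mu>\<bar> * r ^ sum \<mu> F) has_sum L k) E"
    and L: "\<And>k. k \<in> K \<Longrightarrow> L k \<le> B k"
    and v: "\<And>k q. k \<in> K \<Longrightarrow> q \<in> pbox F p r \<Longrightarrow> ((\<lambda>\<mu>. a k \<mu> * mpow F p \<mu> q) has_sum f k q) E"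
    using z by (auto simp: a_def L_def)
  have L0: "L k \<ge> 0" if "k \<in> K" for k
    using a[OF that] by (rule has_sum_nonneg) (use r in auto)
  have Ls: "L summable_on K"
    by (rule summable_on_comparison_test[OF has_sum_imp_summable[OF B(1)]]) (auto simp: L L0)
  define n where "n = (\<lambda>(k, \<mu>). \<bar>a k \<mu>\<bar> * r ^ sum \<mu> F)"
  have ns: "n summable_on Sigma K (\<lambda>_. E)"
    by (rule summable_on_SigmaI[OF _ Ls]) (use a r in \<open>auto simp: n_def\<close>)
  have nh: "(n has_sum infsum L K) (Sigma K (\<lambda>_. E))"
    by (rule has_sum_SigmaI[OF _ has_sum_infsum[OF Ls] ns]) (use a in \<open>auto simp: n_def\<close>)
  show ?thesis
  proof (rule majorizedI[where K = "Sigma K (\<lambda>_. E)" and c = "\<lambda>(k, \<mu>). a k \<mu>" and m = snd, OF F r])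
    show "((\<lambda>k. \<bar>case k of (k, \<mu>) \<Rightarrow> a k \<mu>\<bar> * r ^ sum (snd k) F) has_sum infsum L K) (Sigma K (\<lambda>_. E))"
      using nh by (simp add: n_def case_prod_unfold)
    show "infsum L K \<le> M"
      using has_sum_mono[OF has_sum_infsum[OF Ls] B(1) L] B(2) by simp
    fix q assume q: "q \<in> pbox F p r"
    show "((\<lambda>k. (case k of (k, \<mu>) \<Rightarrow> a k \<mu>) * mpow F p (snd k) q) has_sum g q) (Sigma K (\<lambda>_. E))"
    proof (rule has_sum_SigmaI[OF _ g[OF q]])
      show "(\<lambda>k. (case k of (k, \<mu>) \<Rightarrow> a k \<mu>) * mpow F p (snd k) q) summable_on Sigma K (\<lambda>_. E)"
        by (rule abs_summable_summable, rule Infinite_Sum.abs_summable_on_comparison_test'[OF ns])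
           (auto simp: n_def abs_mult intro!: mult_left_mono abs_mpow_le q)
    qed (use v q in auto)
  qed
qed

lemma majorized_mpow_mult:
  assumes F: "finite F" and r: "r > 0" and g: "majorized F p r M g"
    and B: "\<bar>b\<bar> * r ^ sum \<nu> F * M \<le> B"
  shows "majorized F p r B (\<lambda>q. b * mpow F p \<nu> q * g q)"
proof -
  obtain a N where a: "((\<lambda>\<mu>. \<bar>a \<mu>\<bar> * r ^ sum \<mu> F) has_sum N) (F \<rightarrow>\<^sub>E UNIV)" "N \<le> M"
    "\<And>q. q \<in> pbox F p r \<Longrightarrow> ((\<lambda>\<mu>. a \<mu> * mpow F p \<mu> q) has_sum g q) (F \<rightarrow>\<^sub>E UNIV)"
    using g unfolding majorized_def by blast
  show ?thesis
  proof (rule majorizedI[where c = "\<lambda>\<mu>. b * a \<mu>" and m = "\<lambda>\<mu> c. \<mu> c + \<nu> c", OF F r])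
    have "\<bar>b\<bar> * r ^ sum \<nu> F * N \<le> \<bar>b\<bar> * r ^ sum \<nu> F * M"
      using a(2) r by (intro mult_left_mono) auto
    thus "\<bar>b\<bar> * r ^ sum \<nu> F * N \<le> B" using B by simp
    show "((\<lambda>\<mu>. \<bar>b * a \<mu>\<bar> * r ^ (\<Sum>c\<in>F. \<mu> c + \<nu> c)) has_sum \<bar>b\<bar> * r ^ sum \<nu> F * N) (F \<rightarrow>\<^sub>E UNIV)"
      using has_sum_cmult_right[OF a(1), of "\<bar>b\<bar> * r ^ sum \<nu> F"]
      by (simp add: abs_mult sum.distrib power_add mult_ac)
    show "((\<lambda>\<mu>. b * a \<mu> * mpow F p (\<lambda>c. \<mu> c + \<nu> c) q) has_sum b * mpow F p \<nu> q * g q) (F \<rightarrow>\<^sub>E UNIV)"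
      if "q \<in> pbox F p r" for q
      using has_sum_cmult_right[OF a(3)[OF that], of "b * mpow F p \<nu> q"]
      by (simp add: mpow_add mult_ac)
  qed
qed

lemma majorized_mult:
  assumes F: "finite F" and r: "r > 0"
    and f: "majorized F p r M f" and g: "majorized F p r M' g" and B: "M * M' \<le> B"
  shows "majorized F p r B (\<lambda>q. f q * g q)"
proof -
  obtain a N where a: "((\<lambda>\<mu>. \<bar>a \<mu>\<bar> * r ^ sum \<mu> F) has_sum N) (F \<rightarrow>\<^sub>E UNIV)" "N \<le> M"
    "\<And>q. q \<in> pbox F p r \<Longrightarrow> ((\<lambda>\<mu>. a \<mu> * mpow F p \<mu> q) has_sum f q) (F \<rightarrow>\<^sub>E UNIV)"
    using f unfolding majorized_def by blast
  have M': "M' \<ge> 0" by (rule majorized_nonneg[OF g]) (use r in simp)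
  show ?thesis
  proof (rule majorized_has_sum[OF F r])
    show "majorized F p r (\<bar>a \<mu>\<bar> * r ^ sum \<mu> F * M') (\<lambda>q. a \<mu> * mpow F p \<mu> q * g q)" for \<mu>
      by (rule majorized_mpow_mult[OF F r g]) simp
    show "((\<lambda>\<mu>. \<bar>a \<mu>\<bar> * r ^ sum \<mu> F * M') has_sum (N * M')) (F \<rightarrow>\<^sub>E UNIV)"
      by (rule has_sum_cmult_left[OF a(1)])
    show "N * M' \<le> B" using mult_right_mono[OF a(2) M'] B by simp
    show "((\<lambda>\<mu>. a \<mu> * mpow F p \<mu> q * g q) has_sum (f q * g q)) (F \<rightarrow>\<^sub>E UNIV)" if "q \<in> pbox F p r" for q
      by (rule has_sum_cmult_left[OF a(3)[OF that]])
  qed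
qed

lemma majorized_mono: "majorized F p r M g \<Longrightarrow> M \<le> M' \<Longrightarrow> majorized F p r M' g"
  unfolding majorized_def by (meson order_trans)

lemma majorized_cong:
  assumes "majorized F p r M g" "\<And>q. q \<in> pbox F p r \<Longrightarrow> g q = h q"
  shows "majorized F p r M h"
  using assms unfolding majorized_def by force

lemma majorized_const:
  assumes "finite F" "r > 0" "\<bar>k\<bar> \<le> M"
  shows "majorized F p r M (\<lambda>_. k)"
  by (rule majorizedI[where K = "{()}" and c = "\<lambda>_. k" and m = "\<lambda>_ _. 0" and N = "\<bar>k\<bar>"])
     (use assms in \<open>auto simp: mpow_def intro!: has_sum_finiteI\<close>)

lemma majorized_coord:
  assumes F: "finite F" "c \<in> F" and "r > 0" "r \<le> M"
  shows "majorized F p r M (\<lambda>q. q c - p c)"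
proof -
  have "mpow F p (\<lambda>c'. if c' = c then 1 else 0) q = q c - p c" for q
    using F by (simp add: mpow_def if_distrib prod.delta cong: if_cong)
  thus ?thesis
  by (intro majorizedI[where K = "{()}" and c = "\<lambda>_. 1" and m = "\<lambda>_ c'. if c' = c then 1 else 0" and N = r])
     (use assms in \<open>auto intro!: has_sum_finiteI\<close>)
qed

lemma majorized_sum:
  assumes "finite F" "r > 0" "finite K"
    and "\<And>k. k \<in> K \<Longrightarrow> majorized F p r (B k) (f k)" "sum B K \<le> M"
  shows "majorized F p r M (\<lambda>q. \<Sum>k\<in>K. f k q)"
  by (rule majorized_has_sum[where K = K and B = B and f = f and N = "sum B K"])
     (use assms in \<open>auto intro!: has_sum_finiteI\<close>)

lemma majorized_add:
  assumes "finite F" "r > 0" "majorized F p r M f" "majorized F p r M' g" "M + M' \<le> B"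
  shows "majorized F p r B (\<lambda>q. f q + g q)"
proof -
  have "majorized F p r B (\<lambda>q. \<Sum>b\<in>{True, False}. (if b then f else g) q)"
    by (rule majorized_sum[where B = "\<lambda>b. if b then M else M'"]) (use assms in auto)
  thus ?thesis by simp
qed

lemma majorized_cmult:
  assumes "finite F" "r > 0" "majorized F p r M g" "\<bar>k\<bar> * M \<le> B"
  shows "majorized F p r B (\<lambda>q. k * g q)"
  by (rule majorized_mult[OF assms(1,2) majorized_const assms(3)]) (use assms in auto)

lemma majorized_diff:
  assumes "finite F" "r > 0" "majorized F p r M f" "majorized F p r M' g" "M + M' \<le> B"
  shows "majorized F p r B (\<lambda>q. f q - g q)"
proof -
  have "majorized F p r M' (\<lambda>q. (-1) * g q)"
    by (rule majorized_cmult[OF assms(1,2,4)]) simp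
  from majorized_add[OF assms(1,2,3) this assms(5)] show ?thesis by simp
qed

lemma majorized_power:
  assumes "finite F" "r > 0" "majorized F p r M f"
  shows "majorized F p r (M ^ n) (\<lambda>q. f q ^ n)"
proof (induction n)
  case 0
  show ?case using assms by (simp add: majorized_const)
next
  case (Suc n)
  show ?case unfolding power_Suc by (rule majorized_mult[OF assms Suc.IH]) simp
qed

lemma majorized_prod:
  assumes "finite F" "r > 0" "finite K" "\<And>k. k \<in> K \<Longrightarrow> majorized F p r (B k) (f k)"
  shows "majorized F p r (prod B K) (\<lambda>q. \<Prod>k\<in>K. f k q)"
  using assms(3,4)
proof (induction rule: finite_induct)
  case empty
  show ?case using assms by (simp add: majorized_const)
next
  case (insert k K)
  have "majorized F p r (B k * prod B K) (\<lambda>q. f k q * (\<Prod>k\<in>K. f k q))"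
    by (rule majorized_mult[OF assms(1,2)]) (use insert in auto)
  thus ?case using insert.hyps by simp
qed

text \<open>
  Substitution is the sum of \<open>a \<mu>\<close> times products of powers of the inner functions; the \<open>\<mu>\<close>-th term
  has at most the norm of the \<open>\<mu>\<close>-th term of \<open>g\<close>. Recentring, changes of coordinates and freezing of
  coordinates are all instances.
\<close>

lemma majorized_compose:
  assumes F: "finite F" "r > 0" and F': "finite F'" "r' > 0"
    and g: "majorized F p r M g"
    and \<Phi>: "\<And>c. c \<in> F \<Longrightarrow> majorized F' p' r' r (\<lambda>q. \<Phi> q c - p c)"
  shows "majorized F' p' r' M (\<lambda>q. g (\<Phi> q))"
proof -
  obtain a N where a: "((\<lambda>\<mu>. \<bar>a \<mu>\<bar> * r ^ sum \<mu> F) has_sum N) (F \<rightarrow>\<^sub>E UNIV)" "N \<le> M"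
    "\<And>q. q \<in> pbox F p r \<Longrightarrow> ((\<lambda>\<mu>. a \<mu> * mpow F p \<mu> q) has_sum g q) (F \<rightarrow>\<^sub>E UNIV)"
    using g unfolding majorized_def by blast
  show ?thesis
  proof (rule majorized_has_sum[OF F' _ a(1,2)])
    show "majorized F' p' r' (\<bar>a \<mu>\<bar> * r ^ sum \<mu> F) (\<lambda>q. a \<mu> * mpow F p \<mu> (\<Phi> q))" for \<mu>
      unfolding mpow_def power_sum
      by (rule majorized_cmult[OF F' majorized_prod[OF F' F(1) majorized_power[OF F' \<Phi>]]]) auto
    fix q assume "q \<in> pbox F' p' r'"
    hence "\<Phi> q \<in> pbox F p r" using majorized_bound[OF \<Phi>] by (auto simp: pbox_def)
    thus "((\<lambda>\<mu>. a \<mu> * mpow F p \<mu> (\<Phi> q)) has_sum g (\<Phi> q)) (F \<rightarrow>\<^sub>E UNIV)" by (rule a(3))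
  qed
qed

lemma majorized_recenter:
  assumes F: "finite F" "r > 0" "r' > 0" "F \<subseteq> F'" "finite F'" and g: "majorized F p r M g"
    and p': "\<And>c. c \<in> F \<Longrightarrow> \<bar>p' c - p c\<bar> + r' \<le> r"
  shows "majorized F' p' r' M g"
proof (rule majorized_compose[OF F(1,2,5,3) g])
  fix c assume c: "c \<in> F"
  have "majorized F' p' r' r (\<lambda>q. (q c - p' c) + (p' c - p c))"
    by (rule majorized_add[OF F(5,3) majorized_coord majorized_const]) (use F p' c in force)+
  thus "majorized F' p' r' r (\<lambda>q. q c - p c)" by simp
qed

section \<open>Two-point expansions and derivatives\<close>

text \<open>
  Pairs of points are points over the doubled coordinates \<open>F \<times> UNIV\<close>, so that functions of two points
  are covered by \<^const>\<open>majorized\<close> too.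
\<close>

definition pjoin :: "('c \<Rightarrow> real) \<Rightarrow> ('c \<Rightarrow> real) \<Rightarrow> 'c \<times> bool \<Rightarrow> real" where
  "pjoin q q' = (\<lambda>(c, b). if b then q c else q' c)"

lemma join_in_pbox: "q \<in> pbox F p r \<Longrightarrow> q' \<in> pbox F p r \<Longrightarrow> pjoin q q' \<in> pbox (F \<times> UNIV) (pjoin p p) r"
  by (auto simp: pbox_def pjoin_def)

lemma majorized_join_coord:
  assumes "finite F" "r > 0" "c \<in> F"
  shows "majorized (F \<times> UNIV) (pjoin p p) r r (\<lambda>z. z (c, b) - p c)"
  using majorized_coord[of "F \<times> (UNIV :: bool set)" "(c, b)" r r "pjoin p p"] assms by (simp add: pjoin_def)

lemma power_two_point:
  assumes F: "finite F" "r > 0" "c \<in> F"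
  shows "\<exists>K. majorized (F \<times> UNIV) (pjoin p p) r (real n * r ^ n / r) K \<and>
    (\<forall>q q'. (q c - p c) ^ n - (q' c - p c) ^ n = (q c - q' c) * K (pjoin q q'))"
proof (intro exI conjI allI)
  define K where "K z = (\<Sum>i<n. (z (c, False) - p c) ^ (n - Suc i) * (z (c, True) - p c) ^ i)"
    for z :: "'a \<times> bool \<Rightarrow> real"
  note F2 = finite_cartesian_product[OF F(1) finite_class.finite_UNIV[where 'a = bool]] F(2)
  show "majorized (F \<times> UNIV) (pjoin p p) r (real n * r ^ n / r) K"
    unfolding K_def
  proof (rule majorized_sum[OF F2])
    fix i assume "i \<in> {..<n}"
    show "majorized (F \<times> UNIV) (pjoin p p) r (r ^ (n - Suc i) * r ^ i)
      (\<lambda>z. (z (c, False) - p c) ^ (n - Suc i) * (z (c, True) - p c) ^ i)"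
      by (rule majorized_mult[OF F2 majorized_power[OF F2 majorized_join_coord[OF F]]
          majorized_power[OF F2 majorized_join_coord[OF F]] order_refl])
  next
    have "r ^ (n - Suc i) * r ^ i = r ^ n / r" if "i < n" for i
    proof -
      have "r ^ (n - Suc i) * r ^ i * r = r ^ (n - Suc i + i + 1)" by (simp add: power_add)
      also have "n - Suc i + i + 1 = n" using that by simp
      finally show ?thesis using F by (simp add: field_simps)
    qed
    thus "(\<Sum>i<n. r ^ (n - Suc i) * r ^ i) \<le> real n * r ^ n / r" by simp
  qed simp
  show "(q c - p c) ^ n - (q' c - p c) ^ n = (q c - q' c) * K (pjoin q q')" for q q'
    using power_diff_sumr2[of "q c - p c" n "q' c - p c"] by (simp add: K_def pjoin_def)
qed

text \<open>
  Induction over the variables: a difference of products \<open>u v - u' v'\<close> is \<open>(u - u') v + u' (v - v')\<close>.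
  The bound is that of the derivative of \<open>t^\<bar>\<mu>\<bar>\<close> at \<open>r\<close>.
\<close>

lemma mpow_two_point:
  assumes F: "finite F" "r > 0" "F0 \<subseteq> F"
  shows "\<exists>K. (\<forall>c\<in>F0. majorized (F \<times> UNIV) (pjoin p p) r (real (sum \<mu> F0) * r ^ sum \<mu> F0 / r) (K c)) \<and>
    (\<forall>q q'. mpow F0 p \<mu> q - mpow F0 p \<mu> q' = (\<Sum>c\<in>F0. (q c - q' c) * K c (pjoin q q')))"
  using finite_subset[OF F(3,1)] F(3)
proof (induction F0 rule: finite_induct)
  case empty
  show ?case by (simp add: mpow_def)
next
  case (insert c F0)
  note F2 = finite_cartesian_product[OF F(1) finite_class.finite_UNIV[where 'a = bool]] F(2)
  obtain K where K: "\<And>c. c \<in> F0 \<Longrightarrow> majorized (F \<times> UNIV) (pjoin p p) r (real (sum \<mu> F0) * r ^ sum \<mu> F0 / r) (K c)"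
    and Kd: "\<And>q q'. mpow F0 p \<mu> q - mpow F0 p \<mu> q' = (\<Sum>c\<in>F0. (q c - q' c) * K c (pjoin q q'))"
    using insert by auto
  obtain L where L: "majorized (F \<times> UNIV) (pjoin p p) r (real (\<mu> c) * r ^ \<mu> c / r) L"
    and Ld: "\<And>q q'. (q c - p c) ^ \<mu> c - (q' c - p c) ^ \<mu> c = (q c - q' c) * L (pjoin q q')"
    using power_two_point[of F r c p "\<mu> c"] F insert.prems by auto
  define K' where "K' d z = (if d = c then L z * (\<Prod>e\<in>F0. (z (e, True) - p e) ^ \<mu> e)
     else (z (c, False) - p c) ^ \<mu> c * K d z)" for d z
  have s: "sum \<mu> (insert c F0) = \<mu> c + sum \<mu> F0" using insert by simp
  have "majorized (F \<times> UNIV) (pjoin p p) r (real (sum \<mu> (insert c F0)) * r ^ sum \<mu> (insert c F0) / r) (K' d)"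
    if "d \<in> insert c F0" for d
  proof (cases "d = c")
    case True
    have "majorized (F \<times> UNIV) (pjoin p p) r (r ^ sum \<mu> F0) (\<lambda>z. \<Prod>e\<in>F0. (z (e, True) - p e) ^ \<mu> e)"
      unfolding power_sum using insert
      by (intro majorized_prod[OF F2] majorized_power[OF F2] majorized_join_coord F) auto
    hence "majorized (F \<times> UNIV) (pjoin p p) r (real (sum \<mu> (insert c F0)) * r ^ sum \<mu> (insert c F0) / r)
        (\<lambda>z. L z * (\<Prod>e\<in>F0. (z (e, True) - p e) ^ \<mu> e))"
      by (rule majorized_mult[OF F2 L]) (use F in \<open>auto simp: s field_simps power_add intro!: mult_nonneg_nonneg sum_nonneg\<close>)
    thus ?thesis by (simp add: K'_def[abs_def] True)
  next
    case False
    have "majorized (F \<times> UNIV) (pjoin p p) r (real (sum \<mu> (insert c F0)) * r ^ sum \<mu> (insert c F0) / r)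
        (\<lambda>z. (z (c, False) - p c) ^ \<mu> c * K d z)"
    proof (rule majorized_mult[OF F2 majorized_power[OF F2 majorized_join_coord] K])
      show "d \<in> F0" using False that by simp
    qed (use F insert.prems in \<open>auto simp: s field_simps power_add\<close>)
    thus ?thesis using False by (simp add: K'_def[abs_def])
  qed
  moreover have "mpow (insert c F0) p \<mu> q - mpow (insert c F0) p \<mu> q' =
     (\<Sum>d\<in>insert c F0. (q d - q' d) * K' d (pjoin q q'))" for q q'
  proof -
    have "mpow (insert c F0) p \<mu> q - mpow (insert c F0) p \<mu> q' =
       ((q c - p c) ^ \<mu> c - (q' c - p c) ^ \<mu> c) * mpow F0 p \<mu> q +
       (q' c - p c) ^ \<mu> c * (mpow F0 p \<mu> q - mpow F0 p \<mu> q')"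
      using insert by (simp add: mpow_def algebra_simps)
    also have "\<dots> = (q c - q' c) * K' c (pjoin q q') + (\<Sum>d\<in>F0. (q d - q' d) * K' d (pjoin q q'))"
    proof -
      have "(q' c - p c) ^ \<mu> c * (\<Sum>d\<in>F0. (q d - q' d) * K d (pjoin q q')) =
        (\<Sum>d\<in>F0. (q d - q' d) * K' d (pjoin q q'))"
        unfolding sum_distrib_left using insert.hyps
        by (intro sum.cong) (auto simp: K'_def pjoin_def)
      thus ?thesis unfolding Kd Ld by (simp add: K'_def pjoin_def mpow_def)
    qed
    finally show ?thesis using insert.hyps by simp
  qed
  ultimately show ?case by blast
qed

lemma has_sum_finite_sum:
  fixes f :: "'a \<Rightarrow> 'b \<Rightarrow> real"
  assumes "finite A" "\<And>c. c \<in> A \<Longrightarrow> (f c has_sum S c) K"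
  shows "((\<lambda>k. \<Sum>c\<in>A. f c k) has_sum sum S A) K"
  using assms by (induction rule: finite_induct) (auto intro: has_sum_add)

text \<open>
  Writing \<open>g q - g q'\<close> as a combination of the differences \<open>q c - q' c\<close> with majorized coefficients
  gives Lipschitz bounds, the chain rule and the contraction estimate alike, since the
  coefficients at \<open>q = q'\<close> are the partial derivatives.
\<close>

lemma majorized_two_point:
  assumes F: "finite F" "0 < r'" "r' < r" and g: "majorized F p r M g"
  obtains K M' where "\<And>c. c \<in> F \<Longrightarrow> majorized (F \<times> UNIV) (pjoin p p) r' M' (K c)"
    and "\<And>q q'. q \<in> pbox F p r' \<Longrightarrow> q' \<in> pbox F p r' \<Longrightarrow> g q - g q' = (\<Sum>c\<in>F. (q c - q' c) * K c (pjoin q q'))"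
proof -
  define E where "E = (F \<rightarrow>\<^sub>E (UNIV :: nat set))"
  obtain a N where a: "((\<lambda>\<mu>. \<bar>a \<mu>\<bar> * r ^ sum \<mu> F) has_sum N) E"
    "\<And>q. q \<in> pbox F p r \<Longrightarrow> ((\<lambda>\<mu>. a \<mu> * mpow F p \<mu> q) has_sum g q) E"
    using g unfolding majorized_def E_def by blast
  note F2 = finite_cartesian_product[OF F(1) finite_class.finite_UNIV[where 'a = bool]] F(2)
  define W where "W \<mu> = real (sum \<mu> F) * r' ^ sum \<mu> F / r'" for \<mu> :: "'a \<Rightarrow> nat"
  have "\<forall>\<mu>. \<exists>K. (\<forall>c\<in>F. majorized (F \<times> UNIV) (pjoin p p) r' (W \<mu>) (K c)) \<and>
    (\<forall>q q'. mpow F p \<mu> q - mpow F p \<mu> q' = (\<Sum>c\<in>F. (q c - q' c) * K c (pjoin q q')))"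
    unfolding W_def by (intro allI mpow_two_point F order_refl)
  from choice[OF this] obtain k where "\<forall>\<mu>. (\<forall>c\<in>F. majorized (F \<times> UNIV) (pjoin p p) r' (W \<mu>) (k \<mu> c)) \<and>
    (\<forall>q q'. mpow F p \<mu> q - mpow F p \<mu> q' = (\<Sum>c\<in>F. (q c - q' c) * k \<mu> c (pjoin q q')))" ..
  hence k: "\<And>\<mu> c. c \<in> F \<Longrightarrow> majorized (F \<times> UNIV) (pjoin p p) r' (W \<mu>) (k \<mu> c)"
    and kd: "\<And>\<mu> q q'. mpow F p \<mu> q - mpow F p \<mu> q' = (\<Sum>c\<in>F. (q c - q' c) * k \<mu> c (pjoin q q'))"
    by auto
  \<comment> \<open>The factor \<open>\<bar>\<mu>\<bar>\<close> from the derivative is absorbed by the smaller radius.\<close>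
  have "(\<lambda>n. real n * (r' / r) ^ n) \<longlonglongrightarrow> 0"
    by (rule powser_times_n_limit_0) (use F in auto)
  hence "Bseq (\<lambda>n. real n * (r' / r) ^ n)" by (rule convergent_imp_Bseq[OF convergentI])
  then obtain C where C: "C > 0" "\<And>n. norm (real n * (r' / r) ^ n) \<le> C" by (auto simp: Bseq_def)
  have WC: "W \<mu> \<le> C * r ^ sum \<mu> F / r'" for \<mu>
  proof -
    have "real (sum \<mu> F) * (r' / r) ^ sum \<mu> F \<le> C" using C(2)[of "sum \<mu> F"] by (simp only: real_norm_def)
    hence "real (sum \<mu> F) * r' ^ sum \<mu> F \<le> C * r ^ sum \<mu> F"
      using F by (simp add: power_divide field_simps)
    thus ?thesis using F by (simp add: W_def divide_right_mono)
  qed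
  define K where "K c z = (\<Sum>\<^sub>\<infinity>\<mu>\<in>E. a \<mu> * k \<mu> c z)" for c z
  define B where "B \<mu> = C / r' * (\<bar>a \<mu>\<bar> * r ^ sum \<mu> F)" for \<mu>
  have B: "(B has_sum (C / r' * N)) E"
    unfolding B_def by (rule has_sum_cmult_right[OF a(1)])
  have akm: "majorized (F \<times> UNIV) (pjoin p p) r' (B \<mu>) (\<lambda>z. a \<mu> * k \<mu> c z)" if "c \<in> F" for c \<mu>
  proof (rule majorized_cmult[OF F2 k[OF that]])
    show "\<bar>a \<mu>\<bar> * W \<mu> \<le> B \<mu>"
      using mult_left_mono[OF WC[of \<mu>], of "\<bar>a \<mu>\<bar>"] by (simp add: B_def mult_ac)
  qed
  have Ks: "((\<lambda>\<mu>. a \<mu> * k \<mu> c z) has_sum K c z) E" if "c \<in> F" "z \<in> pbox (F \<times> UNIV) (pjoin p p) r'" for c z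
    unfolding K_def
  proof (rule has_sum_infsum, rule abs_summable_summable)
    show "(\<lambda>\<mu>. norm (a \<mu> * k \<mu> c z)) summable_on E"
      by (rule Infinite_Sum.abs_summable_on_comparison_test'[OF has_sum_imp_summable[OF B]])
         (use majorized_bound[OF akm] that in auto)
  qed
  show thesis
  proof (rule that)
    show "majorized (F \<times> UNIV) (pjoin p p) r' (C / r' * N) (K c)" if "c \<in> F" for c
      by (rule majorized_has_sum[OF F2 akm B order_refl Ks]) (use that in auto)
    fix q q' assume q: "q \<in> pbox F p r'" "q' \<in> pbox F p r'"
    hence q2: "q \<in> pbox F p r" "q' \<in> pbox F p r" using F by (force simp: pbox_def)+
    have "((\<lambda>\<mu>. a \<mu> * mpow F p \<mu> q - a \<mu> * mpow F p \<mu> q') has_sum (g q - g q')) E"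
      using has_sum_add[OF a(2)[OF q2(1)] has_sum_uminusI[OF a(2)[OF q2(2)]]] by simp
    moreover have "a \<mu> * mpow F p \<mu> q - a \<mu> * mpow F p \<mu> q' = (\<Sum>c\<in>F. (q c - q' c) * (a \<mu> * k \<mu> c (pjoin q q')))" for \<mu>
      unfolding right_diff_distrib[symmetric] kd sum_distrib_left by (simp add: mult_ac)
    ultimately have "((\<lambda>\<mu>. \<Sum>c\<in>F. (q c - q' c) * (a \<mu> * k \<mu> c (pjoin q q'))) has_sum (g q - g q')) E"
      by simp
    moreover have "((\<lambda>\<mu>. \<Sum>c\<in>F. (q c - q' c) * (a \<mu> * k \<mu> c (pjoin q q'))) has_sum
       (\<Sum>c\<in>F. (q c - q' c) * K c (pjoin q q'))) E"
      by (intro has_sum_finite_sum F has_sum_cmult_right Ks join_in_pbox q)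
    ultimately show "g q - g q' = (\<Sum>c\<in>F. (q c - q' c) * K c (pjoin q q'))"
      by (rule has_sum_unique)
  qed
qed

lemma majorized_lipschitz:
  assumes F: "finite F" "0 < r'" "r' < r" and g: "majorized F p r M g"
  obtains L where "\<And>q q'. q \<in> pbox F p r' \<Longrightarrow> q' \<in> pbox F p r' \<Longrightarrow> \<bar>g q - g q'\<bar> \<le> L * (\<Sum>c\<in>F. \<bar>q c - q' c\<bar>)"
proof -
  obtain K M' where K: "\<And>c. c \<in> F \<Longrightarrow> majorized (F \<times> UNIV) (pjoin p p) r' M' (K c)"
    and d: "\<And>q q'. q \<in> pbox F p r' \<Longrightarrow> q' \<in> pbox F p r' \<Longrightarrow> g q - g q' = (\<Sum>c\<in>F. (q c - q' c) * K c (pjoin q q'))"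
    by (rule majorized_two_point[OF F g]) blast
  show thesis
  proof (rule that[of M'])
    fix q q' assume q: "q \<in> pbox F p r'" "q' \<in> pbox F p r'"
    have "\<bar>g q - g q'\<bar> \<le> (\<Sum>c\<in>F. \<bar>(q c - q' c) * K c (pjoin q q')\<bar>)"
      unfolding d[OF q] by (rule sum_abs)
    also have "\<dots> \<le> (\<Sum>c\<in>F. \<bar>q c - q' c\<bar> * M')"
      unfolding abs_mult by (intro sum_mono mult_left_mono majorized_bound[OF K] join_in_pbox q) auto
    finally show "\<bar>g q - g q'\<bar> \<le> M' * (\<Sum>c\<in>F. \<bar>q c - q' c\<bar>)" by (simp add: sum_distrib_left mult.commute)
  qed
qed

lemma majorized_shrink_radius:
  assumes F: "finite F" "0 < r'" "r' \<le> r" and g: "majorized F p r M g"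
  shows "majorized F p r' M g"
  by (rule majorized_recenter[OF F(1) _ F(2) _ F(1) g]) (use F in auto)

lemma majorized_tendsto:
  assumes F: "finite F" "0 < r'" "r' < r" and g: "majorized F p r M g" and q: "q \<in> pbox F p r'"
    and \<gamma>: "\<And>c. c \<in> F \<Longrightarrow> ((\<lambda>s. \<gamma> s c) \<longlongrightarrow> q c) A"
  shows "((\<lambda>s. g (\<gamma> s)) \<longlongrightarrow> g q) A"
proof -
  define r'' where "r'' = (r' + r) / 2"
  have r'': "r' < r''" "0 < r''" "r'' < r" using F by (auto simp: r''_def)
  obtain L where L: "\<And>q q'. q \<in> pbox F p r'' \<Longrightarrow> q' \<in> pbox F p r'' \<Longrightarrow> \<bar>g q - g q'\<bar> \<le> L * (\<Sum>c\<in>F. \<bar>q c - q' c\<bar>)"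
    by (rule majorized_lipschitz[OF F(1) r''(2,3) g]) blast
  have "\<forall>\<^sub>F s in A. \<forall>c\<in>F. \<bar>\<gamma> s c - q c\<bar> < r'' - r'"
    using F(1)
  proof (rule eventually_ball_finite, safe)
    fix c assume "c \<in> F"
    from tendstoD[OF \<gamma>[OF this], of "r'' - r'"] r''
    show "\<forall>\<^sub>F s in A. \<bar>\<gamma> s c - q c\<bar> < r'' - r'" by (simp add: dist_real_def)
  qed
  hence ev: "\<forall>\<^sub>F s in A. \<gamma> s \<in> pbox F p r''"
    by eventually_elim (use q in \<open>force simp: pbox_def\<close>)
  have q': "q \<in> pbox F p r''" using q r'' by (force simp: pbox_def)
  have "((\<lambda>s. L * (\<Sum>c\<in>F. \<bar>\<gamma> s c - q c\<bar>)) \<longlongrightarrow> L * (\<Sum>c\<in>F. \<bar>q c - q c\<bar>)) A"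
    by (intro tendsto_intros \<gamma>)
  hence "((\<lambda>s. L * (\<Sum>c\<in>F. \<bar>\<gamma> s c - q c\<bar>)) \<longlongrightarrow> 0) A" by simp
  hence "((\<lambda>s. g (\<gamma> s) - g q) \<longlongrightarrow> 0) A"
    by (rule Lim_null_comparison[rotated]) (use ev in eventually_elim, use L q' in simp)
  thus ?thesis by (simp add: LIM_zero_iff)
qed

text \<open>
  Divide the two-point expansion between \<open>\<gamma> s\<close> and \<open>\<gamma> s0\<close> by \<open>s - s0\<close>: the coefficients are
  continuous, so the limit is their value on the diagonal times the derivative of \<open>\<gamma>\<close>. Moving a
  single coordinate identifies these values as partial derivatives.
\<close>

lemma majorized_pdiff_chain:
  assumes F: "finite F" "0 < r'" "r' < r" and g: "majorized F p r M g"
  obtains M' where "\<And>c. c \<in> F \<Longrightarrow> majorized F p r' M' (pdiff c g)"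
    and "\<And>q c. c \<in> F \<Longrightarrow> q \<in> pbox F p r' \<Longrightarrow> ((\<lambda>s. g (q(c := s))) has_real_derivative pdiff c g q) (at (q c))"
    and "\<And>q \<gamma> d s0. q \<in> pbox F p r' \<Longrightarrow> (\<And>c. c \<in> F \<Longrightarrow> \<gamma> s0 c = q c) \<Longrightarrow>
          (\<And>c. c \<in> F \<Longrightarrow> ((\<lambda>s. \<gamma> s c) has_real_derivative d c) (at s0)) \<Longrightarrow>
          ((\<lambda>s. g (\<gamma> s)) has_real_derivative (\<Sum>c\<in>F. d c * pdiff c g q)) (at s0)"
proof -
  define r'' where "r'' = (r' + r) / 2"
  have r'': "r' < r''" "0 < r''" "r'' < r" using F by (auto simp: r''_def)
  obtain K M' where K: "\<And>c. c \<in> F \<Longrightarrow> majorized (F \<times> UNIV) (pjoin p p) r'' M' (K c)"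
    and d: "\<And>q q'. q \<in> pbox F p r'' \<Longrightarrow> q' \<in> pbox F p r'' \<Longrightarrow> g q - g q' = (\<Sum>c\<in>F. (q c - q' c) * K c (pjoin q q'))"
    by (rule majorized_two_point[OF F(1) r''(2,3) g]) blast
  have chain: "((\<lambda>s. g (\<gamma> s)) has_real_derivative (\<Sum>c\<in>F. D c * K c (pjoin q q))) (at s0)"
    if q: "q \<in> pbox F p r'" and s0: "\<And>c. c \<in> F \<Longrightarrow> \<gamma> s0 c = q c"
      and D: "\<And>c. c \<in> F \<Longrightarrow> ((\<lambda>s. \<gamma> s c) has_real_derivative D c) (at s0)" for q \<gamma> D s0
  proof -
    have lim: "((\<lambda>s. \<gamma> s c) \<longlongrightarrow> q c) (at s0)" if "c \<in> F" for c
      using DERIV_isCont[OF D[OF that]] s0[OF that] by (simp add: isCont_def)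
    have "\<forall>\<^sub>F s in at s0. \<forall>c\<in>F. \<bar>\<gamma> s c - q c\<bar> < r'' - r'"
      using F(1)
    proof (rule eventually_ball_finite, safe)
      fix c assume "c \<in> F"
      from tendstoD[OF lim[OF this], of "r'' - r'"] r''
      show "\<forall>\<^sub>F s in at s0. \<bar>\<gamma> s c - q c\<bar> < r'' - r'" by (simp add: dist_real_def)
    qed
    hence ev: "\<forall>\<^sub>F s in at s0. \<gamma> s \<in> pbox F p r''"
      by eventually_elim (use q in \<open>force simp: pbox_def\<close>)
    have q0: "\<gamma> s0 \<in> pbox F p r''" using q s0 r'' by (force simp: pbox_def)
    have q1: "\<gamma> s0 \<in> pbox F p r'" using q s0 r'' by (force simp: pbox_def)
    show ?thesis unfolding has_field_derivative_iff
    proof (rule Lim_transform_eventually)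
      show "((\<lambda>s. \<Sum>c\<in>F. (\<gamma> s c - \<gamma> s0 c) / (s - s0) * K c (pjoin (\<gamma> s) (\<gamma> s0))) \<longlongrightarrow>
          (\<Sum>c\<in>F. D c * K c (pjoin q q))) (at s0)"
      proof (intro tendsto_sum tendsto_mult)
        fix c assume c: "c \<in> F"
        show "((\<lambda>s. (\<gamma> s c - \<gamma> s0 c) / (s - s0)) \<longlongrightarrow> D c) (at s0)"
          using D[OF c] by (simp add: has_field_derivative_iff)
        show "((\<lambda>s. K c (pjoin (\<gamma> s) (\<gamma> s0))) \<longlongrightarrow> K c (pjoin q q)) (at s0)"
        proof (rule majorized_tendsto[OF _ F(2) r''(1) K[OF c]])
          show "pjoin q q \<in> pbox (F \<times> UNIV) (pjoin p p) r'" by (intro join_in_pbox q)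
          show "((\<lambda>s. pjoin (\<gamma> s) (\<gamma> s0) e) \<longlongrightarrow> pjoin q q e) (at s0)" if "e \<in> F \<times> UNIV" for e
            using that lim s0 by (cases "snd e") (auto simp: pjoin_def case_prod_unfold)
        qed (use F in auto)
      qed
      show "\<forall>\<^sub>F s in at s0. (\<Sum>c\<in>F. (\<gamma> s c - \<gamma> s0 c) / (s - s0) * K c (pjoin (\<gamma> s) (\<gamma> s0))) =
          (g (\<gamma> s) - g (\<gamma> s0)) / (s - s0)"
        using ev by eventually_elim (simp add: d[OF _ q0] sum_divide_distrib)
    qed
  qed
  have der: "((\<lambda>s. g (q(c := s))) has_real_derivative K c (pjoin q q)) (at (q c))"
    if c: "c \<in> F" and q: "q \<in> pbox F p r'" for q c
  proof -
    have "((\<lambda>s. g (q(c := s))) has_real_derivative (\<Sum>e\<in>F. (if e = c then 1 else 0) * K e (pjoin q q))) (at (q c))"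
      by (rule chain[OF q]) (auto intro!: derivative_eq_intros)
    also have "(\<Sum>e\<in>F. (if e = c then 1 else 0) * K e (pjoin q q)) = K c (pjoin q q)"
      using F c by (simp add: if_distrib if_distribR sum.delta cong: if_cong)
    finally show ?thesis .
  qed
  have pd: "pdiff c g q = K c (pjoin q q)" if c: "c \<in> F" and q: "q \<in> pbox F p r'" for q c
    unfolding pdiff_def by (rule DERIV_imp_deriv[OF der[OF that]])
  show thesis
  proof (rule that)
    fix c assume c: "c \<in> F"
    have "majorized F p r' M' (\<lambda>q. K c (pjoin q q))"
      by (rule majorized_compose[OF _ r''(2) F(1,2) K[OF c]])
         (use F r'' in \<open>auto simp: pjoin_def intro!: majorized_coord\<close>)
    thus "majorized F p r' M' (pdiff c g)"
      by (rule majorized_cong) (use pd c in simp)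
  next
    show "((\<lambda>s. g (q(c := s))) has_real_derivative pdiff c g q) (at (q c))"
      if "c \<in> F" "q \<in> pbox F p r'" for q c
      using der[OF that] pd[OF that] by simp
  next
    fix q \<gamma> D s0 assume q: "q \<in> pbox F p r'" and s0: "\<And>c. c \<in> F \<Longrightarrow> \<gamma> s0 c = q c"
      and D: "\<And>c. c \<in> F \<Longrightarrow> ((\<lambda>s. \<gamma> s c) has_real_derivative D c) (at s0)"
    have "(\<Sum>c\<in>F. D c * pdiff c g q) = (\<Sum>c\<in>F. D c * K c (pjoin q q))"
      by (intro sum.cong) (use pd q in auto)
    thus "((\<lambda>s. g (\<gamma> s)) has_real_derivative (\<Sum>c\<in>F. D c * pdiff c g q)) (at s0)"
      using chain[OF q s0 D] by simp
  qed
qed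

text \<open>
  Without a constant term every monomial gains at least one factor \<open>t\<close>. This makes contraction
  constants and initial errors small.
\<close>

lemma majorized_eq_zero_shrink:
  assumes F: "finite F" "r > 0" and g: "majorized F p r M g" and 0: "g p = 0" and t: "0 < t" "t \<le> 1"
  shows "majorized F p (t * r) (t * M) g"
proof -
  define E where "E = (F \<rightarrow>\<^sub>E (UNIV :: nat set))"
  obtain a N where a: "((\<lambda>\<mu>. \<bar>a \<mu>\<bar> * r ^ sum \<mu> F) has_sum N) E" "N \<le> M"
    "\<And>q. q \<in> pbox F p r \<Longrightarrow> ((\<lambda>\<mu>. a \<mu> * mpow F p \<mu> q) has_sum g q) E"
    using g unfolding majorized_def E_def by blast
  define z where "z = (\<lambda>c\<in>F. 0 :: nat)"
  have zE: "z \<in> E" by (auto simp: z_def E_def)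
  have pos: "sum \<mu> F > 0" if "\<mu> \<in> E" "\<mu> \<noteq> z" for \<mu>
  proof (rule ccontr)
    assume "\<not> sum \<mu> F > 0"
    hence "\<forall>c\<in>F. \<mu> c = 0" using F by simp
    hence "\<mu> = z" using that by (auto simp: z_def E_def PiE_def extensional_def)
    thus False using that by simp
  qed
  have m0: "mpow F p \<mu> p = (if \<mu> = z then 1 else 0)" if "\<mu> \<in> E" for \<mu>
  proof (cases "\<mu> = z")
    case False
    from pos[OF that False] obtain c where "c \<in> F" "\<mu> c > 0"
      by (metis gr0I less_numeral_extra(3) sum.neutral)
    thus ?thesis using F False by (auto simp: mpow_def)
  qed (simp add: mpow_def z_def)
  have "p \<in> pbox F p r" using F by (simp add: pbox_def)
  hence "((\<lambda>\<mu>. a \<mu> * mpow F p \<mu> p) has_sum 0) E" using a(3) 0 by force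
  moreover have "((\<lambda>\<mu>. a \<mu> * mpow F p \<mu> p) has_sum a z) E"
    by (rule has_sum_finite_neutralI[where B = "{z}"]) (use m0 zE in auto)
  ultimately have az: "a z = 0" by (metis has_sum_unique)
  have le: "\<bar>a \<mu>\<bar> * (t * r) ^ sum \<mu> F \<le> t * (\<bar>a \<mu>\<bar> * r ^ sum \<mu> F)" if "\<mu> \<in> E" for \<mu>
  proof (cases "\<mu> = z")
    case False
    have "t ^ sum \<mu> F \<le> t ^ 1" using pos[OF that False] t by (intro power_decreasing) auto
    hence "t ^ sum \<mu> F * (\<bar>a \<mu>\<bar> * r ^ sum \<mu> F) \<le> t * (\<bar>a \<mu>\<bar> * r ^ sum \<mu> F)"
      using F by (intro mult_right_mono) auto
    thus ?thesis by (simp add: power_mult_distrib mult_ac)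
  qed (simp add: az)
  have tN: "((\<lambda>\<mu>. t * (\<bar>a \<mu>\<bar> * r ^ sum \<mu> F)) has_sum t * N) E" by (rule has_sum_cmult_right[OF a(1)])
  have s: "(\<lambda>\<mu>. \<bar>a \<mu>\<bar> * (t * r) ^ sum \<mu> F) summable_on E"
    by (rule summable_on_comparison_test[OF has_sum_imp_summable[OF tN] le]) (use F t in auto)
  show ?thesis unfolding majorized_def E_def[symmetric]
  proof (intro exI conjI ballI)
    show "((\<lambda>\<mu>. \<bar>a \<mu>\<bar> * (t * r) ^ sum \<mu> F) has_sum infsum (\<lambda>\<mu>. \<bar>a \<mu>\<bar> * (t * r) ^ sum \<mu> F) E) E"
      using s by (rule has_sum_infsum)
    from has_sum_mono[OF this tN le] a(2) t
    show "infsum (\<lambda>\<mu>. \<bar>a \<mu>\<bar> * (t * r) ^ sum \<mu> F) E \<le> t * M"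
      by (meson mult_left_mono order_less_imp_le order_trans)
    fix q assume "q \<in> pbox F p (t * r)"
    moreover have "t * r \<le> r" using t F by (simp add: mult_le_cancel_right1)
    ultimately have "q \<in> pbox F p r" by (force simp: pbox_def)
    thus "((\<lambda>\<mu>. a \<mu> * mpow F p \<mu> q) has_sum g q) E" by (rule a(3))
  qed
qed

section \<open>Fixed points of analytic contractions\<close>

text \<open>
  Apply the hypothesis to the largest of the finitely many values.
\<close>

lemma contraction_kernel_eq_zero:
  fixes v :: "'c \<Rightarrow> real"
  assumes "finite J" and le: "\<And>\<delta> c. \<lbrakk>\<And>c. c \<in> J \<Longrightarrow> \<bar>v c\<bar> \<le> \<delta>; c \<in> J\<rbrakk> \<Longrightarrow> \<bar>v c\<bar> \<le> \<delta> / 2"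
    and "c \<in> J"
  shows "v c = 0"
proof -
  define \<delta> where "\<delta> = Max ((\<lambda>c. \<bar>v c\<bar>) ` J)"
  have ge: "\<bar>v c\<bar> \<le> \<delta>" if "c \<in> J" for c unfolding \<delta>_def using assms that by (intro Max_ge) auto
  have "\<delta> \<in> (\<lambda>c. \<bar>v c\<bar>) ` J" unfolding \<delta>_def using assms by (intro Max_in) auto
  then obtain c' where "c' \<in> J" "\<delta> = \<bar>v c'\<bar>" by auto
  hence "\<delta> \<le> \<delta> / 2" using le[OF ge] by auto
  moreover have "\<delta> \<ge> 0" using ge[OF \<open>c \<in> J\<close>] by linarith
  ultimately show ?thesis using ge[OF \<open>c \<in> J\<close>] by simp
qed

lemma pbox_mono: "q \<in> pbox F p r \<Longrightarrow> F' \<subseteq> F \<Longrightarrow> r \<le> r' \<Longrightarrow> q \<in> pbox F' p r'"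
  by (fastforce simp: pbox_def)

text \<open>
  Since \<open>H\<close> and its derivatives in the directions \<open>J\<close> vanish at \<open>p\<close>, on a small polydisc \<open>H\<close> contracts
  differences in the variables \<open>J\<close> by the factor \<open>1/2\<close>, both pointwise and in the norm of power
  series. The radius \<open>r1\<close> of the remaining variables is then chosen so small that the first iterate
  has norm \<open>R/4\<close>, and the iterates converge within \<open>R/2\<close>. The strict inclusion in the polydisc of
  radius \<open>R\<close> makes it possible later to use open neighbourhoods.
\<close>

lemma analytic_fixed_point:
  fixes H :: "'c \<Rightarrow> ('c \<Rightarrow> real) \<Rightarrow> real"
  assumes fin: "finite X" "finite J" and disj: "X \<inter> J = {}" and r: "r > 0" and eps: "\<epsilon> > 0"
    and H: "\<And>c. c \<in> J \<Longrightarrow> majorized (X \<union> J) p r M (H c)"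
    and H0: "\<And>c. c \<in> J \<Longrightarrow> H c p = 0"
    and H1: "\<And>c c'. c \<in> J \<Longrightarrow> c' \<in> J \<Longrightarrow> pdiff c' (H c) p = 0"
  obtains r1 R h where "0 < r1" "r1 \<le> R" "R \<le> r" "R \<le> \<epsilon>"
    and "\<And>c. c \<in> J \<Longrightarrow> majorized X p r1 (R / 2) (\<lambda>q. h c q - p c)"
    and "\<And>q. q \<in> pbox X p r1 \<Longrightarrow> q \<in> pbox J p R \<Longrightarrow>
           (\<forall>c\<in>J. q c - p c = H c q) \<longleftrightarrow> (\<forall>c\<in>J. q c = h c q)"
proof -
  define F where "F = X \<union> J"
  have F: "finite F" using fin by (simp add: F_def)
  note F2 = finite_cartesian_product[OF F finite_class.finite_UNIV[where 'a = bool]]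
  have r2: "0 < r / 2" "r / 2 < r" using r by auto
  have "\<forall>c\<in>J. \<exists>K M'. (\<forall>c'\<in>F. majorized (F \<times> UNIV) (pjoin p p) (r / 2) M' (K c')) \<and>
    (\<forall>q\<in>pbox F p (r / 2). \<forall>q'\<in>pbox F p (r / 2). H c q - H c q' = (\<Sum>c'\<in>F. (q c' - q' c') * K c' (pjoin q q')))"
  proof
    fix c assume "c \<in> J"
    obtain K M' where KM: "\<And>c'. c' \<in> F \<Longrightarrow> majorized (F \<times> UNIV) (pjoin p p) (r / 2) M' (K c')"
      "\<And>q q'. q \<in> pbox F p (r / 2) \<Longrightarrow> q' \<in> pbox F p (r / 2) \<Longrightarrow>
         H c q - H c q' = (\<Sum>c'\<in>F. (q c' - q' c') * K c' (pjoin q q'))"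
      by (rule majorized_two_point[OF F r2 H[OF \<open>c \<in> J\<close>, folded F_def]]) blast
    show "\<exists>K M'. (\<forall>c'\<in>F. majorized (F \<times> UNIV) (pjoin p p) (r / 2) M' (K c')) \<and>
    (\<forall>q\<in>pbox F p (r / 2). \<forall>q'\<in>pbox F p (r / 2). H c q - H c q' = (\<Sum>c'\<in>F. (q c' - q' c') * K c' (pjoin q q')))"
      by (intro exI[of _ K] exI[of _ M'] conjI ballI KM)
  qed
  from bchoice[OF this] obtain K where "\<forall>c\<in>J. \<exists>M'. (\<forall>c'\<in>F. majorized (F \<times> UNIV) (pjoin p p) (r / 2) M' (K c c')) \<and>
    (\<forall>q\<in>pbox F p (r / 2). \<forall>q'\<in>pbox F p (r / 2). H c q - H c q' = (\<Sum>c'\<in>F. (q c' - q' c') * K c c' (pjoin q q')))" ..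
  from bchoice[OF this] obtain M' where
    K: "\<And>c c'. c \<in> J \<Longrightarrow> c' \<in> F \<Longrightarrow> majorized (F \<times> UNIV) (pjoin p p) (r / 2) (M' c) (K c c')"
    and Kd: "\<And>c q q'. c \<in> J \<Longrightarrow> q \<in> pbox F p (r / 2) \<Longrightarrow> q' \<in> pbox F p (r / 2) \<Longrightarrow>
       H c q - H c q' = (\<Sum>c'\<in>F. (q c' - q' c') * K c c' (pjoin q q'))" by blast
  have pr: "p \<in> pbox F p (r / 2)" using r by (simp add: pbox_def)
  \<comment> \<open>The coefficients on the diagonal are the partial derivatives of \<open>H\<close>, which vanish at \<open>p\<close>.\<close>
  have K0: "K c c' (pjoin p p) = 0" if c: "c \<in> J" "c' \<in> J" for c c'
  proof -
    have c'F: "c' \<in> F" using c by (simp add: F_def)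
    have ev: "\<forall>\<^sub>F s in at (p c'). p(c' := s) \<in> pbox F p (r / 2)"
      by (rule eventually_mono[OF eventually_at_ball[OF r2(1), of "p c'" UNIV]]) (use r in \<open>auto simp: pbox_def dist_real_def abs_minus_commute\<close>)
    have "((\<lambda>s. K c c' (pjoin (p(c' := s)) p)) \<longlongrightarrow> K c c' (pjoin p p)) (at (p c'))"
    proof (rule majorized_tendsto[OF F2 _ _ K[OF c(1) c'F], of "r / 4"])
      show "((\<lambda>s. pjoin (p(c' := s)) p e) \<longlongrightarrow> pjoin p p e) (at (p c'))" for e
        by (cases "snd e"; cases "fst e = c'") (auto simp: pjoin_def case_prod_unfold intro!: tendsto_eq_intros)
    qed (use r in \<open>auto simp: pbox_def\<close>)
    moreover have "(H c (p(c' := s)) - H c p) / (s - p c') = K c c' (pjoin (p(c' := s)) p)"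
      if "p(c' := s) \<in> pbox F p (r / 2)" "s \<noteq> p c'" for s
    proof -
      have "H c (p(c' := s)) - H c p = (\<Sum>e\<in>F. if e = c' then (s - p c') * K c c' (pjoin (p(c' := s)) p) else 0)"
        unfolding Kd[OF c(1) that(1) pr] by (intro sum.cong) auto
      thus ?thesis using F c'F that by (simp add: sum.delta)
    qed
    ultimately have "((\<lambda>s. (H c (p(c' := s)) - H c (p(c' := p c'))) / (s - p c')) \<longlongrightarrow> K c c' (pjoin p p)) (at (p c'))"
    proof (elim Lim_transform_eventually)
    qed (use ev eventually_neq_at_within[of "p c'" "p c'" UNIV] in eventually_elim, simp)
    hence "((\<lambda>s. H c (p(c' := s))) has_real_derivative K c c' (pjoin p p)) (at (p c'))"
      by (simp add: has_field_derivative_iff)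
    from DERIV_imp_deriv[OF this] H1[OF c] show ?thesis by (simp add: pdiff_def)
  qed
  define B where "B = 1 + (\<Sum>c\<in>J. \<bar>M' c\<bar>) + \<bar>M\<bar>"
  have B: "B \<ge> 1" "\<And>c. c \<in> J \<Longrightarrow> M' c \<le> B" "M \<le> B"
  proof -
    have "0 \<le> (\<Sum>c\<in>J. \<bar>M' c\<bar>)" by (intro sum_nonneg) auto
    thus "B \<ge> 1" "M \<le> B" unfolding B_def by linarith+
    show "M' c \<le> B" if "c \<in> J" for c
      using member_le_sum[OF that, of "\<lambda>c. \<bar>M' c\<bar>"] fin by (auto simp: B_def)
  qed
  define k where "k = real (card J) + 1"
  \<comment> \<open>\<open>t\<close> makes the sum of the \<open>card J\<close> coefficients, each of norm \<open>t * B\<close>, at most \<open>1/2\<close>.\<close>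
  define t where "t = min (1 / (2 * k * B)) (min 1 (\<epsilon> / r))"
  have t: "0 < t" "t \<le> 1" "t * r \<le> \<epsilon>" "t * (k * B) \<le> 1 / 2"
  proof -
    have kB: "k * B > 0" using B(1) by (simp add: k_def)
    show "0 < t" "t \<le> 1" using kB r eps by (auto simp: t_def mult.assoc)
    have "t \<le> \<epsilon> / r" by (simp add: t_def)
    thus "t * r \<le> \<epsilon>" using r by (simp add: field_simps)
    have "t \<le> 1 / (2 * k * B)" by (simp add: t_def)
    thus "t * (k * B) \<le> 1 / 2" using kB by (simp add: field_simps)
  qed
  define R where "R = t * (r / 2)"
  have R: "0 < R" "R \<le> r / 2" "R \<le> \<epsilon>"
    using t r eps by (auto simp: R_def mult_le_cancel_right1)
  have KR: "majorized (F \<times> UNIV) (pjoin p p) R (t * B) (K c c')" if "c \<in> J" "c' \<in> J" for c c'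
  proof -
    have "c' \<in> F" using that by (simp add: F_def)
    from majorized_mono[OF K[OF that(1) this] B(2)[OF that(1)]]
    show ?thesis unfolding R_def
      by (rule majorized_eq_zero_shrink[where g = "K c c'" and p = "pjoin p p", OF F2 r2(1) _ K0[OF that] t(1,2)])
  qed
  have RF: "q \<in> pbox F p (r / 2)" if "q \<in> pbox F p R" for q by (rule pbox_mono[OF that order_refl R(2)])
  have HdJ: "H c q - H c q' = (\<Sum>c'\<in>J. (q c' - q' c') * K c c' (pjoin q q'))"
    if "c \<in> J" "q \<in> pbox F p R" "q' \<in> pbox F p R" "\<And>x. x \<in> X \<Longrightarrow> q x = q' x" for c q q'
    unfolding Kd[OF that(1) RF[OF that(2)] RF[OF that(3)]]
    by (intro sum.mono_neutral_right F) (use that in \<open>auto simp: F_def\<close>)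
  have Bk: "real (card J) * (\<delta> * (t * B)) \<le> \<delta> / 2" if "\<delta> \<ge> 0" for \<delta>
  proof -
    have "real (card J) * (\<delta> * (t * B)) \<le> k * (\<delta> * (t * B))"
      using that t B by (intro mult_right_mono) (auto simp: k_def)
    also have "\<dots> = \<delta> * (t * (k * B))" by simp
    also have "\<dots> \<le> \<delta> * (1 / 2)" using t(4) that by (intro mult_left_mono)
    finally show ?thesis by simp
  qed
  have lip: "\<bar>H c q - H c q'\<bar> \<le> \<delta> / 2"
    if "c \<in> J" "q \<in> pbox F p R" "q' \<in> pbox F p R" "\<And>x. x \<in> X \<Longrightarrow> q x = q' x"
      "\<And>c. c \<in> J \<Longrightarrow> \<bar>q c - q' c\<bar> \<le> \<delta>" for c q q' \<delta>
  proof -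
    have \<delta>: "\<delta> \<ge> 0" using that(5)[OF that(1)] by linarith
    have "\<bar>H c q - H c q'\<bar> \<le> (\<Sum>c'\<in>J. \<bar>(q c' - q' c') * K c c' (pjoin q q')\<bar>)"
      by (subst HdJ[OF that(1-3)]) (use that(4) in \<open>auto intro: sum_abs\<close>)
    also have "\<dots> \<le> (\<Sum>c'\<in>J. \<delta> * (t * B))"
      unfolding abs_mult using that \<delta>
      by (intro sum_mono mult_mono majorized_bound[OF KR] join_in_pbox) auto
    also have "\<dots> \<le> \<delta> / 2" using Bk[OF \<delta>] by simp
    finally show ?thesis .
  qed
  define M1 where "M1 = max 1 M"
  \<comment> \<open>The first iterate has norm at most \<open>M1\<close> on radius \<open>R\<close> and vanishes at \<open>p\<close>, so the factor \<open>t1\<close>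
    brings it down to \<open>R / 4\<close>.\<close>
  define t1 where "t1 = min 1 (R / (4 * M1))"
  have t1: "0 < t1" "t1 \<le> 1" "t1 * M1 \<le> R / 4"
  proof -
    have "M1 > 0" by (simp add: M1_def)
    thus "0 < t1" "t1 \<le> 1" using R by (auto simp: t1_def)
    have "t1 \<le> R / (4 * M1)" by (simp add: t1_def)
    thus "t1 * M1 \<le> R / 4" using \<open>M1 > 0\<close> by (simp add: field_simps)
  qed
  define r1 where "r1 = t1 * R"
  have r1: "0 < r1" "r1 \<le> R" using t1 R by (auto simp: r1_def mult_le_cancel_right1)
  define W where "W = rec_nat (\<lambda>q c. if c \<in> J then p c else q c)
     (\<lambda>_ w q c. if c \<in> J then p c + H c (w q) else q c)"
  have W0: "W 0 q = (\<lambda>c. if c \<in> J then p c else q c)" for q by (simp add: W_def)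
  have WS: "W (Suc n) q = (\<lambda>c. if c \<in> J then p c + H c (W n q) else q c)" for n q
    unfolding W_def by simp
  have WX: "W n q c = q c" if "c \<notin> J" for n q c using that by (cases n) (auto simp: W0 WS)
  have XJ: "x \<notin> J" if "x \<in> X" for x using that disj by auto
  have coordX: "majorized X p r1 R (\<lambda>q. W n q c - p c)" if "c \<in> X" for n c
    using majorized_coord[OF fin(1) that r1] disj that by (subst WX) auto
  have start: "majorized X p r1 (R / 4) (\<lambda>q. H c (W 0 q))" if c: "c \<in> J" for c
  proof -
    have "majorized X p R M1 (\<lambda>q. H c (W 0 q))"
    proof (rule majorized_compose[OF F r fin(1) R(1) majorized_mono[OF H[OF c, folded F_def]]])
      fix c' assume c': "c' \<in> F"
      show "majorized X p R r (\<lambda>q. W 0 q c' - p c')"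
      proof (cases "c' \<in> J")
        case True
        thus ?thesis using R r by (auto simp: W0 intro!: majorized_const fin)
      next
        case False
        hence "c' \<in> X" using c' by (auto simp: F_def)
        thus ?thesis using False R by (auto simp: W0 intro!: majorized_coord fin)
      qed
    qed (simp add: M1_def)
    moreover have "W 0 p = p" by (auto simp: W0)
    ultimately have "majorized X p (t1 * R) (t1 * M1) (\<lambda>q. H c (W 0 q))"
      using H0[OF c] by (intro majorized_eq_zero_shrink[where g = "\<lambda>q. H c (W 0 q)"] fin R t1) auto
    thus ?thesis unfolding r1_def using t1(3) by (rule majorized_mono)
  qed
  have step: "majorized X p r1 (\<delta> / 2) (\<lambda>q. H c (\<Phi> q) - H c (\<Psi> q))"
    if c: "c \<in> J" and \<delta>: "\<delta> \<ge> 0"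
      and \<Phi>: "\<And>c. c \<in> F \<Longrightarrow> majorized X p r1 R (\<lambda>q. \<Phi> q c - p c)"
      and \<Psi>: "\<And>c. c \<in> F \<Longrightarrow> majorized X p r1 R (\<lambda>q. \<Psi> q c - p c)"
      and d: "\<And>c. c \<in> J \<Longrightarrow> majorized X p r1 \<delta> (\<lambda>q. \<Phi> q c - \<Psi> q c)"
      and eq: "\<And>q x. x \<in> X \<Longrightarrow> \<Phi> q x = \<Psi> q x" for c \<delta> \<Phi> \<Psi>
  proof -
    have "majorized X p r1 (\<delta> / 2) (\<lambda>q. \<Sum>c'\<in>J. (\<Phi> q c' - \<Psi> q c') * K c c' (pjoin (\<Phi> q) (\<Psi> q)))"
    proof (rule majorized_sum[OF fin(1) r1(1) fin(2)])
      fix c' assume c': "c' \<in> J"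
      have "majorized X p r1 (t * B) (\<lambda>q. K c c' (pjoin (\<Phi> q) (\<Psi> q)))"
      proof (rule majorized_compose[OF F2 R(1) fin(1) r1(1) KR[OF c c']])
        show "majorized X p r1 R (\<lambda>q. pjoin (\<Phi> q) (\<Psi> q) e - pjoin p p e)" if "e \<in> F \<times> UNIV" for e
          using that \<Phi> \<Psi> by (cases "snd e") (auto simp: pjoin_def case_prod_unfold)
      qed
      thus "majorized X p r1 (\<delta> * (t * B)) (\<lambda>q. (\<Phi> q c' - \<Psi> q c') * K c c' (pjoin (\<Phi> q) (\<Psi> q)))"
        by (rule majorized_mult[OF fin(1) r1(1) d[OF c']]) simp
    qed (use Bk[OF \<delta>] in simp)
    thus ?thesis
    proof (rule majorized_cong)
      fix q assume q: "q \<in> pbox X p r1"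
      have "\<Phi> q \<in> pbox F p R" "\<Psi> q \<in> pbox F p R"
        using majorized_bound[OF \<Phi> q] majorized_bound[OF \<Psi> q] by (auto simp: pbox_def)
      thus "(\<Sum>c'\<in>J. (\<Phi> q c' - \<Psi> q c') * K c c' (pjoin (\<Phi> q) (\<Psi> q))) = H c (\<Phi> q) - H c (\<Psi> q)"
        using HdJ[OF c] eq by simp
    qed
  qed
  have WF: "\<And>c. c \<in> F \<Longrightarrow> majorized X p r1 R (\<lambda>q. W n q c - p c)"
    if "\<And>c. c \<in> J \<Longrightarrow> majorized X p r1 (R / 2 * (1 - (1 / 2) ^ n)) (\<lambda>q. W n q c - p c)" for n
  proof -
    fix c assume c: "c \<in> F"
    show "majorized X p r1 R (\<lambda>q. W n q c - p c)"
    proof (cases "c \<in> J")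
      case True
      have "R / 2 * (1 - (1 / 2) ^ n) \<le> R / 2 * 1" using R by (intro mult_left_mono) auto
      hence "R / 2 * (1 - (1 / 2) ^ n) \<le> R" using R by linarith
      thus ?thesis by (rule majorized_mono[OF that[OF True]])
    next
      case False
      hence "c \<in> X" using c by (simp add: F_def)
      thus ?thesis by (rule coordX)
    qed
  qed
  have main: "(\<forall>c\<in>J. majorized X p r1 (R / 2 * (1 - (1 / 2) ^ n)) (\<lambda>q. W n q c - p c)) \<and>
     (\<forall>c\<in>J. majorized X p r1 (R / 4 * (1 / 2) ^ n) (\<lambda>q. W (Suc n) q c - W n q c))" for n
  proof (induction n)
    case 0
    show ?case using start r1 by (auto simp: WS[of 0] W0 intro!: majorized_const fin)
  next
    case (Suc n)
    have a: "majorized X p r1 (R / 2 * (1 - (1 / 2) ^ Suc n)) (\<lambda>q. W (Suc n) q c - p c)" if c: "c \<in> J" for c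
    proof -
      have "majorized X p r1 (R / 2 * (1 - (1 / 2) ^ Suc n)) (\<lambda>q. (W n q c - p c) + (W (Suc n) q c - W n q c))"
        by (rule majorized_add[OF fin(1) r1(1), of p "R / 2 * (1 - (1 / 2) ^ n)" _ "R / 4 * (1 / 2) ^ n"])
           (use Suc c in \<open>auto simp: algebra_simps\<close>)
      thus ?thesis by simp
    qed
    have b: "majorized X p r1 (R / 4 * (1 / 2) ^ Suc n) (\<lambda>q. W (Suc (Suc n)) q c - W (Suc n) q c)" if c: "c \<in> J" for c
    proof -
      have "majorized X p r1 (R / 4 * (1 / 2) ^ n / 2) (\<lambda>q. H c (W (Suc n) q) - H c (W n q))"
      proof (rule step[OF c])
        show "\<And>c. c \<in> F \<Longrightarrow> majorized X p r1 R (\<lambda>q. W (Suc n) q c - p c)" by (rule WF[OF a])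
        show "\<And>c. c \<in> F \<Longrightarrow> majorized X p r1 R (\<lambda>q. W n q c - p c)" by (rule WF) (use Suc in blast)
        show "\<And>c. c \<in> J \<Longrightarrow> majorized X p r1 (R / 4 * (1 / 2) ^ n) (\<lambda>q. W (Suc n) q c - W n q c)"
          using Suc by blast
        show "W (Suc n) q x = W n q x" if "x \<in> X" for q x
          by (simp add: WX XJ[OF that])
      qed (use R in simp)
      thus ?thesis using c by (simp add: WS)
    qed
    show ?case using a b by blast
  qed
  define V where "V q c = (if c \<in> J then p c + (\<Sum>\<^sub>\<infinity>n. W (Suc n) q c - W n q c) else q c)" for q c
  have geo: "((\<lambda>n. R / 4 * (1 / 2) ^ n) has_sum (R / 2)) UNIV"
  proof (rule sums_nonneg_imp_has_sum)
    show "(\<lambda>n. R / 4 * (1 / 2) ^ n) sums (R / 2)"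
      using sums_mult[OF geometric_sums[of "1 / 2 :: real"], of "R / 4"] by simp
  qed (use R in simp)
  have hs: "((\<lambda>n. W (Suc n) q c - W n q c) has_sum (V q c - p c)) UNIV" if c: "c \<in> J" and q: "q \<in> pbox X p r1" for c q
  proof -
    have "(\<lambda>n. norm (W (Suc n) q c - W n q c)) summable_on UNIV"
    proof (rule Infinite_Sum.abs_summable_on_comparison_test'[OF has_sum_imp_summable[OF geo]])
      show "norm (W (Suc n) q c - W n q c) \<le> R / 4 * (1 / 2) ^ n" for n
        using majorized_bound[OF _ q] main c unfolding real_norm_def by blast
    qed
    hence "(\<lambda>n. W (Suc n) q c - W n q c) summable_on UNIV" by (rule abs_summable_summable)
    thus ?thesis using c by (simp add: V_def)
  qed
  have hmaj: "majorized X p r1 (R / 2) (\<lambda>q. V q c - p c)" if c: "c \<in> J" for c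
  proof (rule majorized_has_sum[OF fin(1) r1(1) _ geo order_refl hs[OF c]])
    show "majorized X p r1 (R / 4 * (1 / 2) ^ n) (\<lambda>q. W (Suc n) q c - W n q c)" for n
      using main c by blast
  qed
  have lim: "(\<lambda>n. W n q c) \<longlonglongrightarrow> V q c" if c: "c \<in> J" and q: "q \<in> pbox X p r1" for c q
  proof -
    have "(\<lambda>n. W (Suc n) q c - W n q c) sums (V q c - p c)"
      by (rule has_sum_imp_sums[OF hs[OF that]])
    hence "(\<lambda>n. W n q c - W 0 q c) \<longlonglongrightarrow> V q c - p c" 
      unfolding sums_def sum_lessThan_telescope[of "\<lambda>n. W n q c"] .
    from tendsto_add[OF this tendsto_const[of "p c"]] show ?thesis using c by (simp add: W0)
  qed
  have VX: "V q x = q x" if "x \<notin> J" for q x using that by (simp add: V_def)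
  have Vbox: "V q \<in> pbox F p R" if q: "q \<in> pbox X p r1" for q
  proof -
    have "\<bar>V q c - p c\<bar> \<le> R" if "c \<in> F" for c
    proof (cases "c \<in> J")
      case True
      from majorized_bound[OF hmaj[OF True] q] R show ?thesis by simp
    next
      case False
      hence "c \<in> X" using that by (simp add: F_def)
      thus ?thesis using q r1 VX[OF False] by (force simp: pbox_def)
    qed
    thus ?thesis by (simp add: pbox_def)
  qed
  have fixpt: "V q c - p c = H c (V q)" if c: "c \<in> J" and q: "q \<in> pbox X p r1" for c q
  proof -
    define D where "D n = (\<Sum>c\<in>J. \<bar>W n q c - V q c\<bar>)" for n
    have "D \<longlonglongrightarrow> (\<Sum>c\<in>J. \<bar>V q c - V q c\<bar>)"
      unfolding D_def by (intro tendsto_intros lim q)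
    hence "D \<longlonglongrightarrow> 0" by simp
    have Wn: "W n q \<in> pbox F p R" for n
      using majorized_bound[OF WF q] main unfolding pbox_def by blast
    have "\<bar>H c (W n q) - H c (V q)\<bar> \<le> D n / 2" for n
    proof (rule lip[OF c Wn Vbox[OF q]])
      show "W n q x = V q x" if "x \<in> X" for x
        using WX[OF XJ[OF that]] VX[OF XJ[OF that]] by simp
      show "\<bar>W n q c - V q c\<bar> \<le> D n" if "c \<in> J" for c
        unfolding D_def using fin that by (intro member_le_sum) auto
    qed
    hence "\<forall>\<^sub>F n in sequentially. norm (H c (W n q) - H c (V q)) \<le> D n / 2" by simp
    moreover have "(\<lambda>n. D n / 2) \<longlonglongrightarrow> 0" using \<open>D \<longlonglongrightarrow> 0\<close> by (rule tendsto_divide_zero)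
    ultimately have "(\<lambda>n. H c (W n q) - H c (V q)) \<longlonglongrightarrow> 0" by (rule Lim_null_comparison)
    hence "(\<lambda>n. H c (W n q)) \<longlonglongrightarrow> H c (V q)" by (simp add: LIM_zero_iff)
    moreover have "(\<lambda>n. H c (W n q)) = (\<lambda>n. W (Suc n) q c - p c)" using c by (simp add: WS)
    moreover have "(\<lambda>n. W (Suc n) q c - p c) \<longlonglongrightarrow> V q c - p c"
      by (intro tendsto_intros LIMSEQ_Suc lim c q)
    ultimately show ?thesis by (metis LIMSEQ_unique)
  qed
  show thesis
  proof (rule that[of r1 R "\<lambda>c q. V q c"])
    show "0 < r1" "r1 \<le> R" "R \<le> r" "R \<le> \<epsilon>" using r1 R r by auto
    show "majorized X p r1 (R / 2) (\<lambda>q. V q c - p c)" if "c \<in> J" for c using hmaj[OF that] .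
    fix q assume q: "q \<in> pbox X p r1" "q \<in> pbox J p R"
    have qF: "q \<in> pbox F p R" using q r1 by (force simp: pbox_def F_def)
    show "(\<forall>c\<in>J. q c - p c = H c q) \<longleftrightarrow> (\<forall>c\<in>J. q c = V q c)"
    proof
      assume s: "\<forall>c\<in>J. q c - p c = H c q"
      have "q c - V q c = 0" if "c \<in> J" for c
        using fin(2) _ that
      proof (rule contraction_kernel_eq_zero)
        fix \<delta> c assume \<delta>: "\<And>c. c \<in> J \<Longrightarrow> \<bar>q c - V q c\<bar> \<le> \<delta>" and c: "c \<in> J"
        have "q c - V q c = H c q - H c (V q)" using s fixpt[OF c q(1)] c by force
        also have "\<bar>\<dots>\<bar> \<le> \<delta> / 2"
        proof (rule lip[OF c qF Vbox[OF q(1)] _ \<delta>])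
          show "q x = V q x" if "x \<in> X" for x using VX[OF XJ[OF that]] by simp
        qed
        finally show "\<bar>q c - V q c\<bar> \<le> \<delta> / 2" .
      qed
      thus "\<forall>c\<in>J. q c = V q c" by simp
    next
      assume s: "\<forall>c\<in>J. q c = V q c"
      have "V q = q"
      proof
        show "V q x = q x" for x using s VX[of x q] by (cases "x \<in> J") auto
      qed
      thus "\<forall>c\<in>J. q c - p c = H c q" using fixpt[OF _ q(1)] by auto
    qed
  qed
qed

section \<open>Nonsingular matrices over finite index sets\<close>

text \<open>
  Rows and columns keep their own index sets because blocks of a matrix are selected by subsets of
  equations and of variables.
\<close>

definition nonsingular_on :: "'i set \<Rightarrow> 'j set \<Rightarrow> ('i \<Rightarrow> 'j \<Rightarrow> real) \<Rightarrow> bool" where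
  "nonsingular_on I Y M \<longleftrightarrow> finite I \<and> finite Y \<and> card I = card Y \<and>
     (\<forall>v. (\<forall>i\<in>I. (\<Sum>j\<in>Y. M i j * v j) = 0) \<longrightarrow> (\<forall>j\<in>Y. v j = 0))"

lemma nonsingular_onD:
  "nonsingular_on I Y M \<Longrightarrow> (\<And>i. i \<in> I \<Longrightarrow> (\<Sum>j\<in>Y. M i j * v j) = 0) \<Longrightarrow> j \<in> Y \<Longrightarrow> v j = 0"
  unfolding nonsingular_on_def by blast

lemma nonsingular_on_iff_det:
  assumes e: "bij_betw e {..<N} I" and f: "bij_betw f {..<N} Y"
  shows "nonsingular_on I Y M \<longleftrightarrow> Determinant.det (Matrix.mat N N (\<lambda>(a, b). M (e a) (f b))) \<noteq> 0"
proof -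
  define A where "A = Matrix.mat N N (\<lambda>(a, b). M (e a) (f b))"
  have A: "A \<in> carrier_mat N N" by (simp add: A_def)
  have card: "finite I" "finite Y" "card I = card Y"
    using bij_betw_finite[OF e] bij_betw_finite[OF f] bij_betw_same_card[OF e] bij_betw_same_card[OF f] by auto
  have prod: "vec_index (A *\<^sub>v Matrix.vec N (\<lambda>b. v (f b))) a = (\<Sum>j\<in>Y. M (e a) j * v j)" if "a < N" for v a
  proof -
    have "vec_index (A *\<^sub>v Matrix.vec N (\<lambda>b. v (f b))) a = (\<Sum>b\<in>{..<N}. M (e a) (f b) * v (f b))"
      using that by (simp add: A_def scalar_prod_def atLeast0LessThan)
    also have "\<dots> = (\<Sum>j\<in>Y. M (e a) j * v j)"
      using sum.reindex_bij_betw[OF f, of "\<lambda>j. M (e a) j * v j"] by simp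
    finally show ?thesis .
  qed
  have eI: "I = e ` {..<N}" "Y = f ` {..<N}" using e f by (auto simp: bij_betw_def)
  have "Determinant.det A = 0 \<longleftrightarrow> (\<exists>v\<in>carrier_vec N. v \<noteq> 0\<^sub>v N \<and> A *\<^sub>v v = 0\<^sub>v N)"
    using det_0_iff_vec_prod_zero_field[OF A] by auto
  also have "\<dots> \<longleftrightarrow> (\<exists>v. (\<forall>i\<in>I. (\<Sum>j\<in>Y. M i j * v j) = 0) \<and> (\<exists>j\<in>Y. v j \<noteq> 0))"
  proof
    assume "\<exists>v\<in>carrier_vec N. v \<noteq> 0\<^sub>v N \<and> A *\<^sub>v v = 0\<^sub>v N"
    then obtain v where v: "v \<in> carrier_vec N" "v \<noteq> 0\<^sub>v N" "A *\<^sub>v v = 0\<^sub>v N" by auto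
    define w where "w j = vec_index v (inv_into {..<N} f j)" for j
    have wf: "w (f b) = vec_index v b" if "b < N" for b
      using that f by (auto simp: w_def bij_betw_def inv_into_f_f)
    have vw: "Matrix.vec N (\<lambda>b. w (f b)) = v" using v(1) wf by (intro eq_vecI) auto
    have "(\<Sum>j\<in>Y. M (e a) j * w j) = 0" if "a < N" for a
      using prod[OF that, of w] that unfolding vw v(3) by simp
    moreover have "\<exists>b<N. vec_index v b \<noteq> 0"
    proof (rule ccontr)
      assume "\<not> (\<exists>b<N. vec_index v b \<noteq> 0)"
      hence "v = 0\<^sub>v N" using v(1) by (intro eq_vecI) auto
      thus False using v by simp
    qed
    ultimately show "\<exists>v. (\<forall>i\<in>I. (\<Sum>j\<in>Y. M i j * v j) = 0) \<and> (\<exists>j\<in>Y. v j \<noteq> 0)"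
      using wf unfolding eI by (intro exI[of _ w]) force
  next
    assume "\<exists>v. (\<forall>i\<in>I. (\<Sum>j\<in>Y. M i j * v j) = 0) \<and> (\<exists>j\<in>Y. v j \<noteq> 0)"
    then obtain v b where v: "\<forall>i\<in>I. (\<Sum>j\<in>Y. M i j * v j) = 0" and b: "b < N" "v (f b) \<noteq> 0"
      unfolding eI by auto
    show "\<exists>v\<in>carrier_vec N. v \<noteq> 0\<^sub>v N \<and> A *\<^sub>v v = 0\<^sub>v N"
    proof (intro bexI conjI)
      show "A *\<^sub>v Matrix.vec N (\<lambda>b. v (f b)) = 0\<^sub>v N"
      proof (intro eq_vecI)
        fix a assume "a < dim_vec (0\<^sub>v N :: real Matrix.vec)"
        hence a: "a < N" by simp
        hence "e a \<in> I" by (simp add: eI)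
        thus "vec_index (A *\<^sub>v Matrix.vec N (\<lambda>b. v (f b))) a = vec_index (0\<^sub>v N) a" using v a by (simp add: prod)
      qed (simp add: A_def)
      show "Matrix.vec N (\<lambda>b. v (f b)) \<noteq> 0\<^sub>v N"
      proof
        assume "Matrix.vec N (\<lambda>b. v (f b)) = 0\<^sub>v N"
        from arg_cong[OF this, of "\<lambda>x. vec_index x b"] b show False by simp
      qed
    qed simp
  qed
  finally show ?thesis unfolding A_def[symmetric] nonsingular_on_def using card by blast
qed

lemma nonsingular_on_inverse:
  assumes M: "nonsingular_on I Y M"
  obtains B where "\<And>i i'. i \<in> I \<Longrightarrow> i' \<in> I \<Longrightarrow> (\<Sum>j\<in>Y. M i j * B j i') = of_bool (i = i')"
    and "\<And>j j'. j \<in> Y \<Longrightarrow> j' \<in> Y \<Longrightarrow> (\<Sum>i\<in>I. B j i * M i j') = of_bool (j = j')"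
proof -
  define N where "N = card I"
  have fin: "finite I" "finite Y" "card Y = N" using M by (auto simp: nonsingular_on_def N_def)
  obtain e where e: "bij_betw e {..<N} I"
    using ex_bij_betw_nat_finite[OF fin(1)] by (auto simp: N_def atLeast0LessThan)
  obtain f where f: "bij_betw f {..<N} Y"
    using ex_bij_betw_nat_finite[OF fin(2)] fin by (auto simp: atLeast0LessThan)
  define A where "A = Matrix.mat N N (\<lambda>(a, b). M (e a) (f b))"
  have A: "A \<in> carrier_mat N N" by (simp add: A_def)
  have "Determinant.det A \<noteq> 0" using M unfolding A_def nonsingular_on_iff_det[OF e f] .
  from det_non_zero_imp_unit[OF A this, of undefined]
  obtain C where C: "C \<in> carrier_mat N N" "A * C = 1\<^sub>m N" "C * A = 1\<^sub>m N"
    by (auto simp: Units_def ring_mat_def)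
  define e' where "e' = inv_into {..<N} e"
  define f' where "f' = inv_into {..<N} f"
  have e': "e' i < N" "e (e' i) = i" if "i \<in> I" for i
    using bij_betw_inv_into[OF e] bij_betw_inv_into_right[OF e that] that by (auto simp: e'_def bij_betw_def)
  have f': "f' j < N" "f (f' j) = j" if "j \<in> Y" for j
    using bij_betw_inv_into[OF f] bij_betw_inv_into_right[OF f that] that by (auto simp: f'_def bij_betw_def)
  have e'e: "e' (e a) = a" "e a \<in> I" if "a < N" for a
    using bij_betw_inv_into_left[OF e, of a] bij_betwE[OF e] that by (auto simp: e'_def)
  have f'f: "f' (f a) = a" "f a \<in> Y" if "a < N" for a
    using bij_betw_inv_into_left[OF f, of a] bij_betwE[OF f] that by (auto simp: f'_def)
  have inj: "e' i = e' i' \<longleftrightarrow> i = i'" if "i \<in> I" "i' \<in> I" for i i' using e' that by metis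
  have inj2: "f' i = f' i' \<longleftrightarrow> i = i'" if "i \<in> Y" "i' \<in> Y" for i i' using f' that by metis
  show thesis
  proof (rule that[of "\<lambda>j i. C $$ (f' j, e' i)"])
    fix i i' assume i: "i \<in> I" "i' \<in> I"
    have "(\<Sum>j\<in>Y. M i j * C $$ (f' j, e' i')) = (\<Sum>b<N. M i (f b) * C $$ (f' (f b), e' i'))"
      by (rule sum.reindex_bij_betw[OF f, symmetric])
    also have "\<dots> = (A * C) $$ (e' i, e' i')"
      using C(1) A e' i by (simp add: scalar_prod_def A_def f'f atLeast0LessThan)
    also have "\<dots> = of_bool (i = i')" using e' i inj by (simp add: C(2))
    finally show "(\<Sum>j\<in>Y. M i j * C $$ (f' j, e' i')) = of_bool (i = i')" .
  next
    fix j j' assume j: "j \<in> Y" "j' \<in> Y"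
    have "(\<Sum>i\<in>I. C $$ (f' j, e' i) * M i j') = (\<Sum>a<N. C $$ (f' j, e' (e a)) * M (e a) j')"
      by (rule sum.reindex_bij_betw[OF e, symmetric])
    also have "\<dots> = (C * A) $$ (f' j, f' j')"
      using C(1) A f' j by (simp add: scalar_prod_def A_def e'e atLeast0LessThan)
    also have "\<dots> = of_bool (j = j')" using f' j inj2 by (simp add: C(3))
    finally show "(\<Sum>i\<in>I. C $$ (f' j, e' i) * M i j') = of_bool (j = j')" .
  qed
qed

text \<open>
  As \<open>\<Sum>j. M i0 j * B j i0 = 1\<close> for the inverse \<open>B\<close>, some \<open>j\<close> has both factors nonzero. A vector in the
  kernel of the remaining block, extended by \<open>0\<close> at \<open>j\<close>, is mapped by \<open>M\<close> to a multiple of the basis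
  vector \<open>i0\<close>, so it is a multiple of the column \<open>B _ i0\<close>; since it vanishes at \<open>j\<close>, it is zero.
\<close>

lemma nonsingular_on_remove:
  assumes M: "nonsingular_on I Y M" and i0: "i0 \<in> I"
  obtains j where "j \<in> Y" "M i0 j \<noteq> 0" "nonsingular_on (I - {i0}) (Y - {j}) M"
proof -
  obtain B where B: "\<And>i i'. i \<in> I \<Longrightarrow> i' \<in> I \<Longrightarrow> (\<Sum>j\<in>Y. M i j * B j i') = of_bool (i = i')"
    and B2: "\<And>j j'. j \<in> Y \<Longrightarrow> j' \<in> Y \<Longrightarrow> (\<Sum>i\<in>I. B j i * M i j') = of_bool (j = j')"
    by (rule nonsingular_on_inverse[OF M]) blast
  have fin: "finite I" "finite Y" "card I = card Y" using M by (auto simp: nonsingular_on_def)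
  have "(\<Sum>j\<in>Y. M i0 j * B j i0) \<noteq> 0" using B[OF i0 i0] by simp
  then obtain j where j: "j \<in> Y" "M i0 j * B j i0 \<noteq> 0" by (meson sum.neutral)
  have "nonsingular_on (I - {i0}) (Y - {j}) M"
    unfolding nonsingular_on_def
  proof (intro conjI allI impI)
    fix v assume v: "\<forall>i\<in>I - {i0}. (\<Sum>j\<in>Y - {j}. M i j * v j) = 0"
    define u where "u = v(j := 0)"
    have uv: "(\<Sum>l\<in>Y - {j}. M i l * v l) = (\<Sum>l\<in>Y. M i l * u l)" for i
      using fin j by (simp add: sum.remove[of Y j] u_def)
    define b where "b = (\<Sum>l\<in>Y. M i0 l * u l)"
    have Mu: "(\<Sum>l\<in>Y. M i l * u l) = (if i = i0 then b else 0)" if "i \<in> I" for i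
      using v that by (auto simp: uv b_def)
    have u: "u l = b * B l i0" if l: "l \<in> Y" for l
    proof -
      have "u l - b * B l i0 = 0"
      proof (rule nonsingular_onD[OF M _ l])
        fix i assume i: "i \<in> I"
        have "(\<Sum>j\<in>Y. M i j * (u j - b * B j i0)) = (\<Sum>j\<in>Y. M i j * u j) - b * (\<Sum>j\<in>Y. M i j * B j i0)"
          by (simp add: right_diff_distrib sum_subtractf sum_distrib_left mult_ac)
        also have "\<dots> = 0" using Mu[OF i] B[OF i i0] by simp
        finally show "(\<Sum>j\<in>Y. M i j * (u j - b * B j i0)) = 0" .
      qed
      thus ?thesis by simp
    qed
    have "b = 0" using u[OF j(1)] j(2) by (simp add: u_def)
    show "\<forall>l\<in>Y - {j}. v l = 0"
    proof
      fix l assume "l \<in> Y - {j}"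
      thus "v l = 0" using u[of l] \<open>b = 0\<close> by (simp add: u_def)
    qed
  qed (use fin i0 j in auto)
  thus thesis using that j by auto
qed

text \<open>
  Rows are removed in the order of decreasing \<open>\<alpha>\<close>, so every block of rows with \<open>\<alpha> i \<le> w\<close> occurs among
  the remaining ones.
\<close>

lemma nested_nonsingular:
  fixes \<alpha> :: "'i \<Rightarrow> nat"
  assumes "nonsingular_on I Y M"
  shows "\<exists>\<sigma>. bij_betw \<sigma> I Y \<and> (\<forall>i\<in>I. M i (\<sigma> i) \<noteq> 0) \<and>
    (\<forall>w. nonsingular_on {i\<in>I. \<alpha> i \<le> w} (\<sigma> ` {i\<in>I. \<alpha> i \<le> w}) M)"
  using assms
proof (induction "card I" arbitrary: I Y)
  case 0
  hence "I = {}" "Y = {}" by (auto simp: nonsingular_on_def)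
  thus ?case using 0 by (auto simp: bij_betw_def)
next
  case (Suc n)
  have fin: "finite I" "finite Y" using Suc.prems by (auto simp: nonsingular_on_def)
  have "I \<noteq> {}" using Suc.hyps(2) by auto
  then obtain i0 where i0: "i0 \<in> I" "\<And>i. i \<in> I \<Longrightarrow> \<alpha> i \<le> \<alpha> i0"
    using Max_in[of "\<alpha> ` I"] Max_ge[of "\<alpha> ` I"] fin by fastforce
  obtain j where j: "j \<in> Y" "M i0 j \<noteq> 0" "nonsingular_on (I - {i0}) (Y - {j}) M"
    using nonsingular_on_remove[OF Suc.prems i0(1)] by blast
  have "n = card (I - {i0})" using Suc.hyps(2) i0 by simp
  from Suc.hyps(1)[OF this j(3)] obtain \<sigma> where \<sigma>: "bij_betw \<sigma> (I - {i0}) (Y - {j})"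
    "\<forall>i\<in>I - {i0}. M i (\<sigma> i) \<noteq> 0"
    "\<forall>w. nonsingular_on {i\<in>I - {i0}. \<alpha> i \<le> w} (\<sigma> ` {i\<in>I - {i0}. \<alpha> i \<le> w}) M" by blast
  define \<tau> where "\<tau> = \<sigma>(i0 := j)"
  have bij: "bij_betw \<tau> I Y"
  proof -
    have "bij_betw \<tau> (I - {i0}) (Y - {j})"
      using \<sigma>(1) by (rule bij_betw_cong[THEN iffD1, rotated]) (auto simp: \<tau>_def)
    from notIn_Un_bij_betw[of i0 "I - {i0}" \<tau> "Y - {j}", OF _ _ this] i0 j
    show ?thesis by (simp add: \<tau>_def insert_absorb)
  qed
  have "nonsingular_on {i\<in>I. \<alpha> i \<le> w} (\<tau> ` {i\<in>I. \<alpha> i \<le> w}) M" for w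
  proof (cases "\<alpha> i0 \<le> w")
    case True
    hence "{i\<in>I. \<alpha> i \<le> w} = I" using i0 by (auto intro: order_trans)
    thus ?thesis using Suc.prems bij by (simp add: bij_betw_def)
  next
    case False
    hence "{i\<in>I. \<alpha> i \<le> w} = {i\<in>I - {i0}. \<alpha> i \<le> w}" by auto
    moreover have "\<tau> ` {i\<in>I - {i0}. \<alpha> i \<le> w} = \<sigma> ` {i\<in>I - {i0}. \<alpha> i \<le> w}"
      by (intro image_cong) (auto simp: \<tau>_def)
    ultimately show ?thesis using \<sigma>(3) by metis
  qed
  moreover have "\<forall>i\<in>I. M i (\<tau> i) \<noteq> 0" using \<sigma>(2) j(2) by (auto simp: \<tau>_def)
  ultimately show ?case using bij by blast
qed

text \<open>
  If \<open>M' v = 0\<close> then \<open>v = B (M - M') v\<close> for the inverse \<open>B\<close> of \<open>M\<close>, which is at most half of \<open>v\<close> when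
  \<open>M'\<close> is close to \<open>M\<close>.
\<close>

lemma nonsingular_on_perturb:
  assumes M: "nonsingular_on I Y M"
  obtains \<epsilon> where "\<epsilon> > 0"
    "\<And>M'. (\<And>i j. i \<in> I \<Longrightarrow> j \<in> Y \<Longrightarrow> \<bar>M' i j - M i j\<bar> \<le> \<epsilon>) \<Longrightarrow> nonsingular_on I Y M'"
proof -
  obtain B where B2: "\<And>j j'. j \<in> Y \<Longrightarrow> j' \<in> Y \<Longrightarrow> (\<Sum>i\<in>I. B j i * M i j') = of_bool (j = j')"
    by (rule nonsingular_on_inverse[OF M]) blast
  have fin: "finite I" "finite Y" "card I = card Y" using M by (auto simp: nonsingular_on_def)
  define C where "C = 1 + (\<Sum>j\<in>Y. \<Sum>i\<in>I. \<bar>B j i\<bar>)"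
  define y where "y = real (card Y) + 1"
  have C1: "C \<ge> 1" unfolding C_def by (simp add: sum_nonneg)
  have Cj: "(\<Sum>i\<in>I. \<bar>B j i\<bar>) \<le> C" if "j \<in> Y" for j
    using member_le_sum[OF that, of "\<lambda>j. \<Sum>i\<in>I. \<bar>B j i\<bar>"] fin by (simp add: C_def sum_nonneg)
  define \<epsilon> where "\<epsilon> = 1 / (2 * C * y)"
  have Cy: "C * y > 0" using C1 by (simp add: y_def)
  have eps: "\<epsilon> > 0" using Cy by (simp add: \<epsilon>_def mult.assoc)
  show thesis
  proof (rule that[OF eps])
    fix M' assume near: "\<And>i j. i \<in> I \<Longrightarrow> j \<in> Y \<Longrightarrow> \<bar>M' i j - M i j\<bar> \<le> \<epsilon>"
    have "v j = 0" if v: "\<And>i. i \<in> I \<Longrightarrow> (\<Sum>j\<in>Y. M' i j * v j) = 0" and j: "j \<in> Y" for v j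
      using fin(2) _ j
    proof (rule contraction_kernel_eq_zero)
      fix \<delta> j assume \<delta>: "\<And>j. j \<in> Y \<Longrightarrow> \<bar>v j\<bar> \<le> \<delta>" and j: "j \<in> Y"
      have \<delta>0: "\<delta> \<ge> 0" using \<delta>[OF j] by linarith
      have "v j = (\<Sum>j'\<in>Y. if j = j' then v j' else 0)" using fin j by (simp add: sum.delta')
      also have "\<dots> = (\<Sum>j'\<in>Y. of_bool (j = j') * v j')" by (intro sum.cong) auto
      also have "\<dots> = (\<Sum>j'\<in>Y. (\<Sum>i\<in>I. B j i * M i j') * v j')" by (intro sum.cong) (auto simp: B2[OF j])
      also have "\<dots> = (\<Sum>i\<in>I. B j i * (\<Sum>j'\<in>Y. M i j' * v j'))"
        unfolding sum_distrib_left sum_distrib_right by (subst sum.swap) (simp add: mult_ac)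
      also have "\<dots> = (\<Sum>i\<in>I. B j i * (\<Sum>j'\<in>Y. (M i j' - M' i j') * v j'))"
        by (intro sum.cong) (auto simp: left_diff_distrib sum_subtractf v)
      finally have "\<bar>v j\<bar> = \<bar>\<Sum>i\<in>I. B j i * (\<Sum>j'\<in>Y. (M i j' - M' i j') * v j')\<bar>" by (rule arg_cong)
      also have "\<dots> \<le> (\<Sum>i\<in>I. \<bar>B j i * (\<Sum>j'\<in>Y. (M i j' - M' i j') * v j')\<bar>)" by (rule sum_abs)
      also have "\<dots> \<le> (\<Sum>i\<in>I. \<bar>B j i\<bar> * (y * (\<epsilon> * \<delta>)))"
        unfolding abs_mult
      proof (intro sum_mono mult_left_mono abs_ge_zero)
        fix i assume i: "i \<in> I"
        have "\<bar>\<Sum>j'\<in>Y. (M i j' - M' i j') * v j'\<bar> \<le> (\<Sum>j'\<in>Y. \<bar>(M i j' - M' i j') * v j'\<bar>)" by (rule sum_abs)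
        also have "\<dots> \<le> (\<Sum>j'\<in>Y. \<epsilon> * \<delta>)"
          unfolding abs_mult using near[OF i] \<delta> eps
          by (intro sum_mono mult_mono) (auto simp: abs_minus_commute)
        also have "\<dots> \<le> y * (\<epsilon> * \<delta>)" using eps \<delta>0 by (simp add: y_def algebra_simps)
        finally show "\<bar>\<Sum>j'\<in>Y. (M i j' - M' i j') * v j'\<bar> \<le> y * (\<epsilon> * \<delta>)" .
      qed
      also have "\<dots> \<le> C * (y * (\<epsilon> * \<delta>))"
        unfolding sum_distrib_right[symmetric] using Cj[OF j] eps \<delta>0 by (intro mult_right_mono) (auto simp: y_def)
      also have "\<dots> = \<delta> / 2" using Cy by (cases "C = 0"; cases "y = 0") (auto simp: \<epsilon>_def field_simps)
      finally show "\<bar>v j\<bar> \<le> \<delta> / 2" .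
    qed
    thus "nonsingular_on I Y M'" unfolding nonsingular_on_def using fin by blast
  qed
qed

section \<open>Calculus of differential functions\<close>

lemma topspace_coord_space: "topspace (coord_space C) = extensional C"
  by (auto simp: PiE_def)

lemma openin_cylinder:
  assumes "finite S" "S \<subseteq> C"
  shows "openin (coord_space C) {q \<in> extensional C. \<forall>c\<in>S. \<bar>q c - p c\<bar> < r c}"
proof -
  define I where "I c = (if c \<in> S then {p c - r c <..< p c + r c} else UNIV)" for c
  have iff: "y \<in> I c \<longleftrightarrow> (c \<in> S \<longrightarrow> \<bar>y - p c\<bar> < r c)" for y c
    by (auto simp: I_def abs_less_iff)
  have "{q \<in> extensional C. \<forall>c\<in>S. \<bar>q c - p c\<bar> < r c} = PiE C I"
    unfolding PiE_def Pi_def iff using assms(2) by blast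
  moreover have "finite {c \<in> C. I c \<noteq> UNIV}"
    by (rule finite_subset[OF _ assms(1)]) (auto simp: I_def)
  moreover have "open (I c)" for c by (simp add: I_def)
  ultimately show ?thesis by (simp add: openin_PiE_gen)
qed

lemma openin_contains_cylinder:
  assumes "openin (coord_space C) U" "p \<in> U"
  obtains S \<epsilon> where "finite S" "S \<subseteq> C" "\<epsilon> > 0"
    "\<And>q. q \<in> extensional C \<Longrightarrow> (\<And>c. c \<in> S \<Longrightarrow> \<bar>q c - p c\<bar> < \<epsilon>) \<Longrightarrow> q \<in> U"
proof -
  obtain V where V: "finite {c \<in> C. V c \<noteq> UNIV}" "\<And>c. c \<in> C \<Longrightarrow> open (V c)" "p \<in> PiE C V" "PiE C V \<subseteq> U"
    using assms unfolding openin_product_topology_alt by auto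
  define S where "S = {c \<in> C. V c \<noteq> UNIV}"
  have "\<forall>c\<in>S. \<exists>e>0. \<forall>y. \<bar>y - p c\<bar> < e \<longrightarrow> y \<in> V c"
  proof
    fix c assume "c \<in> S"
    hence "open (V c)" "p c \<in> V c" using V by (auto simp: S_def)
    thus "\<exists>e>0. \<forall>y. \<bar>y - p c\<bar> < e \<longrightarrow> y \<in> V c" by (auto simp: open_dist dist_real_def)
  qed
  from bchoice[OF this] obtain e where e: "\<And>c. c \<in> S \<Longrightarrow> e c > 0"
    "\<And>c y. c \<in> S \<Longrightarrow> \<bar>y - p c\<bar> < e c \<Longrightarrow> y \<in> V c" by blast
  have S: "finite S" using V(1) by (simp add: S_def)
  define \<epsilon> where "\<epsilon> = Min (insert 1 (e ` S))"
  have eps: "\<epsilon> > 0" "\<And>c. c \<in> S \<Longrightarrow> \<epsilon> \<le> e c" using S e(1) by (auto simp: \<epsilon>_def)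
  show thesis
  proof (rule that[OF S _ eps(1)])
    fix q assume q: "q \<in> extensional C" "\<And>c. c \<in> S \<Longrightarrow> \<bar>q c - p c\<bar> < \<epsilon>"
    have "q c \<in> V c" if "c \<in> C" for c
    proof (cases "c \<in> S")
      case True
      thus ?thesis using e(2)[OF True] q(2)[OF True] eps(2)[OF True] by fastforce
    next
      case False
      thus ?thesis using that by (simp add: S_def)
    qed
    thus "q \<in> U" using V(4) q(1) by (auto simp: PiE_def)
  qed (auto simp: S_def)
qed

lemma openin_coord_space_subset: "openin (coord_space C) U \<Longrightarrow> U \<subseteq> extensional C"
  using openin_subset[of "coord_space C" U] unfolding topspace_coord_space .

lemma eventually_in_openin:
  assumes U: "openin (coord_space C) U" and s0: "\<gamma> s0 \<in> U"
    and ext: "\<And>s. \<gamma> s \<in> extensional C" and cont: "\<And>c. c \<in> C \<Longrightarrow> isCont (\<lambda>s. \<gamma> s c) (s0 :: real)"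
  shows "\<forall>\<^sub>F s in nhds s0. \<gamma> s \<in> U"
proof -
  obtain S \<epsilon> where S: "finite S" "S \<subseteq> C" "\<epsilon> > 0"
    and SU: "\<And>q. q \<in> extensional C \<Longrightarrow> (\<And>c. c \<in> S \<Longrightarrow> \<bar>q c - \<gamma> s0 c\<bar> < \<epsilon>) \<Longrightarrow> q \<in> U"
    by (rule openin_contains_cylinder[OF U s0]) blast
  have "\<forall>\<^sub>F s in nhds s0. \<forall>c\<in>S. \<bar>\<gamma> s c - \<gamma> s0 c\<bar> < \<epsilon>"
    using S(1)
  proof (rule eventually_ball_finite, safe)
    fix c assume "c \<in> S"
    hence "isCont (\<lambda>s. \<gamma> s c) s0" using cont S by auto
    hence "((\<lambda>s. \<gamma> s c) \<longlongrightarrow> \<gamma> s0 c) (nhds s0)"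
      using tendsto_at_iff_tendsto_nhds[of "\<lambda>s. \<gamma> s c" s0] by (simp add: isCont_def)
    from tendstoD[OF this S(3)] show "\<forall>\<^sub>F s in nhds s0. \<bar>\<gamma> s c - \<gamma> s0 c\<bar> < \<epsilon>" by (simp add: dist_real_def)
  qed
  thus ?thesis by eventually_elim (use SU ext in blast)
qed

lemma eventually_fun_upd_in_openin:
  assumes "openin (coord_space C) U" "q \<in> U" "c \<in> C"
  shows "\<forall>\<^sub>F s in nhds (q c). q(c := s) \<in> U"
proof (rule eventually_in_openin[OF assms(1)])
  have "q \<in> extensional C" using openin_coord_space_subset[OF assms(1)] assms(2) by auto
  thus "q(c := s) \<in> extensional C" for s using assms(3) by (auto simp: extensional_def)
  show "isCont (\<lambda>s. (q(c := s)) c') (q c)" for c' by (cases "c' = c") auto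
qed (use assms in simp)

lemma pdiff_cong:
  assumes "openin (coord_space C) U" "q \<in> U" "c \<in> C" "\<And>q. q \<in> U \<Longrightarrow> f q = g q"
  shows "pdiff c f q = pdiff c g q"
  unfolding pdiff_def
  by (rule deriv_cong_ev[OF eventually_mono[OF eventually_fun_upd_in_openin[OF assms(1-3)]]]) (use assms(4) in auto)

lemma derivation_cong:
  assumes "openin (coord_space C) U" "q \<in> U" "\<And>q. q \<in> U \<Longrightarrow> f q = g q"
  shows "derivation C v f q = derivation C v g q"
proof -
  have "pdiff c f q = pdiff c g q" if "c \<in> C" for c by (rule pdiff_cong[OF assms(1,2) that assms(3)])
  thus ?thesis unfolding derivation_def by (intro sum.cong) auto
qed

text \<open>
  The points \<open>q\<close> are only required to be close to \<open>p\<close> in the coordinates of \<open>F\<close>, as in the definition of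
  a differential function.
\<close>

definition analytic_near :: "'c set \<Rightarrow> ('c \<Rightarrow> real) set \<Rightarrow> (('c \<Rightarrow> real) \<Rightarrow> real) \<Rightarrow> ('c \<Rightarrow> real) \<Rightarrow> bool" where
  "analytic_near F U f p \<longleftrightarrow> (\<exists>r>0. \<exists>M g. majorized F p r M g \<and> (\<forall>q\<in>U \<inter> pbox F p r. f q = g q))"

lemma has_sum_mpow_iff: "((\<lambda>\<mu>. a \<mu> * (\<Prod>c\<in>F. (q c - p c) ^ \<mu> c)) has_sum S) A \<longleftrightarrow>
   ((\<lambda>\<mu>. a \<mu> * mpow F p \<mu> q) has_sum S) A"
  by (simp add: mpow_def)

text \<open>
  A power series that converges at one point of \<open>U\<close> with all coordinates in \<open>F\<close> displaced by \<open>\<rho>\<close>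
  converges absolutely on the polydisc of radius \<open>\<rho>\<close>.
\<close>

lemma differential_function_iff:
  "differential_function C U f \<longleftrightarrow> openin (coord_space C) U \<and>
     (\<exists>F. finite F \<and> F \<subseteq> C \<and> (\<forall>p\<in>U. analytic_near F U f p))"
proof (intro iffI conjI)
  assume d: "differential_function C U f"
  thus U: "openin (coord_space C) U" by (simp add: differential_function_def)
  from d[unfolded differential_function_def has_sum_mpow_iff, THEN conjunct2]
  obtain F where Fe: "finite F \<and> F \<subseteq> C \<and> (\<forall>p\<in>U. \<exists>r>0. \<exists>a. \<forall>q\<in>U. (\<forall>c\<in>F. \<bar>q c - p c\<bar> < r) \<longrightarrow>
         ((\<lambda>\<mu>. a \<mu> * mpow F p \<mu> q) has_sum f q) (F \<rightarrow>\<^sub>E UNIV))" ..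
  hence F: "finite F" "F \<subseteq> C" by simp_all
  have e: "\<exists>r>0. \<exists>a. \<forall>q\<in>U. (\<forall>c\<in>F. \<bar>q c - p c\<bar> < r) \<longrightarrow>
         ((\<lambda>\<mu>. a \<mu> * mpow F p \<mu> q) has_sum f q) (F \<rightarrow>\<^sub>E UNIV)" if "p \<in> U" for p
    using bspec[OF conjunct2[OF conjunct2[OF Fe]] that] .
  have "analytic_near F U f p" if p: "p \<in> U" for p
  proof -
    obtain r a where r: "r > 0" and a: "\<And>q. q \<in> U \<Longrightarrow> (\<forall>c\<in>F. \<bar>q c - p c\<bar> < r) \<Longrightarrow>
         ((\<lambda>\<mu>. a \<mu> * mpow F p \<mu> q) has_sum f q) (F \<rightarrow>\<^sub>E UNIV)" using e[OF p] by blast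
    obtain S \<epsilon> where S: "finite S" "S \<subseteq> C" "\<epsilon> > 0"
      and SU: "\<And>q. q \<in> extensional C \<Longrightarrow> (\<And>c. c \<in> S \<Longrightarrow> \<bar>q c - p c\<bar> < \<epsilon>) \<Longrightarrow> q \<in> U"
      by (rule openin_contains_cylinder[OF U p]) blast
    define \<rho> where "\<rho> = min (\<epsilon> / 2) (r / 2)"
    have \<rho>: "\<rho> > 0" "\<rho> < \<epsilon>" "\<rho> < r" using r S by (auto simp: \<rho>_def)
    define q where "q c = (if c \<in> F then p c + \<rho> else p c)" for c
    have "p \<in> extensional C" using openin_coord_space_subset[OF U] p by auto
    hence "q \<in> extensional C" using F by (auto simp: q_def extensional_def)
    hence "q \<in> U" by (rule SU) (use \<rho> S in \<open>auto simp: q_def\<close>)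
    hence "((\<lambda>\<mu>. a \<mu> * mpow F p \<mu> q) has_sum f q) (F \<rightarrow>\<^sub>E UNIV)"
      by (rule a) (use \<rho> in \<open>auto simp: q_def\<close>)
    moreover have "mpow F p \<mu> q = \<rho> ^ sum \<mu> F" for \<mu> by (simp add: mpow_def q_def power_sum)
    ultimately have "(\<lambda>\<mu>. a \<mu> * \<rho> ^ sum \<mu> F) summable_on (F \<rightarrow>\<^sub>E UNIV)"
      by (simp add: has_sum_imp_summable)
    hence "(\<lambda>\<mu>. norm (a \<mu> * \<rho> ^ sum \<mu> F)) summable_on (F \<rightarrow>\<^sub>E UNIV)"
      by (rule summable_on_iff_abs_summable_on_real[THEN iffD1])
    hence sm: "(\<lambda>\<mu>. \<bar>a \<mu>\<bar> * \<rho> ^ sum \<mu> F) summable_on (F \<rightarrow>\<^sub>E UNIV)" using \<rho> by (simp add: abs_mult)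
    define g where "g q = (\<Sum>\<^sub>\<infinity>\<mu>\<in>F \<rightarrow>\<^sub>E UNIV. a \<mu> * mpow F p \<mu> q)" for q
    have g: "((\<lambda>\<mu>. a \<mu> * mpow F p \<mu> q) has_sum g q) (F \<rightarrow>\<^sub>E UNIV)" if "q \<in> pbox F p \<rho>" for q
      unfolding g_def
    proof (rule has_sum_infsum, rule abs_summable_summable)
      show "(\<lambda>\<mu>. norm (a \<mu> * mpow F p \<mu> q)) summable_on F \<rightarrow>\<^sub>E UNIV"
        by (rule Infinite_Sum.abs_summable_on_comparison_test'[OF sm])
           (auto simp: abs_mult intro!: mult_left_mono abs_mpow_le[OF that])
    qed
    have "majorized F p \<rho> (infsum (\<lambda>\<mu>. \<bar>a \<mu>\<bar> * \<rho> ^ sum \<mu> F) (F \<rightarrow>\<^sub>E UNIV)) g"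
      unfolding majorized_def using g has_sum_infsum[OF sm] by blast
    moreover have "f q = g q" if "q \<in> U \<inter> pbox F p \<rho>" for q
    proof (rule has_sum_unique)
      show "((\<lambda>\<mu>. a \<mu> * mpow F p \<mu> q) has_sum g q) (F \<rightarrow>\<^sub>E UNIV)" using g that by blast
      show "((\<lambda>\<mu>. a \<mu> * mpow F p \<mu> q) has_sum f q) (F \<rightarrow>\<^sub>E UNIV)"
        by (rule a) (use that \<rho> in \<open>auto simp: pbox_def\<close>)
    qed
    ultimately show ?thesis unfolding analytic_near_def using \<rho>(1) by blast
  qed
  thus "\<exists>F. finite F \<and> F \<subseteq> C \<and> (\<forall>p\<in>U. analytic_near F U f p)" using F by blast
next
  assume "openin (coord_space C) U \<and> (\<exists>F. finite F \<and> F \<subseteq> C \<and> (\<forall>p\<in>U. analytic_near F U f p))"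
  then obtain F where U: "openin (coord_space C) U" and F: "finite F" "F \<subseteq> C"
    "\<And>p. p \<in> U \<Longrightarrow> analytic_near F U f p" by blast
  have e: "\<exists>r>0. \<exists>a. \<forall>q\<in>U. (\<forall>c\<in>F. \<bar>q c - p c\<bar> < r) \<longrightarrow>
         ((\<lambda>\<mu>. a \<mu> * mpow F p \<mu> q) has_sum f q) (F \<rightarrow>\<^sub>E UNIV)" if p: "p \<in> U" for p
  proof -
    obtain r M g where r: "r > 0" and g: "majorized F p r M g" "\<forall>q\<in>U \<inter> pbox F p r. f q = g q"
      using F(3)[OF p] unfolding analytic_near_def by blast
    from g(1) obtain a where a: "\<forall>q\<in>pbox F p r. ((\<lambda>\<mu>. a \<mu> * mpow F p \<mu> q) has_sum g q) (F \<rightarrow>\<^sub>E UNIV)"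
      unfolding majorized_def by blast
    have "((\<lambda>\<mu>. a \<mu> * mpow F p \<mu> q) has_sum f q) (F \<rightarrow>\<^sub>E UNIV)"
      if q: "q \<in> U" "\<forall>c\<in>F. \<bar>q c - p c\<bar> < r" for q
    proof -
      have "q \<in> pbox F p r" using q(2) by (auto simp: pbox_def intro: less_imp_le)
      thus ?thesis using a g(2) q(1) by auto
    qed
    thus ?thesis using r by blast
  qed
  show "differential_function C U f"
    unfolding differential_function_def has_sum_mpow_iff
    by (intro conjI exI[of _ F] ballI U F(1,2) e)
qed

lemma differential_function_open: "differential_function C U f \<Longrightarrow> openin (coord_space C) U"
  by (simp add: differential_function_def)

lemma differential_functionE:
  assumes "differential_function C U f"
  obtains F where "finite F" "F \<subseteq> C" "\<And>p. p \<in> U \<Longrightarrow> analytic_near F U f p"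
  using assms unfolding differential_function_iff by blast

lemma differential_functionI:
  assumes "openin (coord_space C) U" "finite F" "F \<subseteq> C" "\<And>p. p \<in> U \<Longrightarrow> analytic_near F U f p"
  shows "differential_function C U f"
  using assms unfolding differential_function_iff by blast

lemma analytic_near_mono:
  assumes "analytic_near F U f p" "finite F'" "F \<subseteq> F'"
  shows "analytic_near F' U f p"
proof -
  obtain r M g where r: "r > 0" and g: "majorized F p r M g" "\<forall>q\<in>U \<inter> pbox F p r. f q = g q"
    using assms(1) unfolding analytic_near_def by blast
  have "majorized F' p r M g"
    by (rule majorized_recenter[OF finite_subset[OF assms(3,2)] r r assms(3,2) g(1)]) simp
  moreover have "f q = g q" if "q \<in> U \<inter> pbox F' p r" for q
    using g(2) pbox_mono[of q F' p r F r] assms(3) that by auto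
  ultimately show ?thesis using r unfolding analytic_near_def by blast
qed

lemma analytic_nearI:
  assumes "r > 0" "majorized F p r M f"
  shows "analytic_near F U f p"
  unfolding analytic_near_def
  by (rule exI[of _ r], intro conjI exI[of _ M] exI[of _ f]) (use assms in auto)

lemma analytic_near_common:
  assumes "finite F" "analytic_near F U f p" "analytic_near F U g p"
  obtains r M f' M' g' where "r > 0" "majorized F p r M f'" "majorized F p r M' g'"
    "\<And>q. q \<in> U \<Longrightarrow> q \<in> pbox F p r \<Longrightarrow> f q = f' q" "\<And>q. q \<in> U \<Longrightarrow> q \<in> pbox F p r \<Longrightarrow> g q = g' q"
proof -
  obtain r M f' where r: "r > 0" and f: "majorized F p r M f'" "\<forall>q\<in>U \<inter> pbox F p r. f q = f' q"
    using assms(2) unfolding analytic_near_def by blast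
  obtain r' M' g' where r': "r' > 0" and g: "majorized F p r' M' g'" "\<forall>q\<in>U \<inter> pbox F p r'. g q = g' q"
    using assms(3) unfolding analytic_near_def by blast
  show thesis
  proof (rule that[of "min r r'"])
    show "min r r' > 0" using r r' by simp
    show "majorized F p (min r r') M f'" "majorized F p (min r r') M' g'"
      using r r' by (auto intro: majorized_shrink_radius[OF assms(1) _ _ f(1)] majorized_shrink_radius[OF assms(1) _ _ g(1)])
    fix q assume q: "q \<in> U" "q \<in> pbox F p (min r r')"
    show "f q = f' q" using f(2) q pbox_mono[OF q(2) order_refl, of r] by simp
    show "g q = g' q" using g(2) q pbox_mono[OF q(2) order_refl, of r'] by simp
  qed
qed

lemma analytic_near_add:
  assumes "finite F" "analytic_near F U f p" "analytic_near F U g p"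
  shows "analytic_near F U (\<lambda>q. f q + g q) p"
proof -
  obtain r M f' M' g' where "r > 0" "majorized F p r M f'" "majorized F p r M' g'"
    "\<And>q. q \<in> U \<Longrightarrow> q \<in> pbox F p r \<Longrightarrow> f q = f' q" "\<And>q. q \<in> U \<Longrightarrow> q \<in> pbox F p r \<Longrightarrow> g q = g' q"
    by (rule analytic_near_common[OF assms]) blast
  thus ?thesis unfolding analytic_near_def
    by (intro exI[of _ r] conjI exI[of _ "\<lambda>q. f' q + g' q"] exI[of _ "M + M'"])
       (auto intro: majorized_add[OF assms(1)])
qed

lemma analytic_near_mult:
  assumes "finite F" "analytic_near F U f p" "analytic_near F U g p"
  shows "analytic_near F U (\<lambda>q. f q * g q) p"
proof -
  obtain r M f' M' g' where "r > 0" "majorized F p r M f'" "majorized F p r M' g'"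
    "\<And>q. q \<in> U \<Longrightarrow> q \<in> pbox F p r \<Longrightarrow> f q = f' q" "\<And>q. q \<in> U \<Longrightarrow> q \<in> pbox F p r \<Longrightarrow> g q = g' q"
    by (rule analytic_near_common[OF assms]) blast
  thus ?thesis unfolding analytic_near_def
    by (intro exI[of _ r] conjI exI[of _ "\<lambda>q. f' q * g' q"] exI[of _ "M * M'"])
       (auto intro: majorized_mult[OF assms(1)])
qed

lemma differential_function_const:
  assumes "openin (coord_space C) U"
  shows "differential_function C U (\<lambda>_. k)"
proof (rule differential_functionI[OF assms, of "{}"])
  show "analytic_near {} U (\<lambda>_. k) p" for p
    by (rule analytic_nearI[OF _ majorized_const[OF _ _ order_refl], of 1]) auto
qed auto

lemma differential_function_coord:
  assumes "openin (coord_space C) U" "c \<in> C"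
  shows "differential_function C U (\<lambda>q. q c)"
proof (rule differential_functionI[OF assms(1), of "{c}"])
  fix p
  have "majorized {c} p 1 (1 + \<bar>p c\<bar>) (\<lambda>q. (q c - p c) + p c)"
    by (rule majorized_add[OF _ _ majorized_coord majorized_const]) auto
  thus "analytic_near {c} U (\<lambda>q. q c) p" by (intro analytic_nearI[of 1]) simp_all
qed (use assms in auto)

lemma differential_function_add:
  assumes f: "differential_function C U f" and g: "differential_function C U g"
  shows "differential_function C U (\<lambda>q. f q + g q)"
proof -
  obtain F where F: "finite F" "F \<subseteq> C" "\<And>p. p \<in> U \<Longrightarrow> analytic_near F U f p"
    by (rule differential_functionE[OF f]) blast
  obtain G where G: "finite G" "G \<subseteq> C" "\<And>p. p \<in> U \<Longrightarrow> analytic_near G U g p"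
    by (rule differential_functionE[OF g]) blast
  have FG: "finite (F \<union> G)" using F G by simp
  show ?thesis
  proof (rule differential_functionI[OF differential_function_open[OF f] FG])
    fix p assume p: "p \<in> U"
    show "analytic_near (F \<union> G) U (\<lambda>q. f q + g q) p"
      by (rule analytic_near_add[OF FG analytic_near_mono[OF F(3)[OF p] FG] analytic_near_mono[OF G(3)[OF p] FG]]) auto
  qed (use F G in simp)
qed

lemma differential_function_mult:
  assumes f: "differential_function C U f" and g: "differential_function C U g"
  shows "differential_function C U (\<lambda>q. f q * g q)"
proof -
  obtain F where F: "finite F" "F \<subseteq> C" "\<And>p. p \<in> U \<Longrightarrow> analytic_near F U f p"
    by (rule differential_functionE[OF f]) blast
  obtain G where G: "finite G" "G \<subseteq> C" "\<And>p. p \<in> U \<Longrightarrow> analytic_near G U g p"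
    by (rule differential_functionE[OF g]) blast
  have FG: "finite (F \<union> G)" using F G by simp
  show ?thesis
  proof (rule differential_functionI[OF differential_function_open[OF f] FG])
    fix p assume p: "p \<in> U"
    show "analytic_near (F \<union> G) U (\<lambda>q. f q * g q) p"
      by (rule analytic_near_mult[OF FG analytic_near_mono[OF F(3)[OF p] FG] analytic_near_mono[OF G(3)[OF p] FG]]) auto
  qed (use F G in simp)
qed

lemma differential_function_sum:
  assumes "openin (coord_space C) U" "finite K" "\<And>k. k \<in> K \<Longrightarrow> differential_function C U (f k)"
  shows "differential_function C U (\<lambda>q. \<Sum>k\<in>K. f k q)"
  using assms(2,3)
proof (induction rule: finite_induct)
  case empty
  show ?case using differential_function_const[OF assms(1)] by simp
next
  case (insert k K)
  have "differential_function C U (\<lambda>q. f k q + (\<Sum>k\<in>K. f k q))"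
    by (rule differential_function_add) (use insert in auto)
  thus ?case using insert.hyps by simp
qed

lemma differential_function_cong:
  assumes f: "differential_function C U f" and "\<And>q. q \<in> U \<Longrightarrow> f q = g q"
  shows "differential_function C U g"
proof -
  obtain F where F: "finite F" "F \<subseteq> C" "\<And>p. p \<in> U \<Longrightarrow> analytic_near F U f p"
    by (rule differential_functionE[OF f]) blast
  show ?thesis
    by (rule differential_functionI[OF differential_function_open[OF f] F(1,2)])
       (use F(3) assms(2) in \<open>auto simp: analytic_near_def\<close>)
qed

text \<open>
  For \<open>c\<close> outside \<open>F\<close> the function does not change with the coordinate \<open>c\<close>, hence the case distinction.
\<close>

lemma analytic_near_pdiff:
  assumes U: "openin (coord_space C) U" and F: "finite F" "F \<subseteq> C" and c: "c \<in> C"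
    and f: "analytic_near F U f p"
  obtains r M g where "r > 0" "majorized F p r M g" "\<And>q. q \<in> U \<Longrightarrow> q \<in> pbox F p r \<Longrightarrow> f q = g q"
    "\<And>q. q \<in> U \<Longrightarrow> q \<in> pbox F p r \<Longrightarrow> pdiff c f q = (if c \<in> F then pdiff c g q else 0)"
    "c \<in> F \<Longrightarrow> majorized F p r M (pdiff c g)"
proof -
  obtain r M g where r: "r > 0" and g: "majorized F p r M g" "\<forall>q\<in>U \<inter> pbox F p r. f q = g q"
    using f unfolding analytic_near_def by blast
  have r2: "0 < r / 2" "r / 2 < r" using r by auto
  obtain M' where M': "\<And>c. c \<in> F \<Longrightarrow> majorized F p (r / 2) M' (pdiff c g)"
    by (rule majorized_pdiff_chain[OF F(1) r2 g(1)]) blast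
  have near: "\<forall>\<^sub>F s in nhds (q c). q(c := s) \<in> U \<inter> pbox F p r" if q: "q \<in> U" "q \<in> pbox F p (r / 2)" for q
  proof -
    have "\<forall>\<^sub>F s in nhds (q c). s \<in> ball (q c) (r / 2)"
      by (rule eventually_nhds_in_open) (use r in auto)
    hence "\<forall>\<^sub>F s in nhds (q c). q(c := s) \<in> pbox F p r"
    proof eventually_elim
      case (elim s)
      have "\<bar>(q(c := s)) c' - p c'\<bar> \<le> r" if "c' \<in> F" for c'
      proof -
        have 1: "\<bar>q c' - p c'\<bar> \<le> r / 2" using q(2) that by (simp add: pbox_def)
        have 2: "\<bar>s - q c\<bar> \<le> r / 2" using elim by (simp add: dist_real_def abs_minus_commute)
        show ?thesis
        proof (cases "c' = c")
          case True
          have "\<bar>s - p c\<bar> \<le> r" using 1 2 unfolding True by linarith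
          thus ?thesis by (simp add: True)
        next
          case False
          thus ?thesis using 1 r by simp
        qed
      qed
      thus ?case unfolding pbox_def by blast
    qed
    with eventually_fun_upd_in_openin[OF U q(1) c] show ?thesis by eventually_elim auto
  qed
  show thesis
  proof (rule that[of "r / 2" "max M M'" g])
    show "majorized F p (r / 2) (max M M') g"
      by (rule majorized_mono[OF majorized_shrink_radius[OF F(1) _ _ g(1)]]) (use r in auto)
    show "f q = g q" if "q \<in> U" "q \<in> pbox F p (r / 2)" for q
      using g(2) pbox_mono[OF that(2) order_refl, of r] that(1) r by auto
    show "majorized F p (r / 2) (max M M') (pdiff c g)" if "c \<in> F"
      by (rule majorized_mono[OF M'[OF that]]) simp
    fix q assume q: "q \<in> U" "q \<in> pbox F p (r / 2)"
    have ev: "\<forall>\<^sub>F s in nhds (q c). f (q(c := s)) = g (q(c := s))"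
      using near[OF q] by eventually_elim (use g(2) in auto)
    have eq: "pdiff c f q = pdiff c g q"
      unfolding pdiff_def by (rule deriv_cong_ev[OF ev refl])
    show "pdiff c f q = (if c \<in> F then pdiff c g q else 0)"
    proof (cases "c \<in> F")
      case False
      obtain a where a: "\<And>q. q \<in> pbox F p r \<Longrightarrow> ((\<lambda>\<mu>. a \<mu> * mpow F p \<mu> q) has_sum g q) (F \<rightarrow>\<^sub>E UNIV)"
        using g(1) unfolding majorized_def by blast
      have "mpow F p \<mu> (q(c := s)) = mpow F p \<mu> q" for \<mu> s
        unfolding mpow_def using False by (intro prod.cong) auto
      moreover have qr: "q(c := s) \<in> pbox F p r" for s
        using pbox_mono[OF q(2) order_refl, of r] r False by (auto simp: pbox_def)
      ultimately have "g (q(c := s)) = g (q(c := q c))" for s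
        using has_sum_unique[OF a[OF qr[of s]], of "g (q(c := q c))"] a[OF qr[of "q c"]] by simp
      hence "(\<lambda>s. g (q(c := s))) = (\<lambda>s. g (q(c := q c)))" by (rule ext)
      hence "pdiff c g q = 0" unfolding pdiff_def by simp
      thus ?thesis using eq False by simp
    qed (use eq in simp)
  qed (use r in auto)
qed

lemma differential_function_pdiff:
  assumes f: "differential_function C U f" and c: "c \<in> C"
  shows "differential_function C U (pdiff c f)"
proof -
  obtain F where F: "finite F" "F \<subseteq> C" "\<And>p. p \<in> U \<Longrightarrow> analytic_near F U f p"
    by (rule differential_functionE[OF f]) blast
  note U = differential_function_open[OF f]
  show ?thesis
  proof (rule differential_functionI[OF U F(1,2)])
    fix p assume p: "p \<in> U"
    obtain r M g where r: "r > 0" and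
      g: "\<And>q. q \<in> U \<Longrightarrow> q \<in> pbox F p r \<Longrightarrow> pdiff c f q = (if c \<in> F then pdiff c g q else 0)"
      "c \<in> F \<Longrightarrow> majorized F p r M (pdiff c g)"
      by (rule analytic_near_pdiff[OF U F(1,2) c F(3)[OF p]]) blast
    show "analytic_near F U (pdiff c f) p"
    proof (cases "c \<in> F")
      case True
      thus ?thesis using r g unfolding analytic_near_def by auto
    next
      case False
      thus ?thesis unfolding analytic_near_def using r g majorized_const[OF F(1) r, of 0 0 p]
        by (intro exI[of _ r] conjI exI[of _ 0] exI[of _ "\<lambda>_. 0"]) auto
    qed
  qed
qed

lemma differential_function_support:
  assumes f: "differential_function C U f"
  obtains F where "finite F" "F \<subseteq> C" "\<And>p c. p \<in> U \<Longrightarrow> c \<in> C \<Longrightarrow> pdiff c f p \<noteq> 0 \<Longrightarrow> c \<in> F"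
    "\<And>p. p \<in> U \<Longrightarrow> analytic_near F U f p"
proof -
  obtain F where F: "finite F" "F \<subseteq> C" "\<And>p. p \<in> U \<Longrightarrow> analytic_near F U f p"
    by (rule differential_functionE[OF f]) blast
  note U = differential_function_open[OF f]
  show thesis
  proof (rule that[OF F(1,2) _ F(3)])
    fix p c assume p: "p \<in> U" and c: "c \<in> C" and nz: "pdiff c f p \<noteq> 0"
    obtain r g where "r > 0" "\<And>q. q \<in> U \<Longrightarrow> q \<in> pbox F p r \<Longrightarrow> pdiff c f q = (if c \<in> F then pdiff c g q else 0)"
      by (rule analytic_near_pdiff[OF U F(1,2) c F(3)[OF p]]) blast
    moreover from this(1) have "p \<in> pbox F p r" by (simp add: pbox_def)
    ultimately show "c \<in> F" using p nz by presburger
  qed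
qed

lemma derivation_eq_sum:
  assumes "finite F" "F \<subseteq> C" "\<And>c. c \<in> C \<Longrightarrow> pdiff c f p \<noteq> 0 \<Longrightarrow> c \<in> F"
  shows "derivation C v f p = (\<Sum>c\<in>F. v c p * pdiff c f p)"
  unfolding derivation_def by (intro sum.mono_neutral_left) (use assms in auto)

lemma differential_function_derivation:
  assumes f: "differential_function C U f" and v: "\<And>c. c \<in> C \<Longrightarrow> differential_function C U (v c)"
  shows "differential_function C U (derivation C v f)"
proof -
  obtain F where F: "finite F" "F \<subseteq> C" "\<And>p c. p \<in> U \<Longrightarrow> c \<in> C \<Longrightarrow> pdiff c f p \<noteq> 0 \<Longrightarrow> c \<in> F"
    by (rule differential_function_support[OF f]) blast
  note U = differential_function_open[OF f]
  have "differential_function C U (\<lambda>p. \<Sum>c\<in>F. v c p * pdiff c f p)"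
    by (rule differential_function_sum[OF U F(1)])
       (use F in \<open>auto intro!: differential_function_mult v differential_function_pdiff[OF f]\<close>)
  thus ?thesis by (rule differential_function_cong) (rule derivation_eq_sum[OF F(1,2) F(3), symmetric])
qed

lemma differential_function_chain:
  assumes f: "differential_function C U f" and s0: "\<gamma> s0 \<in> U" and ext: "\<And>s. \<gamma> s \<in> extensional C"
    and D: "\<And>c. c \<in> C \<Longrightarrow> ((\<lambda>s. \<gamma> s c) has_real_derivative D c) (at s0)"
  shows "((\<lambda>s. f (\<gamma> s)) has_real_derivative derivation C (\<lambda>c _. D c) f (\<gamma> s0)) (at s0)"
proof -
  obtain F where F: "finite F" "F \<subseteq> C" "\<And>p c. p \<in> U \<Longrightarrow> c \<in> C \<Longrightarrow> pdiff c f p \<noteq> 0 \<Longrightarrow> c \<in> F"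
    "\<And>p. p \<in> U \<Longrightarrow> analytic_near F U f p"
    by (rule differential_function_support[OF f]) blast
  note U = differential_function_open[OF f]
  let ?p = "\<gamma> s0"
  obtain r M g where r: "r > 0" and g: "majorized F ?p r M g" "\<forall>q\<in>U \<inter> pbox F ?p r. f q = g q"
    using F(4)[OF s0] unfolding analytic_near_def by blast
  have r2: "0 < r / 2" "r / 2 < r" using r by auto
  have pp: "?p \<in> pbox F ?p (r / 2)" using r by (simp add: pbox_def)
  define V where "V = {q \<in> extensional C. \<forall>c\<in>F. \<bar>q c - ?p c\<bar> < r} \<inter> U"
  have V: "openin (coord_space C) V" unfolding V_def by (intro openin_Int openin_cylinder F U)
  have pV: "?p \<in> V" using s0 ext r by (simp add: V_def)
  have fg: "f q = g q" if "q \<in> V" for q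
    using that g(2) by (auto simp: V_def pbox_def less_imp_le)
  have ev: "\<forall>\<^sub>F s in nhds s0. \<gamma> s \<in> V"
    by (rule eventually_in_openin[of C V \<gamma> s0, OF V pV ext]) (use D DERIV_isCont in blast)
  have "((\<lambda>s. g (\<gamma> s)) has_real_derivative (\<Sum>c\<in>F. D c * pdiff c g ?p)) (at s0)"
  proof (rule majorized_pdiff_chain[OF F(1) r2 g(1)])
    assume "\<And>q \<gamma> d s0. q \<in> pbox F ?p (r / 2) \<Longrightarrow> (\<And>c. c \<in> F \<Longrightarrow> \<gamma> s0 c = q c) \<Longrightarrow>
          (\<And>c. c \<in> F \<Longrightarrow> ((\<lambda>s. \<gamma> s c) has_real_derivative d c) (at s0)) \<Longrightarrow>
          ((\<lambda>s. g (\<gamma> s)) has_real_derivative (\<Sum>c\<in>F. d c * pdiff c g q)) (at s0)"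
    from this[of ?p \<gamma> s0 D] show ?thesis using pp D F(2) by auto
  qed
  also have "(\<Sum>c\<in>F. D c * pdiff c g ?p) = (\<Sum>c\<in>F. D c * pdiff c f ?p)"
    by (intro sum.cong refl arg_cong[of _ _ "\<lambda>x. _ * x"] pdiff_cong[OF V pV, symmetric] fg) (use F(2) in auto)
  also have "\<dots> = derivation C (\<lambda>c _. D c) f ?p"
    by (rule derivation_eq_sum[symmetric, OF F(1,2)]) (use F(3) s0 in auto)
  also have "((\<lambda>s. g (\<gamma> s)) has_real_derivative derivation C (\<lambda>c _. D c) f ?p) (at s0) \<longleftrightarrow> ?thesis"
    by (rule DERIV_cong_ev[OF refl _ refl]) (use ev in eventually_elim, use fg in simp)
  finally show ?thesis .
qed

lemma differential_function_has_pdiff: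
  assumes f: "differential_function C U f" and p: "p \<in> U" and c: "c \<in> C"
  shows "((\<lambda>s. f (p(c := s))) has_real_derivative pdiff c f p) (at (p c))"
proof -
  have "p \<in> extensional C" using openin_coord_space_subset[OF differential_function_open[OF f]] p by (rule subsetD)
  hence ext: "p(c := s) \<in> extensional C" for s using c by (auto simp: extensional_def)
  have "((\<lambda>s. f (p(c := s))) has_real_derivative derivation C (\<lambda>e _. if e = c then 1 else 0) f (p(c := p c))) (at (p c))"
  proof (rule differential_function_chain[where \<gamma> = "\<lambda>s. p(c := s)" and ?s0.0 = "p c", OF f _ ext])
    show "((\<lambda>s. (p(c := s)) e) has_real_derivative (if e = c then 1 else 0)) (at (p c))" for e
      by (cases "e = c") auto
  qed (use p in simp)
  from DERIV_imp_deriv[OF this] this show ?thesis unfolding pdiff_def by simp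
qed

text \<open>
  The chain rule for a change of coordinates between infinite-dimensional spaces: only finitely many
  coordinates \<open>c\<close> matter for \<open>f\<close>, and for each of them only finitely many coordinates of the source.
\<close>

lemma derivation_compose:
  assumes f: "differential_function C U f" and y: "\<psi> y \<in> U" "y \<in> extensional E"
    and ext: "\<And>y. y \<in> extensional E \<Longrightarrow> \<psi> y \<in> extensional C"
    and \<psi>: "\<And>c. c \<in> C \<Longrightarrow> \<exists>V. y \<in> V \<and> differential_function E V (\<lambda>y. \<psi> y c)"
  shows "derivation E v (\<lambda>y. f (\<psi> y)) y = derivation C (\<lambda>c _. derivation E v (\<lambda>y. \<psi> y c) y) f (\<psi> y)"
proof -
  obtain F where F: "finite F" "F \<subseteq> C" "\<And>p c. p \<in> U \<Longrightarrow> c \<in> C \<Longrightarrow> pdiff c f p \<noteq> 0 \<Longrightarrow> c \<in> F"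
    by (rule differential_function_support[OF f]) blast
  have "\<forall>c\<in>F. \<exists>G. finite G \<and> G \<subseteq> E \<and> (\<forall>b\<in>E. pdiff b (\<lambda>y. \<psi> y c) y \<noteq> 0 \<longrightarrow> b \<in> G)"
  proof
    fix c assume "c \<in> F"
    then obtain V where V: "y \<in> V" "differential_function E V (\<lambda>y. \<psi> y c)" using \<psi> F(2) by blast
    obtain G where "finite G" "G \<subseteq> E" "\<And>p b. p \<in> V \<Longrightarrow> b \<in> E \<Longrightarrow> pdiff b (\<lambda>y. \<psi> y c) p \<noteq> 0 \<Longrightarrow> b \<in> G"
      by (rule differential_function_support[OF V(2)]) blast
    thus "\<exists>G. finite G \<and> G \<subseteq> E \<and> (\<forall>b\<in>E. pdiff b (\<lambda>y. \<psi> y c) y \<noteq> 0 \<longrightarrow> b \<in> G)"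
      using V(1) by blast
  qed
  from bchoice[OF this] obtain G where G: "\<And>c. c \<in> F \<Longrightarrow> finite (G c)" "\<And>c. c \<in> F \<Longrightarrow> G c \<subseteq> E"
    "\<And>c b. c \<in> F \<Longrightarrow> b \<in> E \<Longrightarrow> pdiff b (\<lambda>y. \<psi> y c) y \<noteq> 0 \<Longrightarrow> b \<in> G c" by blast
  define H where "H = (\<Union>c\<in>F. G c)"
  have H: "finite H" "H \<subseteq> E" using F(1) G(1,2) by (auto simp: H_def)
  have HG: "b \<in> H" if "c \<in> F" "b \<in> E" "pdiff b (\<lambda>y. \<psi> y c) y \<noteq> 0" for b c
    using G(3)[OF that] that(1) by (auto simp: H_def)
  have pd: "pdiff b (\<lambda>y. f (\<psi> y)) y = (\<Sum>c\<in>F. pdiff b (\<lambda>y. \<psi> y c) y * pdiff c f (\<psi> y))" if b: "b \<in> E" for b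
  proof -
    have "((\<lambda>s. f (\<psi> (y(b := s)))) has_real_derivative
        derivation C (\<lambda>c _. pdiff b (\<lambda>y. \<psi> y c) y) f (\<psi> (y(b := y b)))) (at (y b))"
    proof (rule differential_function_chain[where \<gamma> = "\<lambda>s. \<psi> (y(b := s))" and ?s0.0 = "y b", OF f])
      show "\<psi> (y(b := s)) \<in> extensional C" for s
        by (rule ext) (use y(2) b in \<open>auto simp: extensional_def\<close>)
      fix c assume "c \<in> C"
      then obtain V where V: "y \<in> V" "differential_function E V (\<lambda>y. \<psi> y c)" using \<psi> by blast
      show "((\<lambda>s. \<psi> (y(b := s)) c) has_real_derivative pdiff b (\<lambda>y. \<psi> y c) y) (at (y b))"
        by (rule differential_function_has_pdiff[OF V(2,1) b])
    qed (use y in simp)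
    hence "pdiff b (\<lambda>y. f (\<psi> y)) y = derivation C (\<lambda>c _. pdiff b (\<lambda>y. \<psi> y c) y) f (\<psi> y)"
      unfolding pdiff_def by (simp add: DERIV_imp_deriv)
    also have "\<dots> = (\<Sum>c\<in>F. pdiff b (\<lambda>y. \<psi> y c) y * pdiff c f (\<psi> y))"
      by (rule derivation_eq_sum[OF F(1,2)]) (use F(3) y in auto)
    finally show ?thesis .
  qed
  have "derivation E v (\<lambda>y. f (\<psi> y)) y = (\<Sum>b\<in>H. v b y * pdiff b (\<lambda>y. f (\<psi> y)) y)"
  proof (rule derivation_eq_sum[OF H])
    fix b assume b: "b \<in> E" "pdiff b (\<lambda>y. f (\<psi> y)) y \<noteq> 0"
    then obtain c where "c \<in> F" "pdiff b (\<lambda>y. \<psi> y c) y * pdiff c f (\<psi> y) \<noteq> 0"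
      unfolding pd[OF b(1)] by (meson sum.neutral)
    thus "b \<in> H" using HG b(1) by auto
  qed
  also have "\<dots> = (\<Sum>b\<in>H. v b y * (\<Sum>c\<in>F. pdiff b (\<lambda>y. \<psi> y c) y * pdiff c f (\<psi> y)))"
    by (intro sum.cong) (use pd H in auto)
  also have "\<dots> = (\<Sum>c\<in>F. (\<Sum>b\<in>H. v b y * pdiff b (\<lambda>y. \<psi> y c) y) * pdiff c f (\<psi> y))"
    unfolding sum_distrib_left sum_distrib_right by (subst sum.swap) (simp add: mult_ac)
  also have "\<dots> = (\<Sum>c\<in>F. derivation E v (\<lambda>y. \<psi> y c) y * pdiff c f (\<psi> y))"
    by (intro sum.cong refl arg_cong[of _ _ "\<lambda>x. x * _"] derivation_eq_sum[symmetric, OF H]) (use HG in auto)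
  also have "\<dots> = derivation C (\<lambda>c _. derivation E v (\<lambda>y. \<psi> y c) y) f (\<psi> y)"
    by (rule derivation_eq_sum[symmetric, OF F(1,2)]) (use F(3) y in auto)
  finally show ?thesis .
qed

section \<open>The analytic implicit function theorem\<close>

text \<open>
  With the inverse \<open>B\<close> of the Jacobian matrix at \<open>p\<close>, the equations \<open>G = 0\<close> say that the
  displacement of the variables \<open>J\<close> is a fixed point of \<open>displacement - B G\<close>, whose derivatives in these
  variables vanish at \<open>p\<close>.
\<close>

lemma analytic_implicit_function:
  fixes G :: "'k \<Rightarrow> ('c \<Rightarrow> real) \<Rightarrow> real"
  assumes fin: "finite X" "finite J" and disj: "X \<inter> J = {}" and r: "r > 0" and eps: "\<epsilon> > 0"
    and G: "\<And>k. k \<in> I \<Longrightarrow> majorized (X \<union> J) p r (M k) (G k)"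
    and G0: "\<And>k. k \<in> I \<Longrightarrow> G k p = 0"
    and ns: "nonsingular_on I J (\<lambda>k c. pdiff c (G k) p)"
  obtains r1 R h where "0 < r1" "r1 \<le> R" "R \<le> r" "R \<le> \<epsilon>"
    and "\<And>c. c \<in> J \<Longrightarrow> majorized X p r1 (R / 2) (\<lambda>q. h c q - p c)"
    and "\<And>q. q \<in> pbox X p r1 \<Longrightarrow> q \<in> pbox J p R \<Longrightarrow>
           (\<forall>k\<in>I. G k q = 0) \<longleftrightarrow> (\<forall>c\<in>J. q c = h c q)"
proof -
  define F where "F = X \<union> J"
  have F: "finite F" using fin by (simp add: F_def)
  have I: "finite I" using ns by (simp add: nonsingular_on_def)
  obtain B where B: "\<And>k k'. k \<in> I \<Longrightarrow> k' \<in> I \<Longrightarrow> (\<Sum>c\<in>J. pdiff c (G k) p * B c k') = of_bool (k = k')"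
    and B2: "\<And>c c'. c \<in> J \<Longrightarrow> c' \<in> J \<Longrightarrow> (\<Sum>k\<in>I. B c k * pdiff c' (G k) p) = of_bool (c = c')"
    by (rule nonsingular_on_inverse[OF ns]) blast
  define H where "H c q = (q c - p c) - (\<Sum>k\<in>I. B c k * G k q)" for c q
  define b where "b c = (\<Sum>k\<in>I. \<bar>B c k\<bar> * M k)" for c
  have M0: "M k \<ge> 0" if "k \<in> I" for k by (rule majorized_nonneg[OF G[OF that]]) (use r in simp)
  have b0: "b c \<ge> 0" for c unfolding b_def by (intro sum_nonneg mult_nonneg_nonneg M0) auto
  define MM where "MM = r + sum b J"
  have HM: "majorized (X \<union> J) p r MM (H c)" if c: "c \<in> J" for c
  proof -
    have "majorized F p r (r + b c) (H c)"
      unfolding H_def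
    proof (rule majorized_diff[OF F r])
      show "majorized F p r r (\<lambda>q. q c - p c)" by (rule majorized_coord[OF F _ r]) (use c in \<open>auto simp: F_def\<close>)
      show "majorized F p r (b c) (\<lambda>q. \<Sum>k\<in>I. B c k * G k q)"
        unfolding b_def
        by (rule majorized_sum[OF F r I majorized_cmult[OF F r G[folded F_def] order_refl] order_refl])
    qed simp
    moreover have "b c \<le> sum b J" using member_le_sum[OF c, of b] b0 fin by simp
    ultimately show ?thesis unfolding F_def MM_def by (rule majorized_mono[OF _ add_left_mono])
  qed
  have H0: "H c p = 0" for c using G0 by (simp add: H_def)
  have H1: "pdiff c' (H c) p = 0" if c: "c \<in> J" "c' \<in> J" for c c'
  proof -
    have r2: "0 < r / 2" "r / 2 < r" using r by auto
    have c': "c' \<in> F" using c by (simp add: F_def)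
    have pp: "p \<in> pbox F p (r / 2)" using r by (simp add: pbox_def)
    have d: "((\<lambda>s. G k (p(c' := s))) has_real_derivative pdiff c' (G k) p) (at (p c'))" if k: "k \<in> I" for k
      by (rule majorized_pdiff_chain[OF F r2 G[OF k, folded F_def]]) (use c' pp in blast)
    have "((\<lambda>s. H c (p(c' := s))) has_real_derivative of_bool (c = c') - (\<Sum>k\<in>I. B c k * pdiff c' (G k) p)) (at (p c'))"
      unfolding H_def
    proof (rule DERIV_diff[OF _ DERIV_sum[OF DERIV_cmult[OF d]]])
      show "((\<lambda>s. (p(c' := s)) c - p c) has_real_derivative of_bool (c = c')) (at (p c'))"
        by (cases "c = c'") (auto intro!: derivative_eq_intros)
    qed
    from DERIV_imp_deriv[OF this] show ?thesis unfolding pdiff_def[of c' "H c"] by (simp add: B2[OF c])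
  qed
  obtain r1 R h where R: "0 < r1" "r1 \<le> R" "R \<le> r" "R \<le> \<epsilon>"
    and h: "\<And>c. c \<in> J \<Longrightarrow> majorized X p r1 (R / 2) (\<lambda>q. h c q - p c)"
    and iff: "\<And>q. q \<in> pbox X p r1 \<Longrightarrow> q \<in> pbox J p R \<Longrightarrow>
           (\<forall>c\<in>J. q c - p c = H c q) \<longleftrightarrow> (\<forall>c\<in>J. q c = h c q)"
    by (rule analytic_fixed_point[where H = H and M = MM, OF fin disj r eps])
       (assumption | rule HM H0 H1 that)+
  show thesis
  proof (rule that[OF R h])
    fix q assume q: "q \<in> pbox X p r1" "q \<in> pbox J p R"
    have "(\<forall>c\<in>J. q c - p c = H c q) \<longleftrightarrow> (\<forall>c\<in>J. (\<Sum>k\<in>I. B c k * G k q) = 0)"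
      unfolding H_def by auto
    also have "\<dots> \<longleftrightarrow> (\<forall>k\<in>I. G k q = 0)"
    proof (intro iffI ballI)
      fix k assume *: "\<forall>c\<in>J. (\<Sum>k\<in>I. B c k * G k q) = 0" and k: "k \<in> I"
      have "G k q = (\<Sum>k'\<in>I. if k = k' then G k' q else 0)" using I k by (simp add: sum.delta')
      also have "\<dots> = (\<Sum>k'\<in>I. (\<Sum>c\<in>J. pdiff c (G k) p * B c k') * G k' q)"
        by (intro sum.cong) (auto simp: B[OF k])
      also have "\<dots> = (\<Sum>c\<in>J. pdiff c (G k) p * (\<Sum>k'\<in>I. B c k' * G k' q))"
        unfolding sum_distrib_left sum_distrib_right by (subst sum.swap) (simp add: mult_ac)
      also have "\<dots> = 0" using * by simp
      finally show "G k q = 0" .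
    qed simp
    finally show "(\<forall>k\<in>I. G k q = 0) \<longleftrightarrow> (\<forall>c\<in>J. q c = h c q)" using iff[OF q] by simp
  qed
qed

lemma majorized_eq_on:
  assumes "majorized F p r M g" "q \<in> pbox F p r" "\<And>c. c \<in> F \<Longrightarrow> q c = q' c"
  shows "g q = g q'"
proof -
  obtain a where a: "\<forall>q\<in>pbox F p r. ((\<lambda>\<mu>. a \<mu> * mpow F p \<mu> q) has_sum g q) (F \<rightarrow>\<^sub>E UNIV)"
    using assms(1) unfolding majorized_def by blast
  have eq: "mpow F p \<mu> q = mpow F p \<mu> q'" for \<mu>
    unfolding mpow_def using assms(3) by (intro prod.cong) auto
  have "q' \<in> pbox F p r" using assms(2,3) by (simp add: pbox_def)
  from has_sum_unique[OF bspec[OF a assms(2), unfolded eq] bspec[OF a this]] show ?thesis .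
qed

lemma differential_function_openin:
  assumes f: "differential_function C U f"
  shows "openin (coord_space C) {q \<in> U. \<bar>f q - k\<bar> < \<epsilon>}"
proof (subst openin_subopen, safe)
  fix q assume q: "q \<in> U" "\<bar>f q - k\<bar> < \<epsilon>"
  obtain F where F: "finite F" "F \<subseteq> C" "\<And>p. p \<in> U \<Longrightarrow> analytic_near F U f p"
    by (rule differential_functionE[OF f]) blast
  note U = differential_function_open[OF f]
  obtain r M g where r: "r > 0" and g: "majorized F q r M g" "\<forall>p\<in>U \<inter> pbox F q r. f p = g p"
    using F(3)[OF q(1)] unfolding analytic_near_def by blast
  have r2: "0 < r / 2" "r / 2 < r" using r by auto
  obtain L where L: "\<And>p p'. p \<in> pbox F q (r / 2) \<Longrightarrow> p' \<in> pbox F q (r / 2) \<Longrightarrow> \<bar>g p - g p'\<bar> \<le> L * (\<Sum>c\<in>F. \<bar>p c - p' c\<bar>)"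
    by (rule majorized_lipschitz[OF F(1) r2 g(1)]) blast
  define K where "K = (1 + \<bar>L\<bar>) * (1 + real (card F))"
  have K: "K > 0" unfolding K_def by (intro mult_pos_pos) auto
  define \<delta> where "\<delta> = min (r / 2) ((\<epsilon> - \<bar>f q - k\<bar>) / (2 * K))"
  have \<delta>: "\<delta> > 0" using K q r by (simp add: \<delta>_def)
  have "\<delta> \<le> (\<epsilon> - \<bar>f q - k\<bar>) / (2 * K)" by (simp add: \<delta>_def)
  hence \<delta>K: "\<delta> * K \<le> (\<epsilon> - \<bar>f q - k\<bar>) / 2" using K by (simp add: field_simps)
  define T where "T = {p \<in> extensional C. \<forall>c\<in>F. \<bar>p c - q c\<bar> < \<delta>} \<inter> U"
  have "openin (coord_space C) T" unfolding T_def by (intro openin_Int openin_cylinder F U)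
  moreover have "q \<in> T" using q(1) \<delta> openin_coord_space_subset[OF U] by (auto simp: T_def)
  moreover have "T \<subseteq> {q \<in> U. \<bar>f q - k\<bar> < \<epsilon>}"
  proof
    fix p assume p: "p \<in> T"
    hence pU: "p \<in> U" by (simp add: T_def)
    have pb: "p \<in> pbox F q (r / 2)" using p by (auto simp: T_def pbox_def \<delta>_def less_imp_le)
    have qb: "q \<in> pbox F q (r / 2)" using r by (simp add: pbox_def)
    have "\<bar>f p - f q\<bar> = \<bar>g p - g q\<bar>"
      using g(2) pU q(1) pbox_mono[OF pb order_refl, of r] pbox_mono[OF qb order_refl, of r] r by auto
    also have "\<dots> \<le> L * (\<Sum>c\<in>F. \<bar>p c - q c\<bar>)" by (rule L[OF pb qb])
    also have "\<dots> \<le> (1 + \<bar>L\<bar>) * (\<Sum>c\<in>F. \<bar>p c - q c\<bar>)"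
      by (intro mult_right_mono sum_nonneg) auto
    also have "\<dots> \<le> (1 + \<bar>L\<bar>) * (\<Sum>c\<in>F. \<delta>)"
      by (intro mult_left_mono sum_mono) (use p in \<open>auto simp: T_def less_imp_le\<close>)
    also have "\<dots> \<le> (1 + \<bar>L\<bar>) * ((1 + real (card F)) * \<delta>)"
      by (intro mult_left_mono) (use \<delta> in auto)
    also have "\<dots> = \<delta> * K" by (simp add: K_def)
    finally have "\<bar>f p - f q\<bar> \<le> (\<epsilon> - \<bar>f q - k\<bar>) / 2" using \<delta>K by simp
    moreover have "\<bar>f p - k\<bar> \<le> \<bar>f p - f q\<bar> + \<bar>f q - k\<bar>" by simp
    ultimately have "\<bar>f p - k\<bar> < \<epsilon>" using q(2) by argo
    thus "p \<in> {q \<in> U. \<bar>f q - k\<bar> < \<epsilon>}" using pU by simp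
  qed
  ultimately show "\<exists>T. openin (coord_space C) T \<and> q \<in> T \<and> T \<subseteq> {q \<in> U. \<bar>f q - k\<bar> < \<epsilon>}" by blast
qed

text \<open>
  The radius may depend on the coordinate because solved variables and free variables will have
  different radii.
\<close>

definition cylinder :: "'c set \<Rightarrow> 'c set \<Rightarrow> ('c \<Rightarrow> real) \<Rightarrow> ('c \<Rightarrow> real) \<Rightarrow> ('c \<Rightarrow> real) set" where
  "cylinder C S p r = {q \<in> extensional C. \<forall>c\<in>S. \<bar>q c - p c\<bar> < r c}"

lemma cylinder_fun_upd_between:
  assumes "q \<in> cylinder C S p r" "q(c := s) \<in> cylinder C S p r" "min (q c) s \<le> t" "t \<le> max (q c) s" "c \<in> C"
  shows "q(c := t) \<in> cylinder C S p r"
proof -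
  have "\<bar>(q(c := t)) e - p e\<bar> < r e" if e: "e \<in> S" for e
  proof (cases "e = c")
    case True
    have "\<bar>q c - p c\<bar> < r c" using assms(1) e True by (simp add: cylinder_def)
    moreover have "\<bar>s - p c\<bar> < r c" using assms(2) e True by (auto simp: cylinder_def)
    ultimately have "\<bar>t - p c\<bar> < r c" using assms(3,4) by (simp add: min_def max_def split: if_splits)
    thus ?thesis using True by simp
  next
    case False
    thus ?thesis using assms(1) e by (simp add: cylinder_def)
  qed
  moreover have "q(c := t) \<in> extensional C" using assms(1,5) by (auto simp: cylinder_def extensional_def)
  ultimately show ?thesis by (simp add: cylinder_def)
qed

lemma differential_function_fun_upd_eq:
  assumes f: "differential_function C U f" and VU: "cylinder C S p r \<subseteq> U"
    and c: "c \<in> C" and z: "\<And>q. q \<in> cylinder C S p r \<Longrightarrow> pdiff c f q = 0"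
    and q: "q \<in> cylinder C S p r" "q(c := s) \<in> cylinder C S p r"
  shows "f (q(c := s)) = f q"
proof -
  have der: "((\<lambda>t. f (q(c := t))) has_real_derivative 0) (at t)" if "min (q c) s \<le> t" "t \<le> max (q c) s" for t
  proof -
    have m: "q(c := t) \<in> cylinder C S p r" by (rule cylinder_fun_upd_between[OF q that c])
    hence "q(c := t) \<in> U" using VU by blast
    from differential_function_has_pdiff[OF f this c] z[OF m] show ?thesis by simp
  qed
  have "f (q(c := max (q c) s)) = f (q(c := min (q c) s))"
  proof (cases "q c = s")
    case False
    hence lt: "min (q c) s < max (q c) s" by auto
    show ?thesis
      by (rule DERIV_isconst2[OF lt, of "\<lambda>t. f (q(c := t))" "max (q c) s"])
         (use der lt in \<open>auto intro!: DERIV_isCont continuous_at_imp_continuous_on\<close>)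
  qed simp
  thus ?thesis by (cases "q c \<le> s") (auto simp: max_def min_def)
qed

text \<open>
  The points may differ in infinitely many coordinates of \<open>D\<close>. The finitely many of these in the
  support of \<open>f\<close> are exchanged one at a time along segments of the cylinder; the others do not
  affect \<open>f\<close>.
\<close>

lemma differential_function_indep:
  assumes f: "differential_function C U f" and VU: "cylinder C S p r \<subseteq> U"
    and z: "\<And>c q. c \<in> D \<Longrightarrow> c \<in> C \<Longrightarrow> q \<in> cylinder C S p r \<Longrightarrow> pdiff c f q = 0"
    and q: "q \<in> cylinder C S p r" "q' \<in> cylinder C S p r" "\<And>c. c \<in> C \<Longrightarrow> c \<notin> D \<Longrightarrow> q c = q' c"
  shows "f q = f q'"
proof -
  obtain F where F: "finite F" "F \<subseteq> C" "\<And>p. p \<in> U \<Longrightarrow> analytic_near F U f p"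
    by (rule differential_functionE[OF f]) blast
  \<comment> \<open>\<open>m T\<close> is \<open>q\<close> with the coordinates in \<open>T\<close> exchanged for those of \<open>q'\<close>.\<close>
  define m where "m T c = (if c \<in> T then q' c else q c)" for T c
  have mC: "m T \<in> cylinder C S p r" for T using q(1,2) by (auto simp: cylinder_def m_def extensional_def)
  have "f (m T) = f q" if "finite T" "T \<subseteq> D \<inter> C" for T
    using that
  proof (induction T rule: finite_induct)
    case empty
    have "m {} = q" by (rule ext) (simp add: m_def)
    thus ?case by simp
  next
    case (insert c T)
    have eq: "m (insert c T) = (m T)(c := q' c)" by (rule ext) (simp add: m_def)
    have "f ((m T)(c := q' c)) = f (m T)"
      by (rule differential_function_fun_upd_eq[OF f VU _ z mC]) (use insert.prems mC[of "insert c T"] eq in auto)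
    also have "f (m T) = f q" using insert by simp
    finally show ?case by (simp only: eq)
  qed
  from this[of "F \<inter> D"] F have 1: "f (m (F \<inter> D)) = f q" by blast
  have q'U: "q' \<in> U" "m (F \<inter> D) \<in> U" using q(2) mC VU by auto
  obtain r M g where r: "r > 0" and g: "majorized F q' r M g" "\<forall>q\<in>U \<inter> pbox F q' r. f q = g q"
    using F(3)[OF q'U(1)] unfolding analytic_near_def by blast
  have eqF: "q' c = m (F \<inter> D) c" if "c \<in> F" for c using that q(3)[of c] F(2) by (auto simp: m_def)
  have b: "q' \<in> pbox F q' r" "m (F \<inter> D) \<in> pbox F q' r" using r eqF by (auto simp: pbox_def)
  have "f q' = f (m (F \<inter> D))"
    using majorized_eq_on[OF g(1) b(1) eqF] g(2) b q'U by simp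
  thus ?thesis using 1 by simp
qed

lemma pdiff_indep:
  assumes f: "differential_function C U f" and VU: "cylinder C S p r \<subseteq> U" and S: "finite S" "S \<subseteq> C"
    and z: "\<And>c q. c \<in> D \<Longrightarrow> c \<in> C \<Longrightarrow> q \<in> cylinder C S p r \<Longrightarrow> pdiff c f q = 0"
    and q: "q \<in> cylinder C S p r" "q' \<in> cylinder C S p r" "\<And>c. c \<in> C \<Longrightarrow> c \<notin> D \<Longrightarrow> q c = q' c"
    and c: "c \<in> C"
  shows "pdiff c f q = pdiff c f q'"
proof (cases "c \<in> D")
  case True
  thus ?thesis using z q c by simp
next
  case False
  have V: "openin (coord_space C) (cylinder C S p r)" unfolding cylinder_def by (rule openin_cylinder[OF S])
  have qc: "q c = q' c" using q(3) c False by blast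
  have "\<forall>\<^sub>F s in nhds (q c). q(c := s) \<in> cylinder C S p r"
    by (rule eventually_fun_upd_in_openin[OF V q(1) c])
  moreover have "\<forall>\<^sub>F s in nhds (q c). q'(c := s) \<in> cylinder C S p r"
    unfolding qc by (rule eventually_fun_upd_in_openin[OF V q(2) c])
  ultimately have "\<forall>\<^sub>F s in nhds (q c). f (q(c := s)) = f (q'(c := s))"
  proof eventually_elim
    case (elim s)
    show ?case by (rule differential_function_indep[OF f VU z elim]) (use q(3) in auto)
  qed
  thus ?thesis unfolding pdiff_def by (rule deriv_cong_ev) (rule qc)
qed

lemma pdiff_coord: "pdiff c (\<lambda>q. q c') p = (if c = c' then 1 else 0)"
proof -
  have "((\<lambda>s. (p(c := s)) c') has_real_derivative (if c = c' then 1 else 0)) (at (p c))"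
    by (cases "c = c'") auto
  thus ?thesis unfolding pdiff_def by (rule DERIV_imp_deriv)
qed

lemma derivation_coord: "c \<in> C \<Longrightarrow> derivation C v (\<lambda>q. q c) p = v c p"
  using derivation_eq_sum[of "{c}" C "\<lambda>q. q c" p v] by (simp add: pdiff_coord split: if_splits)

lemma derivation_const: "derivation C v (\<lambda>_. k) p = 0"
  by (simp add: derivation_def pdiff_def)

section \<open>Weights and separants of a differential system\<close>

lemma Time_in_jet_coords [simp]: "Time \<in> jet_coords n"
  and Jet_in_jet_coords [simp]: "Jet j k \<in> jet_coords n \<longleftrightarrow> j < n"
  by (auto simp: jet_coords_def)

lemma differential_function_jet_field:
  assumes "openin (coord_space (jet_coords n)) U" "c \<in> jet_coords n"
  shows "differential_function (jet_coords n) U (jet_field c)"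
proof (cases c)
  case Time
  have "jet_field c = (\<lambda>_. 1)" by (rule ext) (simp add: Time)
  thus ?thesis using differential_function_const[OF assms(1)] by simp
next
  case (Jet j k)
  have "jet_field c = (\<lambda>p. p (Jet j (Suc k)))" by (rule ext) (simp add: Jet)
  thus ?thesis using differential_function_coord[OF assms(1), of "Jet j (Suc k)"] assms(2) Jet by simp
qed

lemma differential_function_d_t:
  assumes "differential_function (jet_coords n) U f"
  shows "differential_function (jet_coords n) U (d_t n f)"
  unfolding d_t_def
  by (rule differential_function_derivation[OF assms])
     (rule differential_function_jet_field[OF differential_function_open[OF assms]])

text \<open>
  In the sum of \<open>v c * pdiff c f\<close> the factors \<open>pdiff c f\<close> do not depend on \<open>x_j^(l)\<close>, as \<open>f\<close> does not, and
  only the coefficient \<open>v c\<close> of \<open>c = x_j^(l - 1)\<close> does.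
\<close>

lemma pdiff_d_t:
  assumes f: "differential_function (jet_coords n) U f" and j: "j < n" and p: "p \<in> U"
    and z: "\<And>q. q \<in> U \<Longrightarrow> pdiff (Jet j l) f q = 0"
  shows "pdiff (Jet j l) (d_t n f) p = (case l of 0 \<Rightarrow> 0 | Suc l' \<Rightarrow> pdiff (Jet j l') f p)"
proof -
  let ?C = "jet_coords n" and ?c = "Jet j l"
  note U = differential_function_open[OF f]
  have cC: "?c \<in> ?C" using j by simp
  obtain S \<epsilon> where S: "finite S" "S \<subseteq> ?C" "\<epsilon> > 0"
    and SU: "\<And>q. q \<in> extensional ?C \<Longrightarrow> (\<And>c. c \<in> S \<Longrightarrow> \<bar>q c - p c\<bar> < \<epsilon>) \<Longrightarrow> q \<in> U"
    by (rule openin_contains_cylinder[OF U p]) blast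
  define V where "V = cylinder ?C S p (\<lambda>_. \<epsilon>)"
  have VU: "V \<subseteq> U" using SU by (auto simp: V_def cylinder_def)
  have V: "openin (coord_space ?C) V" unfolding V_def cylinder_def by (rule openin_cylinder[OF S(1,2)])
  have "p \<in> extensional ?C" using openin_coord_space_subset[OF U] p by (rule subsetD)
  hence pV: "p \<in> V" using S(3) by (simp add: V_def cylinder_def)
  obtain F where F: "finite F" "F \<subseteq> ?C" "\<And>p c. p \<in> U \<Longrightarrow> c \<in> ?C \<Longrightarrow> pdiff c f p \<noteq> 0 \<Longrightarrow> c \<in> F"
    by (rule differential_function_support[OF f]) blast
  \<comment> \<open>\<open>b c\<close> is the partial derivative of \<open>jet_field c\<close> with respect to \<open>x_j^(l)\<close>.\<close>
  define b :: "jet_coord \<Rightarrow> real" where "b c = (if jet_field c = (\<lambda>p. p ?c) then 1 else 0)" for c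
  have b: "b c = (case l of 0 \<Rightarrow> 0 | Suc l' \<Rightarrow> if c = Jet j l' then 1 else 0)" for c
  proof (cases c)
    case Time
    have "jet_field c \<noteq> (\<lambda>p. p ?c)"
    proof
      assume "jet_field c = (\<lambda>p. p ?c)"
      from fun_cong[OF this, of "\<lambda>_. 0"] show False by (simp add: Time)
    qed
    thus ?thesis using Time by (simp add: b_def split: nat.split)
  next
    case (Jet j' k)
    have "jet_field c = (\<lambda>p. p ?c) \<longleftrightarrow> Jet j' (Suc k) = ?c"
    proof
      assume *: "jet_field c = (\<lambda>p. p ?c)"
      from fun_cong[OF *, of "\<lambda>x. if x = ?c then 1 else 0"] show "Jet j' (Suc k) = ?c"
        by (simp add: Jet split: if_splits)
    next
      assume "Jet j' (Suc k) = ?c"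
      thus "jet_field c = (\<lambda>p. p ?c)" by (intro ext) (simp add: Jet)
    qed
    thus ?thesis using Jet by (auto simp: b_def split: nat.split)
  qed
  have jf: "((\<lambda>s. jet_field c (p(?c := s))) has_real_derivative b c) (at (p ?c))" for c
  proof (cases c)
    case Time
    thus ?thesis unfolding b by (auto split: nat.split)
  next
    case (Jet j' k)
    thus ?thesis unfolding b by (cases "Jet j' (Suc k) = ?c") (auto split: nat.split)
  qed
  have "((\<lambda>s. \<Sum>c\<in>F. jet_field c (p(?c := s)) * pdiff c f p) has_real_derivative (\<Sum>c\<in>F. b c * pdiff c f p)) (at (p ?c))"
    by (intro DERIV_sum DERIV_cmult_right jf)
  also have "?this \<longleftrightarrow> ((\<lambda>s. d_t n f (p(?c := s))) has_real_derivative (\<Sum>c\<in>F. b c * pdiff c f p)) (at (p ?c))"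
  proof (rule DERIV_cong_ev[OF refl _ refl])
    show "\<forall>\<^sub>F s in nhds (p ?c). (\<Sum>c\<in>F. jet_field c (p(?c := s)) * pdiff c f p) = d_t n f (p(?c := s))"
      using eventually_fun_upd_in_openin[OF V pV cC]
    proof eventually_elim
      case (elim s)
      have "d_t n f (p(?c := s)) = (\<Sum>c\<in>F. jet_field c (p(?c := s)) * pdiff c f (p(?c := s)))"
        unfolding d_t_def by (rule derivation_eq_sum[OF F(1,2)]) (use F(3) elim VU in auto)
      also have "\<dots> = (\<Sum>c\<in>F. jet_field c (p(?c := s)) * pdiff c f p)"
      proof (intro sum.cong refl arg_cong[of _ _ "\<lambda>x. _ * x"])
        fix c assume "c \<in> F"
        hence c: "c \<in> ?C" using F(2) by auto
        show "pdiff c f (p(?c := s)) = pdiff c f p"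
          by (rule pdiff_indep[OF f VU[unfolded V_def] S(1,2) _ elim[unfolded V_def] pV[unfolded V_def] _ c, of "{?c}"])
             (use z VU in \<open>auto simp: V_def\<close>)
      qed
      finally show ?case by simp
    qed
  qed
  finally have "pdiff ?c (d_t n f) p = (\<Sum>c\<in>F. b c * pdiff c f p)"
    unfolding pdiff_def[of ?c "d_t n f"] by (rule DERIV_imp_deriv)
  also have "\<dots> = (case l of 0 \<Rightarrow> 0 | Suc l' \<Rightarrow> pdiff (Jet j l') f p)"
  proof (cases l)
    case 0
    thus ?thesis by (simp add: b)
  next
    case (Suc l')
    have "(\<Sum>c\<in>F. b c * pdiff c f p) = (\<Sum>c\<in>F. if c = Jet j l' then pdiff (Jet j l') f p else 0)"
      by (intro sum.cong) (auto simp: b Suc)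
    also have "\<dots> = (if Jet j l' \<in> F then pdiff (Jet j l') f p else 0)" using F(1) by (simp add: sum.delta)
    also have "\<dots> = pdiff (Jet j l') f p" using F(3)[OF p, of "Jet j l'"] j by auto
    finally show ?thesis by (simp add: Suc)
  qed
  finally show ?thesis .
qed

text \<open>
  The numbers \<open>\<beta>\<close>, which may be negative, are eliminated by means of \<open>\<beta> (\<sigma> i) = e i - \<alpha> i\<close>, and columns
  are indexed by equations through \<open>\<sigma>\<close>, so that everything takes place in the natural numbers.
\<close>

locale weighted_system =
  fixes n s :: nat and U :: "nat \<Rightarrow> (jet_coord \<Rightarrow> real) set" and P :: "nat \<Rightarrow> (jet_coord \<Rightarrow> real) \<Rightarrow> real"
    and \<sigma> \<alpha> e :: "nat \<Rightarrow> nat" and \<eta> :: "jet_coord \<Rightarrow> real"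
  assumes P: "i < s \<Longrightarrow> differential_function (jet_coords n) (U i) (P i)"
    and eta: "\<eta> \<in> points (system_diffiety n s U P)"
    and inj_\<sigma>: "inj_on \<sigma> {..<s}" and \<sigma>_less: "i < s \<Longrightarrow> \<sigma> i < n"
    and order: "\<lbrakk>i < s; i' < s; p \<in> U i; k + \<alpha> i' > \<alpha> i + e i'\<rbrakk> \<Longrightarrow> pdiff (Jet (\<sigma> i') k) (P i) p = 0"
    and regular: "nonsingular_on {i. i < s \<and> \<alpha> i \<le> w} {i. i < s \<and> \<alpha> i \<le> w}
      (\<lambda>i i'. if \<alpha> i' \<le> \<alpha> i + e i' then pdiff (Jet (\<sigma> i') (\<alpha> i + e i' - \<alpha> i')) (P i) \<eta> else 0)"
begin

abbreviation "C \<equiv> jet_coords n"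

definition "level w = {i. i < s \<and> \<alpha> i \<le> w}"

text \<open>
  The coefficient of the derivative of \<open>x_(\<sigma> i')\<close> of top weight in every prolongation of \<open>P i\<close>.
\<close>

definition "separant i i' p =
  (if \<alpha> i' \<le> \<alpha> i + e i' then pdiff (Jet (\<sigma> i') (\<alpha> i + e i' - \<alpha> i')) (P i) p else 0)"

definition "prolong i k = (d_t n ^^ k) (P i)"

text \<open>
  The leading derivatives. The one given by \<open>i\<close> and \<open>k\<close> has weight \<open>k + \<alpha> i\<close>, like the equation
  \<open>prolong i k\<close> that is to be solved for it.
\<close>

definition "lead i k = Jet (\<sigma> i) (e i + k)"

definition "known = C - {lead i k |i k. i < s}"

lemma lead_eq_iff: "i < s \<Longrightarrow> i' < s \<Longrightarrow> lead i k = lead i' k' \<longleftrightarrow> i = i' \<and> k = k'"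
  using inj_onD[OF inj_\<sigma>, of i i'] by (auto simp: lead_def)

lemma lead_in: "i < s \<Longrightarrow> lead i k \<in> C"
  by (simp add: lead_def \<sigma>_less)

lemma coord_cases:
  assumes "c \<in> C"
  obtains "c \<in> known" | i k where "i < s" "c = lead i k"
  using assms by (auto simp: known_def)

lemma lead_notin_known: "i < s \<Longrightarrow> lead i k \<notin> known"
  by (auto simp: known_def)

lemma known_subset: "known \<subseteq> C" by (auto simp: known_def)

lemma prolong_0: "prolong i 0 = P i"
  and prolong_Suc: "prolong i (Suc k) = d_t n (prolong i k)"
  by (simp_all add: prolong_def)

lemma prolong: "i < s \<Longrightarrow> differential_function C (U i) (prolong i k)"
  by (induction k) (auto simp: prolong_0 prolong_Suc P differential_function_d_t)

lemma pdiff_prolong_above: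
  assumes "i < s" "i' < s" "p \<in> U i" "l + \<alpha> i' > k + \<alpha> i + e i'"
  shows "pdiff (Jet (\<sigma> i') l) (prolong i k) p = 0"
  using assms(3,4)
proof (induction k arbitrary: l p)
  case 0
  thus ?case using order[of i i' p l] assms by (simp add: prolong_0)
next
  case (Suc k)
  have "pdiff (Jet (\<sigma> i') l) (prolong i (Suc k)) p =
     (case l of 0 \<Rightarrow> 0 | Suc l' \<Rightarrow> pdiff (Jet (\<sigma> i') l') (prolong i k) p)"
    unfolding prolong_Suc
    by (rule pdiff_d_t[OF prolong[OF assms(1)] \<sigma>_less[OF assms(2)] Suc.prems(1)]) (use Suc in auto)
  also have "\<dots> = 0"
    by (cases l) (use Suc in auto)
  finally show ?case .
qed

lemma pdiff_prolong_top:
  assumes "i < s" "i' < s" "p \<in> U i" "l + \<alpha> i' = k + \<alpha> i + e i'"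
  shows "pdiff (Jet (\<sigma> i') l) (prolong i k) p = separant i i' p"
  using assms(4)
proof (induction k arbitrary: l)
  case 0
  hence "\<alpha> i' \<le> \<alpha> i + e i'" "l = \<alpha> i + e i' - \<alpha> i'" by auto
  thus ?case by (simp add: prolong_0 separant_def)
next
  case (Suc k)
  have "pdiff (Jet (\<sigma> i') l) (prolong i (Suc k)) p =
     (case l of 0 \<Rightarrow> 0 | Suc l' \<Rightarrow> pdiff (Jet (\<sigma> i') l') (prolong i k) p)"
    unfolding prolong_Suc
    by (rule pdiff_d_t[OF prolong[OF assms(1)] \<sigma>_less[OF assms(2)] assms(3)])
       (use pdiff_prolong_above assms Suc in auto)
  also have "\<dots> = separant i i' p"
  proof (cases l)
    case 0
    thus ?thesis using Suc.prems by (simp add: separant_def)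
  next
    case (Suc l')
    thus ?thesis using Suc.IH[of l'] Suc.prems by simp
  qed
  finally show ?case .
qed

lemma pdiff_lead_above:
  "\<lbrakk>i < s; i' < s; p \<in> U i; k' + \<alpha> i' > k + \<alpha> i\<rbrakk> \<Longrightarrow> pdiff (lead i' k') (prolong i k) p = 0"
  unfolding lead_def by (rule pdiff_prolong_above) auto

lemma pdiff_lead_top:
  "\<lbrakk>i < s; i' < s; p \<in> U i; k' + \<alpha> i' = k + \<alpha> i\<rbrakk> \<Longrightarrow> pdiff (lead i' k') (prolong i k) p = separant i i' p"
  unfolding lead_def by (rule pdiff_prolong_top) auto

definition "regular_at p \<longleftrightarrow>
  (\<forall>i<s. p \<in> U i) \<and> (\<forall>w. nonsingular_on (level w) (level w) (\<lambda>i i'. separant i i' p))"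

lemma regular_at_U: "regular_at p \<Longrightarrow> i < s \<Longrightarrow> p \<in> U i"
  by (simp add: regular_at_def)

lemma regular_at_eta: "regular_at \<eta>"
  using eta regular by (simp add: regular_at_def system_diffiety_def level_def separant_def)

lemma finite_level: "finite (level w)"
  by (rule finite_subset[of _ "{..<s}"]) (auto simp: level_def)

text \<open>
  Induction on the weight: a linearised equation of weight \<open>w\<close> involves no leading derivative of
  larger weight, those of smaller weight contribute nothing by induction, and those of weight \<open>w\<close>
  enter through the nonsingular matrix of separants of level \<open>w\<close>. Used with three kinds of \<open>\<delta>\<close>: a vector in
  the kernel of the Jacobian matrix, the failure of the implicit functions to follow the vector
  field, and the difference of the velocities at two points of the diffiety.
\<close>

lemma kernel_trivial:
  assumes p: "regular_at p" and known: "\<And>c. c \<in> known \<Longrightarrow> \<delta> c = 0"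
    and der: "\<And>i k. i < s \<Longrightarrow> k + \<alpha> i < B \<Longrightarrow> derivation C (\<lambda>c _. \<delta> c) (prolong i k) p = 0"
    and "i < s" "k + \<alpha> i < B"
  shows "\<delta> (lead i k) = 0"
  using assms(4,5)
proof (induction "k + \<alpha> i" arbitrary: i k rule: less_induct)
  case less
  define w where "w = k + \<alpha> i"
  define T where "T = (\<lambda>i'. lead i' (w - \<alpha> i')) ` level w"
  have inj: "inj_on (\<lambda>i'. lead i' (w - \<alpha> i')) (level w)"
    by (auto simp: inj_on_def level_def lead_eq_iff)
  have "\<delta> (lead l (w - \<alpha> l)) = 0" if "l \<in> level w" for l
  proof (rule nonsingular_onD[where v = "\<lambda>l. \<delta> (lead l (w - \<alpha> l))" and M = "\<lambda>i i'. separant i i' p", OF _ _ that])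
    show "nonsingular_on (level w) (level w) (\<lambda>i i'. separant i i' p)" using p by (simp add: regular_at_def)
    fix i assume "i \<in> level w"
    hence i: "i < s" "\<alpha> i \<le> w" by (auto simp: level_def)
    have pU: "p \<in> U i" by (rule regular_at_U[OF p i(1)])
    obtain F where F: "finite F" "F \<subseteq> C"
      "\<And>q c. q \<in> U i \<Longrightarrow> c \<in> C \<Longrightarrow> pdiff c (prolong i (w - \<alpha> i)) q \<noteq> 0 \<Longrightarrow> c \<in> F"
      by (rule differential_function_support[OF prolong[OF i(1)]]) blast
    have T: "finite T" "T \<subseteq> C" by (auto simp: T_def finite_level level_def lead_in)
    have "0 = derivation C (\<lambda>c _. \<delta> c) (prolong i (w - \<alpha> i)) p"
      using der[of i "w - \<alpha> i"] i less.prems by (simp add: w_def)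
    also have "\<dots> = (\<Sum>c\<in>F \<union> T. \<delta> c * pdiff c (prolong i (w - \<alpha> i)) p)"
      by (rule derivation_eq_sum) (use F T pU in auto)
    also have "\<dots> = (\<Sum>c\<in>T. \<delta> c * pdiff c (prolong i (w - \<alpha> i)) p)"
    proof (rule sum.mono_neutral_right)
      show "\<forall>c\<in>F \<union> T - T. \<delta> c * pdiff c (prolong i (w - \<alpha> i)) p = 0"
      proof
        fix c assume c: "c \<in> F \<union> T - T"
        hence "c \<in> C" using F(2) by auto
        thus "\<delta> c * pdiff c (prolong i (w - \<alpha> i)) p = 0"
        proof (cases rule: coord_cases)
          case 1
          thus ?thesis using known by simp
        next
          case (2 i' k')
          consider "k' + \<alpha> i' < w" | "k' + \<alpha> i' = w" | "k' + \<alpha> i' > w" by linarith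
          thus ?thesis
          proof cases
            case 1
            thus ?thesis using less.hyps[of k' i'] less.prems 2 by (simp add: w_def)
          next
            case a: 2
            hence "i' \<in> level w" "k' = w - \<alpha> i'" using \<open>i' < s\<close> by (auto simp: level_def)
            hence "c \<in> T" using 2 by (auto simp: T_def)
            thus ?thesis using c by simp
          next
            case 3
            thus ?thesis using pdiff_lead_above[OF i(1) \<open>i' < s\<close> pU, of "w - \<alpha> i" k'] 2 i by simp
          qed
        qed
      qed
    qed (use F T in auto)
    also have "\<dots> = (\<Sum>i'\<in>level w. \<delta> (lead i' (w - \<alpha> i')) * pdiff (lead i' (w - \<alpha> i')) (prolong i (w - \<alpha> i)) p)"
      unfolding T_def by (simp add: sum.reindex[OF inj])
    also have "\<dots> = (\<Sum>i'\<in>level w. separant i i' p * \<delta> (lead i' (w - \<alpha> i')))"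
      by (intro sum.cong) (use pdiff_lead_top i pU in \<open>auto simp: level_def\<close>)
    finally show "(\<Sum>i'\<in>level w. separant i i' p * \<delta> (lead i' (w - \<alpha> i'))) = 0" by simp
  qed
  from this[of i] show ?case using less.prems by (simp add: level_def w_def)
qed

lemma differential_function_separant:
  assumes "i < s" "i' < s"
  shows "differential_function C (U i) (separant i i')"
proof (cases "\<alpha> i' \<le> \<alpha> i + e i'")
  case True
  have "separant i i' = pdiff (Jet (\<sigma> i') (\<alpha> i + e i' - \<alpha> i')) (P i)"
    by (rule ext) (use True in \<open>simp add: separant_def\<close>)
  thus ?thesis using differential_function_pdiff[OF P[OF assms(1)]] \<sigma>_less[OF assms(2)] by simp
next
  case False
  have "separant i i' = (\<lambda>_. 0)" by (rule ext) (use False in \<open>simp add: separant_def\<close>)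
  thus ?thesis using differential_function_const[OF differential_function_open[OF P[OF assms(1)]]] by simp
qed

text \<open>
  The levels \<open>w\<close> beyond the largest \<open>\<alpha> i\<close> all give the same matrix, so there are finitely many open
  conditions.
\<close>

lemma regular_neighbourhood:
  obtains N where "openin (coord_space C) N" "\<eta> \<in> N" "\<And>q. q \<in> N \<Longrightarrow> regular_at q"
proof -
  have "\<forall>w. \<exists>\<epsilon>. \<epsilon> > 0 \<and> (\<forall>M. (\<forall>i\<in>level w. \<forall>j\<in>level w. \<bar>M i j - separant i j \<eta>\<bar> \<le> \<epsilon>) \<longrightarrow>
      nonsingular_on (level w) (level w) M)"
  proof
    fix w
    have "nonsingular_on (level w) (level w) (\<lambda>i j. separant i j \<eta>)"
      using regular_at_eta by (simp add: regular_at_def)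
    from nonsingular_on_perturb[OF this] obtain \<epsilon> where "\<epsilon> > 0"
      "\<And>M. (\<And>i j. i \<in> level w \<Longrightarrow> j \<in> level w \<Longrightarrow> \<bar>M i j - separant i j \<eta>\<bar> \<le> \<epsilon>) \<Longrightarrow>
        nonsingular_on (level w) (level w) M" by blast
    thus "\<exists>\<epsilon>. \<epsilon> > 0 \<and> (\<forall>M. (\<forall>i\<in>level w. \<forall>j\<in>level w. \<bar>M i j - separant i j \<eta>\<bar> \<le> \<epsilon>) \<longrightarrow>
      nonsingular_on (level w) (level w) M)" by auto
  qed
  from choice[OF this] obtain \<epsilon> where eps: "\<And>w. \<epsilon> w > 0"
    "\<And>w M. (\<And>i j. i \<in> level w \<Longrightarrow> j \<in> level w \<Longrightarrow> \<bar>M i j - separant i j \<eta>\<bar> \<le> \<epsilon> w) \<Longrightarrow>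
        nonsingular_on (level w) (level w) M" by blast
  define A where "A = sum \<alpha> {..<s}"
  have A: "\<alpha> i \<le> A" if "i < s" for i
    unfolding A_def using that by (intro member_le_sum) auto
  define \<epsilon>0 where "\<epsilon>0 = Min (\<epsilon> ` {..A})"
  have eps0: "\<epsilon>0 > 0" "\<And>w. w \<le> A \<Longrightarrow> \<epsilon>0 \<le> \<epsilon> w" using eps(1) by (auto simp: \<epsilon>0_def)
  define N where "N = extensional C \<inter> (\<Inter>i\<in>{..<s}. \<Inter>i'\<in>{..<s}. {q \<in> U i. \<bar>separant i i' q - separant i i' \<eta>\<bar> < \<epsilon>0})"
  have etaU: "\<eta> \<in> extensional C" "\<And>i. i < s \<Longrightarrow> \<eta> \<in> U i"
    using eta unfolding system_diffiety_def topspace_coord_space by auto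
  have top: "openin (coord_space C) (extensional C)"
    using openin_topspace[of "coord_space C"] by (simp only: topspace_coord_space)
  have op: "openin (coord_space C) (extensional C \<inter> (\<Inter>(i, i')\<in>K. {q \<in> U i. \<bar>separant i i' q - separant i i' \<eta>\<bar> < \<epsilon>0}))"
    if "finite K" "K \<subseteq> {..<s} \<times> {..<s}" for K
    using that
  proof (induction K rule: finite_induct)
    case empty
    thus ?case using top by simp
  next
    case (insert x K)
    obtain i i' where x: "x = (i, i')" by force
    have "openin (coord_space C) ({q \<in> U i. \<bar>separant i i' q - separant i i' \<eta>\<bar> < \<epsilon>0} \<inter>
       (extensional C \<inter> (\<Inter>(i, i')\<in>K. {q \<in> U i. \<bar>separant i i' q - separant i i' \<eta>\<bar> < \<epsilon>0})))"
      by (rule openin_Int[OF differential_function_openin[OF differential_function_separant]]) (use insert x in auto)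
    thus ?case by (simp add: x Int_left_commute Int_assoc)
  qed
  have "N = extensional C \<inter> (\<Inter>(i, i')\<in>{..<s} \<times> {..<s}. {q \<in> U i. \<bar>separant i i' q - separant i i' \<eta>\<bar> < \<epsilon>0})"
    by (auto simp: N_def)
  hence "openin (coord_space C) N" using op[of "{..<s} \<times> {..<s}"] by simp
  moreover have "\<eta> \<in> N" using etaU eps0(1) by (auto simp: N_def)
  moreover have "regular_at q" if q: "q \<in> N" for q
    unfolding regular_at_def
  proof (intro conjI allI impI)
    show "q \<in> U i" if "i < s" for i using q that by (auto simp: N_def)
    fix w
    \<comment> \<open>Bounding \<open>w\<close> by \<open>A\<close> leaves finitely many matrices.\<close>
    have lev: "level w = level (min w A)" using A by (force simp: level_def)
    show "nonsingular_on (level w) (level w) (\<lambda>i i'. separant i i' q)"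
      unfolding lev
    proof (rule eps(2))
      fix i j assume "i \<in> level (min w A)" "j \<in> level (min w A)"
      hence "i < s" "j < s" by (auto simp: level_def)
      hence "\<bar>separant i j q - separant i j \<eta>\<bar> < \<epsilon>0" using q by (auto simp: N_def)
      thus "\<bar>separant i j q - separant i j \<eta>\<bar> \<le> \<epsilon> (min w A)" using eps0(2)[of "min w A"] by simp
    qed
  qed
  ultimately show thesis by (rule that)
qed

end

section \<open>Solving a system for its leading derivatives\<close>

lemma finite_common_radius:
  assumes "finite K" and "\<And>k. k \<in> K \<Longrightarrow> \<exists>r>0. Q k r"
    and "\<And>k r r'. Q k r \<Longrightarrow> 0 < r' \<Longrightarrow> r' \<le> r \<Longrightarrow> Q k r'"
  shows "\<exists>r>0::real. \<forall>k\<in>K. Q k r"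
  using assms(1,2)
proof (induction K rule: finite_induct)
  case empty
  show ?case by (rule exI[of _ 1]) simp
next
  case (insert k K)
  then obtain r where r: "r > 0" "\<forall>k\<in>K. Q k r" by auto
  obtain r' where r': "r' > 0" "Q k r'" using insert.prems by auto
  have "Q k' (min r r')" if "k' \<in> insert k K" for k'
    using that r r' assms(3)[of k r' "min r r'"] assms(3)[of k' r "min r r'"] by auto
  thus ?case using r r' by (intro exI[of _ "min r r'"]) auto
qed

context weighted_system
begin

definition "leads A = {lead i k |i k. i < s \<and> k + \<alpha> i \<le> A}"

definition "nbhd A X r1 R = cylinder C (X \<union> leads A) \<eta> (\<lambda>c. if c \<in> leads A then R else r1)"

lemma eta_ext: "\<eta> \<in> extensional C"
  using eta unfolding system_diffiety_def topspace_coord_space by simp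

lemma finite_leads: "finite (leads A)"
proof -
  have "leads A \<subseteq> (\<lambda>(i, k). lead i k) ` ({..<s} \<times> {..A})" by (auto simp: leads_def)
  thus ?thesis by (rule finite_subset) auto
qed

lemma leads_subset: "leads A \<subseteq> C" by (auto simp: leads_def lead_in)

lemma known_leads_disjoint: "known \<inter> leads A = {}"
  using lead_notin_known by (auto simp: leads_def)

lemma lead_in_leads: "i < s \<Longrightarrow> lead i k \<in> leads A \<longleftrightarrow> k + \<alpha> i \<le> A"
  by (auto simp: leads_def lead_eq_iff)

text \<open>
  The bound \<open>A\<close> has to cover all \<open>\<alpha> i\<close> and also the leading derivatives among the finitely many
  coordinates that define a regular neighbourhood of \<open>\<eta>\<close>; then the resulting neighbourhood only
  restricts free coordinates and leading derivatives that are solved for.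
\<close>

lemma local_solution:
  obtains A X r1 R h where "finite X" "X \<subseteq> known" "0 < r1" "r1 \<le> R" "\<And>i. i < s \<Longrightarrow> \<alpha> i \<le> A"
    and "\<And>c. c \<in> leads A \<Longrightarrow> majorized X \<eta> r1 (R / 2) (\<lambda>q. h c q - \<eta> c)"
    and "\<And>q. q \<in> nbhd A X r1 R \<Longrightarrow> regular_at q"
    and "\<And>q. q \<in> nbhd A X r1 R \<Longrightarrow>
      (\<forall>i k. i < s \<longrightarrow> k + \<alpha> i \<le> A \<longrightarrow> prolong i k q = 0) \<longleftrightarrow> (\<forall>c\<in>leads A. q c = h c q)"
proof -
  obtain N0 where N0: "openin (coord_space C) N0" "\<eta> \<in> N0" "\<And>q. q \<in> N0 \<Longrightarrow> regular_at q"
    by (rule regular_neighbourhood) (rule that)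
  obtain S \<epsilon> where S: "finite S" "S \<subseteq> C" "\<epsilon> > 0"
    and SN: "\<And>q. q \<in> extensional C \<Longrightarrow> (\<And>c. c \<in> S \<Longrightarrow> \<bar>q c - \<eta> c\<bar> < \<epsilon>) \<Longrightarrow> q \<in> N0"
    by (rule openin_contains_cylinder[OF N0(1,2)]) blast
  define len where "len c = (case c of Time \<Rightarrow> 0 | Jet j l \<Rightarrow> l)" for c
  define A where "A = sum \<alpha> {..<s} + sum len S"
  have A: "\<alpha> i \<le> sum \<alpha> {..<s}" if "i < s" for i
    using that by (intro member_le_sum) auto
  define K where "K = {(i, k). i < s \<and> k + \<alpha> i \<le> A}"
  have K: "finite K" by (rule finite_subset[of _ "{..<s} \<times> {..A}"]) (auto simp: K_def)
  let ?pr = "\<lambda>(i, k). prolong i k" and ?ld = "\<lambda>(i, k). lead i k"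
  define J where "J = leads A"
  have JK: "J = ?ld ` K" by (auto simp: J_def leads_def K_def)
  have J: "finite J" "J \<subseteq> C" "known \<inter> J = {}"
    unfolding J_def by (rule finite_leads leads_subset known_leads_disjoint)+
  have injK: "inj_on ?ld K" by (auto simp: inj_on_def K_def lead_eq_iff)
  have "\<forall>x\<in>K. \<exists>F. finite F \<and> F \<subseteq> C \<and>
      (\<forall>q\<in>U (fst x). \<forall>c\<in>C. pdiff c (?pr x) q \<noteq> 0 \<longrightarrow> c \<in> F) \<and> analytic_near F (U (fst x)) (?pr x) \<eta>"
  proof
    fix x assume "x \<in> K"
    then obtain i k where x: "x = (i, k)" "i < s" by (auto simp: K_def)
    have "\<eta> \<in> U i" by (rule regular_at_U[OF regular_at_eta x(2)])
    show "\<exists>F. finite F \<and> F \<subseteq> C \<and>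
      (\<forall>q\<in>U (fst x). \<forall>c\<in>C. pdiff c (?pr x) q \<noteq> 0 \<longrightarrow> c \<in> F) \<and> analytic_near F (U (fst x)) (?pr x) \<eta>"
    proof (rule differential_function_support[OF prolong[OF x(2), of k]])
      fix F assume "finite F" "F \<subseteq> C"
        "\<And>q c. q \<in> U i \<Longrightarrow> c \<in> C \<Longrightarrow> pdiff c (prolong i k) q \<noteq> 0 \<Longrightarrow> c \<in> F"
        "\<And>q. q \<in> U i \<Longrightarrow> analytic_near F (U i) (prolong i k) q"
      thus ?thesis using \<open>\<eta> \<in> U i\<close> by (intro exI[of _ F] conjI ballI impI) (simp_all add: x(1))
    qed
  qed
  from bchoice[OF this] obtain F where F0: "\<forall>x\<in>K. finite (F x) \<and> F x \<subseteq> C \<and>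
      (\<forall>q\<in>U (fst x). \<forall>c\<in>C. pdiff c (?pr x) q \<noteq> 0 \<longrightarrow> c \<in> F x) \<and> analytic_near (F x) (U (fst x)) (?pr x) \<eta>" ..
  have F: "finite (F x)" "F x \<subseteq> C" "analytic_near (F x) (U (fst x)) (?pr x) \<eta>" if "x \<in> K" for x
    by (fact conjunct1[OF bspec[OF F0 that]] conjunct1[OF conjunct2[OF bspec[OF F0 that]]]
        conjunct2[OF conjunct2[OF conjunct2[OF bspec[OF F0 that]]]])+
  have F3: "c \<in> F x" if "x \<in> K" "q \<in> U (fst x)" "c \<in> C" "pdiff c (?pr x) q \<noteq> 0" for x q c
    using bspec[OF F0 that(1)] that(2-4) by (elim conjE) (drule (1) bspec, drule (1) bspec, erule (1) mp)
  define X where "X = known \<inter> (S \<union> (\<Union>x\<in>K. F x))"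
  have X: "finite X" "X \<subseteq> known" using S K F(1) by (auto simp: X_def)
  have XJ: "X \<inter> J = {}" "finite (X \<union> J)" "X \<union> J \<subseteq> C"
    using X J known_subset by auto
  have SXJ: "c \<in> X \<union> J" if c: "c \<in> S" for c
  proof -
    have "c \<in> C" using c S by auto
    thus ?thesis
    proof (cases rule: coord_cases)
      case 1
      thus ?thesis using c by (simp add: X_def)
    next
      case (2 i k)
      have "e i + k \<le> sum len S"
        using member_le_sum[OF c, of len] S(1) 2 by (simp add: len_def lead_def)
      hence "k + \<alpha> i \<le> A" using A[OF 2(1)] by (simp add: A_def)
      thus ?thesis using 2 by (simp add: J_def lead_in_leads)
    qed
  qed
  \<comment> \<open>All of \<open>V\<close> is regular because \<open>S \<subseteq> X \<union> J\<close>.\<close>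
  define V where "V = cylinder C (X \<union> J) \<eta> (\<lambda>_. \<epsilon>)"
  have VN: "q \<in> N0" if "q \<in> V" for q
    by (rule SN) (use that SXJ in \<open>auto simp: V_def cylinder_def\<close>)
  have VU: "V \<subseteq> U i" if "i < s" for i
    using regular_at_U[OF N0(3)[OF VN] that] by auto
  \<comment> \<open>The equations must be functions of \<open>X \<union> J\<close> only, so all other coordinates are frozen at \<open>\<eta>\<close>. On \<open>V\<close>
    this does not change the values: the frozen coordinates are outside the support or of too large weight.\<close>
  define freeze where "freeze q c = (if c \<in> X \<union> J then q c else \<eta> c)" for q c
  define Z where "Z x q = ?pr x (freeze q)" for x q
  have exV: "freeze q \<in> V" if "\<And>c. c \<in> X \<union> J \<Longrightarrow> \<bar>q c - \<eta> c\<bar> < \<epsilon>" for q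
    unfolding V_def cylinder_def
  proof (rule CollectI, rule conjI)
    show "freeze q \<in> extensional C" unfolding extensional_def
    proof (rule CollectI, intro allI impI)
      fix c assume "c \<notin> C"
      hence "c \<notin> X \<union> J" using XJ(3) by auto
      thus "freeze q c = undefined" using eta_ext \<open>c \<notin> C\<close> by (simp add: freeze_def extensional_def)
    qed
  qed (use that in \<open>simp add: freeze_def\<close>)
  have Z: "?pr x q = Z x q" if x: "x \<in> K" and q: "q \<in> V" for x q
  proof -
    obtain i k where ik: "x = (i, k)" "i < s" "k + \<alpha> i \<le> A" using x by (auto simp: K_def)
    have "prolong i k q = prolong i k (freeze q)"
    proof (rule differential_function_indep[OF prolong[OF ik(2)] VU[OF ik(2), unfolded V_def], of "C - (X \<union> J)"])
      show "q \<in> cylinder C (X \<union> J) \<eta> (\<lambda>_. \<epsilon>)" using q by (simp add: V_def)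
      show "freeze q \<in> cylinder C (X \<union> J) \<eta> (\<lambda>_. \<epsilon>)"
        unfolding V_def[symmetric] by (rule exV) (use q in \<open>simp add: V_def cylinder_def\<close>)
      show "q c = freeze q c" if "c \<in> C" "c \<notin> C - (X \<union> J)" for c using that by (simp add: freeze_def)
      fix c p assume c: "c \<in> C - (X \<union> J)" "c \<in> C" and "p \<in> cylinder C (X \<union> J) \<eta> (\<lambda>_. \<epsilon>)"
      hence p: "p \<in> U i" using VU[OF ik(2)] by (auto simp: V_def)
      from c(2) show "pdiff c (prolong i k) p = 0"
      proof (cases rule: coord_cases)
        case 1
        hence "c \<notin> F x" using c x by (auto simp: X_def)
        thus ?thesis using F3[OF x _ c(2), of p] p by (auto simp: ik(1))
      next
        case (2 i' k')
        hence "\<not> k' + \<alpha> i' \<le> A" using c by (simp add: J_def lead_in_leads)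
        thus ?thesis using pdiff_lead_above[OF ik(2) 2(1) p, of k k'] 2 ik by simp
      qed
    qed
    thus ?thesis by (simp add: Z_def ik(1))
  qed
  have "\<exists>r>0. \<forall>x\<in>K. \<exists>M. majorized (X \<union> J) \<eta> r M (Z x)"
  proof (rule finite_common_radius[OF K])
    fix x assume x: "x \<in> K"
    obtain i k where ik: "x = (i, k)" "i < s" using x by (auto simp: K_def)
    obtain r M g where r: "r > 0" and g: "majorized (F x) \<eta> r M g" "\<forall>q\<in>U i \<inter> pbox (F x) \<eta> r. prolong i k q = g q"
      using F(3)[OF x] unfolding analytic_near_def ik(1) by auto
    define r' where "r' = min r (\<epsilon> / 2)"
    have r': "r' > 0" "r' \<le> r" "r' < \<epsilon>" using r S(3) by (auto simp: r'_def)
    have exc: "majorized (X \<union> J) \<eta> r' r (\<lambda>q. freeze q c - \<eta> c)" for c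
    proof (cases "c \<in> X \<union> J")
      case True
      thus ?thesis using majorized_coord[OF XJ(2) True r'(1,2)] by (simp add: freeze_def)
    next
      case False
      thus ?thesis using majorized_const[OF XJ(2) r'(1), of 0 r] r by (simp add: freeze_def)
    qed
    have "majorized (X \<union> J) \<eta> r' M (\<lambda>q. g (freeze q))"
      by (rule majorized_compose[OF F(1)[OF x] r XJ(2) r'(1) g(1) exc])
    hence "majorized (X \<union> J) \<eta> r' M (Z x)"
    proof (rule majorized_cong)
      fix q assume q: "q \<in> pbox (X \<union> J) \<eta> r'"
      have "freeze q \<in> V" by (rule exV) (use q r' in \<open>force simp: pbox_def\<close>)
      hence "freeze q \<in> U i" using VU[OF ik(2)] by auto
      moreover have "freeze q \<in> pbox (F x) \<eta> r" using majorized_bound[OF exc q] by (simp add: pbox_def)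
      ultimately show "g (freeze q) = Z x q" using g(2) by (simp add: Z_def ik(1))
    qed
    thus "\<exists>r>0. \<exists>M. majorized (X \<union> J) \<eta> r M (Z x)" using r'(1) by blast
  next
    fix x and r r' :: real assume "\<exists>M. majorized (X \<union> J) \<eta> r M (Z x)" "0 < r'" "r' \<le> r"
    thus "\<exists>M. majorized (X \<union> J) \<eta> r' M (Z x)" using majorized_shrink_radius[OF XJ(2)] by blast
  qed
  then obtain r where r: "r > 0" and "\<forall>x\<in>K. \<exists>M. majorized (X \<union> J) \<eta> r M (Z x)" by blast
  from bchoice[OF this(2)] obtain M where M: "\<And>x. x \<in> K \<Longrightarrow> majorized (X \<union> J) \<eta> r (M x) (Z x)" by blast
  have freeze_eta: "freeze \<eta> = \<eta>" by (rule ext) (simp add: freeze_def)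
  have Z0: "Z x \<eta> = 0" if "x \<in> K" for x
    using eta that by (auto simp: Z_def freeze_eta K_def prolong_def system_diffiety_def)
  have pdZ: "pdiff c (Z x) \<eta> = pdiff c (?pr x) \<eta>" if c: "c \<in> J" for c x
  proof -
    have "freeze (\<eta>(c := t)) = \<eta>(c := t)" for t by (rule ext) (use c in \<open>simp add: freeze_def\<close>)
    thus ?thesis by (simp add: pdiff_def Z_def)
  qed
  have ns: "nonsingular_on K J (\<lambda>x c. pdiff c (Z x) \<eta>)"
    unfolding nonsingular_on_def
  proof (intro conjI allI impI)
    show "card K = card J" unfolding JK by (rule card_image[OF injK, symmetric])
    fix v assume v: "\<forall>x\<in>K. (\<Sum>c\<in>J. pdiff c (Z x) \<eta> * v c) = 0"
    define \<delta> where "\<delta> c = (if c \<in> J then v c else 0)" for c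
    have der: "derivation C (\<lambda>c _. \<delta> c) (prolong i k) \<eta> = 0" if ik: "i < s" "k + \<alpha> i < Suc A" for i k
    proof -
      have x: "(i, k) \<in> K" using ik by (simp add: K_def)
      have "derivation C (\<lambda>c _. \<delta> c) (prolong i k) \<eta> = (\<Sum>c\<in>F (i, k) \<union> J. \<delta> c * pdiff c (prolong i k) \<eta>)"
        by (rule derivation_eq_sum) (use F(1,2)[OF x] F3[OF x] J regular_at_U[OF regular_at_eta ik(1)] in auto)
      also have "\<dots> = (\<Sum>c\<in>J. \<delta> c * pdiff c (prolong i k) \<eta>)"
        by (rule sum.mono_neutral_right) (use F(1)[OF x] J in \<open>auto simp: \<delta>_def\<close>)
      also have "\<dots> = (\<Sum>c\<in>J. pdiff c (Z (i, k)) \<eta> * v c)"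
        by (intro sum.cong) (simp_all add: \<delta>_def pdZ)
      finally show ?thesis using v x by simp
    qed
    show "\<forall>c\<in>J. v c = 0"
    proof
      fix c assume c: "c \<in> J"
      then obtain i k where ik: "c = lead i k" "i < s" "k + \<alpha> i < Suc A"
        by (auto simp: J_def leads_def)
      have "\<delta> (lead i k) = 0"
        by (rule kernel_trivial[OF regular_at_eta _ der ik(2,3)]) (use J(3) in \<open>auto simp: \<delta>_def\<close>)
      thus "v c = 0" using c by (simp add: \<delta>_def ik(1))
    qed
  qed (use K J in auto)
  have eps2: "\<epsilon> / 2 > 0" using S(3) by simp
  obtain r1 R h where R: "0 < r1" "r1 \<le> R" "R \<le> r" "R \<le> \<epsilon> / 2"
    and h: "\<And>c. c \<in> J \<Longrightarrow> majorized X \<eta> r1 (R / 2) (\<lambda>q. h c q - \<eta> c)"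
    and iff: "\<And>q. q \<in> pbox X \<eta> r1 \<Longrightarrow> q \<in> pbox J \<eta> R \<Longrightarrow>
           (\<forall>x\<in>K. Z x q = 0) \<longleftrightarrow> (\<forall>c\<in>J. q c = h c q)"
    by (rule analytic_implicit_function[OF X(1) J(1) XJ(1) r eps2 M Z0 ns])
       (assumption | rule that)+
  have NV: "q \<in> V" if q: "q \<in> nbhd A X r1 R" for q
  proof -
    have "\<bar>q c - \<eta> c\<bar> < \<epsilon>" if "c \<in> X \<union> J" for c
    proof -
      have "\<bar>q c - \<eta> c\<bar> < (if c \<in> J then R else r1)"
        using q that unfolding nbhd_def cylinder_def J_def by blast
      thus ?thesis using R S(3) by (simp split: if_splits)
    qed
    thus ?thesis using q by (simp add: V_def nbhd_def cylinder_def)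
  qed
  show thesis
  proof (rule that[OF X R(1,2)])
    show "\<alpha> i \<le> A" if "i < s" for i using A[OF that] by (simp add: A_def)
    show "majorized X \<eta> r1 (R / 2) (\<lambda>q. h c q - \<eta> c)" if "c \<in> leads A" for c
      using h that by (simp add: J_def)
    fix q assume q: "q \<in> nbhd A X r1 R"
    show "regular_at q" by (rule N0(3)[OF VN[OF NV[OF q]]])
    have qb: "\<bar>q c - \<eta> c\<bar> < (if c \<in> J then R else r1)" if "c \<in> X \<union> J" for c
      using q that unfolding nbhd_def cylinder_def J_def by blast
    have q1: "q \<in> pbox X \<eta> r1" unfolding pbox_def
    proof (rule CollectI, rule ballI)
      fix c assume c: "c \<in> X"
      hence "c \<notin> J" using XJ(1) by auto
      thus "\<bar>q c - \<eta> c\<bar> \<le> r1" using qb[of c] c by simp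
    qed
    have q2: "q \<in> pbox J \<eta> R" using qb by (force simp: pbox_def)
    have "(\<forall>i k. i < s \<longrightarrow> k + \<alpha> i \<le> A \<longrightarrow> prolong i k q = 0) \<longleftrightarrow> (\<forall>x\<in>K. ?pr x q = 0)"
      by (auto simp: K_def)
    also have "\<dots> \<longleftrightarrow> (\<forall>x\<in>K. Z x q = 0)" using Z[OF _ NV[OF q]] by simp
    also have "\<dots> \<longleftrightarrow> (\<forall>c\<in>J. q c = h c q)" by (rule iff[OF q1 q2])
    finally show "(\<forall>i k. i < s \<longrightarrow> k + \<alpha> i \<le> A \<longrightarrow> prolong i k q = 0) \<longleftrightarrow> (\<forall>c\<in>leads A. q c = h c q)"
      by (simp add: J_def)
  qed
qed

end

section \<open>The representation given by the non-leading derivatives\<close>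

text \<open>
  The map \<open>\<iota>\<close> names the free coordinates by time, states and inputs. The derivatives of one variable
  that is an input are consecutive, which makes the derivation on inputs a shift.
\<close>

locale parametrized_system = weighted_system +
  fixes A :: nat and X :: "jet_coord set" and r1 R :: real and h :: "jet_coord \<Rightarrow> (jet_coord \<Rightarrow> real) \<Rightarrow> real"
    and d m :: nat and \<iota> :: "rep_coord \<Rightarrow> jet_coord"
  assumes X: "finite X" "X \<subseteq> known" and r1: "0 < r1" "r1 \<le> R" and A: "i < s \<Longrightarrow> \<alpha> i \<le> A"
    and h: "c \<in> leads A \<Longrightarrow> majorized X \<eta> r1 (R / 2) (\<lambda>q. h c q - \<eta> c)"
    and regular_nbhd: "q \<in> nbhd A X r1 R \<Longrightarrow> regular_at q"
    and solution: "q \<in> nbhd A X r1 R \<Longrightarrow>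
      (\<forall>i k. i < s \<longrightarrow> k + \<alpha> i \<le> A \<longrightarrow> prolong i k q = 0) \<longleftrightarrow> (\<forall>c\<in>leads A. q c = h c q)"
    and bij_\<iota>: "bij_betw \<iota> (rep_coords d m) known"
    and \<iota>_RTime: "\<iota> RTime = Time"
    and \<iota>_Input: "b < m \<Longrightarrow> \<exists>j. \<forall>l. \<iota> (Input b l) = Jet j l"
begin

abbreviation "E \<equiv> rep_coords d m"
abbreviation "N \<equiv> nbhd A X r1 R"

definition "\<kappa> = inv_into E \<iota>"

definition "lift y = (\<lambda>c. y (\<kappa> c))"

definition "W = cylinder E (\<kappa> ` X) (\<lambda>b. \<eta> (\<iota> b)) (\<lambda>_. r1)"

text \<open>
  The point over \<open>y\<close> on the graph of the implicit functions. Leading derivatives of weight beyond \<open>A\<close>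
  get the values at \<open>\<eta>\<close> as placeholders: equations up to weight \<open>A\<close> do not involve them.
\<close>

definition "graph y c = (if c \<in> known then y (\<kappa> c) else if c \<in> leads A then h c (lift y) else \<eta> c)"

text \<open>
  A state moves with the velocity of the corresponding jet coordinate at the point of the graph,
  which is another state or an implicit function.
\<close>

definition "vf = rep_field (\<lambda>a y. jet_field (\<iota> (State a)) (graph y))"

definition "D = derivation E vf"

lemma kappa_in: "c \<in> known \<Longrightarrow> \<kappa> c \<in> E"
  unfolding \<kappa>_def by (rule inv_into_into) (use bij_\<iota> in \<open>auto simp: bij_betw_def\<close>)

lemma iota_kappa: "c \<in> known \<Longrightarrow> \<iota> (\<kappa> c) = c"
  unfolding \<kappa>_def by (rule bij_betw_inv_into_right[OF bij_\<iota>])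

lemma kappa_iota: "b \<in> E \<Longrightarrow> \<kappa> (\<iota> b) = b"
  unfolding \<kappa>_def by (rule bij_betw_inv_into_left[OF bij_\<iota>])

lemma iota_in: "b \<in> E \<Longrightarrow> \<iota> b \<in> known"
  using bij_betwE[OF bij_\<iota>] by blast

lemma kappa_X: "finite (\<kappa> ` X)" "\<kappa> ` X \<subseteq> E"
  using X kappa_in by auto

lemma openin_W: "openin (coord_space E) W"
  unfolding W_def cylinder_def by (rule openin_cylinder[OF kappa_X])

lemma W_ext: "y \<in> W \<Longrightarrow> y \<in> extensional E"
  by (simp add: W_def cylinder_def)

lemma W_bound: "y \<in> W \<Longrightarrow> c \<in> X \<Longrightarrow> \<bar>y (\<kappa> c) - \<eta> c\<bar> < r1"
  using X iota_kappa by (force simp: W_def cylinder_def)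

lemma lift_in_pbox: "y \<in> W \<Longrightarrow> lift y \<in> pbox X \<eta> r1"
  using W_bound by (auto simp: pbox_def lift_def less_imp_le)

lemma openin_nbhd: "openin (coord_space C) N"
  unfolding nbhd_def cylinder_def
  by (rule openin_cylinder) (use X finite_leads leads_subset known_subset in auto)

lemma eta_nbhd: "\<eta> \<in> N"
  using eta_ext r1 by (simp add: nbhd_def cylinder_def)

lemma nbhdI:
  assumes "q \<in> extensional C" "\<And>c. c \<in> X \<Longrightarrow> \<bar>q c - \<eta> c\<bar> < r1" "\<And>c. c \<in> leads A \<Longrightarrow> \<bar>q c - \<eta> c\<bar> < R"
  shows "q \<in> N"
  using assms by (auto simp: nbhd_def cylinder_def)

lemma nbhdD:
  assumes "q \<in> N"
  shows "q \<in> extensional C" "c \<in> X \<Longrightarrow> \<bar>q c - \<eta> c\<bar> < r1" "c \<in> leads A \<Longrightarrow> \<bar>q c - \<eta> c\<bar> < R"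
proof -
  show "q \<in> extensional C" using assms by (simp add: nbhd_def cylinder_def)
  have *: "\<bar>q c - \<eta> c\<bar> < (if c \<in> leads A then R else r1)" if "c \<in> X \<union> leads A" for c
    using assms that unfolding nbhd_def cylinder_def by blast
  show "\<bar>q c - \<eta> c\<bar> < R" if "c \<in> leads A" using *[of c] that by simp
  show "\<bar>q c - \<eta> c\<bar> < r1" if "c \<in> X"
  proof -
    have "c \<notin> leads A" using that X known_leads_disjoint by auto
    thus ?thesis using *[of c] that by simp
  qed
qed

lemma analytic_h:
  assumes c: "c \<in> leads A"
  shows "differential_function E W (\<lambda>y. h c (lift y))"
proof (rule differential_functionI[OF openin_W kappa_X])
  fix p assume p: "p \<in> W"
  define r where "r = Min (insert r1 ((\<lambda>c. r1 - \<bar>p (\<kappa> c) - \<eta> c\<bar>) ` X))"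
  have r: "r > 0" "\<And>c. c \<in> X \<Longrightarrow> r + \<bar>p (\<kappa> c) - \<eta> c\<bar> \<le> r1"
  proof -
    show "r > 0" unfolding r_def using X r1 W_bound[OF p] by (subst Min_gr_iff) auto
    fix c assume "c \<in> X"
    hence "r \<le> r1 - \<bar>p (\<kappa> c) - \<eta> c\<bar>" unfolding r_def using X by (intro Min_le) auto
    thus "r + \<bar>p (\<kappa> c) - \<eta> c\<bar> \<le> r1" by simp
  qed
  have "majorized (\<kappa> ` X) p r (R / 2) (\<lambda>y. h c (lift y) - \<eta> c)"
  proof (rule majorized_compose[OF X(1) r1(1) kappa_X(1) r(1) h[OF c]])
    fix c' assume c': "c' \<in> X"
    have "majorized (\<kappa> ` X) p r r1 (\<lambda>y. (y (\<kappa> c') - p (\<kappa> c')) + (p (\<kappa> c') - \<eta> c'))"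
      by (rule majorized_add[OF kappa_X(1) r(1) majorized_coord majorized_const])
         (use kappa_X(1) r c' in auto)
    thus "majorized (\<kappa> ` X) p r r1 (\<lambda>y. lift y c' - \<eta> c')" by (simp add: lift_def)
  qed
  from majorized_add[OF kappa_X(1) r(1) this majorized_const[where k = "\<eta> c", OF kappa_X(1) r(1) order_refl] order_refl]
  have "majorized (\<kappa> ` X) p r (R / 2 + \<bar>\<eta> c\<bar>) (\<lambda>y. h c (lift y))" by simp
  thus "analytic_near (\<kappa> ` X) W (\<lambda>y. h c (lift y)) p" by (rule analytic_nearI[OF r(1)])
qed

lemma h_bound: "c \<in> leads A \<Longrightarrow> y \<in> W \<Longrightarrow> \<bar>h c (lift y) - \<eta> c\<bar> < R"
  using majorized_bound[OF h lift_in_pbox, of c y] r1 by fastforce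

lemma h_eq:
  assumes "c \<in> leads A" "q \<in> N" "\<And>c. c \<in> X \<Longrightarrow> q c = q' c"
  shows "h c q = h c q'"
proof -
  have "q \<in> pbox X \<eta> r1" using nbhdD(2)[OF assms(2)] by (auto simp: pbox_def less_imp_le)
  from majorized_eq_on[OF h[OF assms(1)] this assms(3)] show ?thesis by simp
qed

lemma graph_known: "c \<in> known \<Longrightarrow> graph y c = y (\<kappa> c)"
  by (simp add: graph_def)

lemma graph_lead: "c \<in> leads A \<Longrightarrow> graph y c = h c (lift y)"
  using known_leads_disjoint by (auto simp: graph_def)

lemma graph_differential:
  assumes "c \<in> C"
  shows "differential_function E W (\<lambda>y. graph y c)"
proof -
  consider "c \<in> known" | "c \<in> leads A" | "c \<notin> known" "c \<notin> leads A" by blast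
  thus ?thesis
  proof cases
    case 1
    thus ?thesis using differential_function_coord[OF openin_W kappa_in[OF 1]] by (simp add: graph_def)
  next
    case 2
    thus ?thesis using analytic_h[OF 2] by (simp add: graph_lead)
  next
    case 3
    thus ?thesis using differential_function_const[OF openin_W] by (simp add: graph_def)
  qed
qed

lemma graph_extensional: "graph y \<in> extensional C"
  using eta_ext leads_subset known_subset by (auto simp: graph_def extensional_def)

lemma in_nbhd_of_graph:
  assumes "y \<in> W" "q \<in> extensional C" "\<And>c. c \<in> known \<union> leads A \<Longrightarrow> q c = graph y c"
  shows "q \<in> N"
proof (rule nbhdI[OF assms(2)])
  show "\<bar>q c - \<eta> c\<bar> < r1" if "c \<in> X" for c
    using W_bound[OF assms(1) that] X(2) that assms(3)[of c] by (auto simp: graph_known)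
  show "\<bar>q c - \<eta> c\<bar> < R" if "c \<in> leads A" for c
    using h_bound[OF that assms(1)] assms(3)[of c] that by (simp add: graph_lead)
qed

lemma prolong_zero_of_graph:
  assumes y: "y \<in> W" and q: "q \<in> extensional C" "\<And>c. c \<in> known \<union> leads A \<Longrightarrow> q c = graph y c"
    and i: "i < s" "k + \<alpha> i \<le> A"
  shows "prolong i k q = 0"
proof -
  have qN: "q \<in> N" by (rule in_nbhd_of_graph[OF y q])
  have "q c = h c q" if c: "c \<in> leads A" for c
  proof -
    have "h c q = h c (lift y)"
      by (rule h_eq[OF c qN]) (use q(2) X(2) in \<open>auto simp: graph_known lift_def\<close>)
    thus ?thesis using q(2)[of c] c by (simp add: graph_lead)
  qed
  thus ?thesis using solution[OF qN] i by blast
qed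

lemma known_succ_cases:
  assumes "Jet j l \<in> known"
  obtains "Jet j (Suc l) \<in> known" | i where "i < s" "Jet j (Suc l) = lead i 0"
proof -
  have "Jet j (Suc l) \<in> C" using assms known_subset by auto
  thus thesis
  proof (cases rule: coord_cases)
    case (2 i k)
    show thesis
    proof (cases k)
      case 0
      thus thesis using 2 that(2) by simp
    next
      case (Suc k')
      hence "Jet j l = lead i k'" using 2 by (simp add: lead_def)
      thus thesis using assms lead_notin_known[OF 2(1)] by simp
    qed
  qed (rule that(1))
qed

lemma succ_lead: "jet_field (lead i k) q = q (lead i (Suc k))"
  by (simp add: lead_def)

lemma jet_field_known_eq:
  assumes c: "c \<in> known" and eq: "\<And>c. c \<in> known \<Longrightarrow> q c = q' c" "\<And>i. i < s \<Longrightarrow> q (lead i 0) = q' (lead i 0)"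
  shows "jet_field c q = jet_field c q'"
proof (cases c)
  case (Jet j l)
  have "Jet j l \<in> known" using c Jet by simp
  thus ?thesis by (rule known_succ_cases) (use Jet eq in auto)
qed simp

text \<open>
  On inputs this holds because their successors are inputs again.
\<close>

lemma vf_eq: "b \<in> E \<Longrightarrow> vf b y = jet_field (\<iota> b) (graph y)"
proof (cases b)
  case (Input b' l)
  assume b: "b \<in> E"
  hence b': "b' < m" using Input by (auto simp: rep_coords_def)
  obtain j where j: "\<And>l. \<iota> (Input b' l) = Jet j l" using \<iota>_Input[OF b'] by blast
  have E: "Input b' (Suc l) \<in> E" using b' by (auto simp: rep_coords_def)
  have "graph y (Jet j (Suc l)) = y (Input b' (Suc l))"
    using graph_known[OF iota_in[OF E]] kappa_iota[OF E] j by simp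
  thus ?thesis using Input j by (simp add: vf_def)
qed (simp_all add: vf_def \<iota>_RTime)

lemma vf_differential:
  assumes "b \<in> E"
  shows "differential_function E W (vf b)"
proof -
  have eq: "vf b = (\<lambda>y. jet_field (\<iota> b) (graph y))" using vf_eq[OF assms] by auto
  have k: "\<iota> b \<in> C" using iota_in[OF assms] known_subset by auto
  show ?thesis
  proof (cases "\<iota> b")
    case Time
    thus ?thesis unfolding eq using differential_function_const[OF openin_W] by simp
  next
    case (Jet j l)
    hence "Jet j (Suc l) \<in> C" using k by simp
    from graph_differential[OF this] show ?thesis unfolding eq by (simp add: Jet)
  qed
qed

lemma D_differential: "differential_function E W f \<Longrightarrow> differential_function E W (D f)"
  unfolding D_def by (rule differential_function_derivation[OF _ vf_differential])

lemma D_cong: "y \<in> W \<Longrightarrow> (\<And>y. y \<in> W \<Longrightarrow> f y = g y) \<Longrightarrow> D f y = D g y"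
  unfolding D_def by (rule derivation_cong[OF openin_W])

lemma D_zero: "y \<in> W \<Longrightarrow> (\<And>y. y \<in> W \<Longrightarrow> f y = 0) \<Longrightarrow> D f y = 0"
  using D_cong[of y f "\<lambda>_. 0"] by (simp add: D_def derivation_const)

lemma D_known:
  assumes "c \<in> known"
  shows "D (\<lambda>y. y (\<kappa> c)) y = jet_field c (graph y)"
  unfolding D_def derivation_coord[OF kappa_in[OF assms]] vf_eq[OF kappa_in[OF assms]] iota_kappa[OF assms] ..

lemma D_compose:
  assumes f: "differential_function C U' f" and y: "y \<in> W" "\<psi> y \<in> U'"
    and ext: "\<And>y. \<psi> y \<in> extensional C" and \<psi>: "\<And>c. c \<in> C \<Longrightarrow> differential_function E W (\<lambda>y. \<psi> y c)"
  shows "D (\<lambda>y. f (\<psi> y)) y = derivation C (\<lambda>c _. D (\<lambda>y. \<psi> y c) y) f (\<psi> y)"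
  unfolding D_def by (rule derivation_compose[where \<psi> = \<psi> and y = y, OF f y(2) W_ext[OF y(1)] ext]) (use y(1) \<psi> in blast)

lemma derivation_diff_field:
  "derivation C (\<lambda>c _. u c - v c) f q = derivation C (\<lambda>c _. u c) f q - derivation C (\<lambda>c _. v c) f q"
  by (simp add: derivation_def left_diff_distrib sum_subtractf)

lemma derivation_at: "derivation C w f q = derivation C (\<lambda>c _. w c q) f q"
  by (simp add: derivation_def)

text \<open>
  Differentiating an equation of weight less than \<open>A\<close> along the vector field and prolonging it by \<open>d_t\<close>
  both give zero on the graph. The difference is a linear relation for the errors
  \<open>D x - x'\<close>, which vanish on free coordinates by the choice of the vector field.
\<close>

lemma D_graph_lead:
  assumes y: "y \<in> W" and i: "i < s" "k + \<alpha> i < A"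
  shows "D (\<lambda>y. graph y (lead i k)) y = graph y (lead i (Suc k))"
proof -
  define \<delta> where "\<delta> c = D (\<lambda>y. graph y c) y - jet_field c (graph y)" for c
  have gN: "graph y \<in> N" if "y \<in> W" for y by (rule in_nbhd_of_graph[OF that graph_extensional refl])
  have "\<delta> (lead i k) = 0"
  proof (rule kernel_trivial[OF regular_nbhd[OF gN[OF y]] _ _ i])
    show "\<delta> c = 0" if "c \<in> known" for c
      using D_known[OF that, of y] by (simp add: \<delta>_def graph_known[OF that])
    fix i k assume i: "i < s" "k + \<alpha> i < A"
    have pU: "graph y \<in> U i" if "y \<in> W" for y by (rule regular_at_U[OF regular_nbhd[OF gN[OF that]] i(1)])
    have "derivation C (\<lambda>c _. D (\<lambda>y. graph y c) y) (prolong i k) (graph y) = D (\<lambda>y. prolong i k (graph y)) y"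
      by (rule D_compose[symmetric, where \<psi> = graph, OF prolong[OF i(1)] y pU[OF y] graph_extensional graph_differential])
    also have "\<dots> = 0"
      by (rule D_zero[OF y]) (rule prolong_zero_of_graph[OF _ graph_extensional refl i(1)], use i in auto)
    finally have 1: "derivation C (\<lambda>c _. D (\<lambda>y. graph y c) y) (prolong i k) (graph y) = 0" .
    have "derivation C (\<lambda>c _. jet_field c (graph y)) (prolong i k) (graph y) = prolong i (Suc k) (graph y)"
      unfolding prolong_Suc d_t_def by (rule derivation_at[symmetric])
    also have "\<dots> = 0"
      by (rule prolong_zero_of_graph[OF y graph_extensional refl i(1)]) (use i in auto)
    finally show "derivation C (\<lambda>c _. \<delta> c) (prolong i k) (graph y) = 0"
      unfolding \<delta>_def derivation_diff_field using 1 by simp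
  qed
  thus ?thesis by (simp add: \<delta>_def succ_lead)
qed

text \<open>
  The inverse of the coordinate projection \<open>\<phi>\<close>. Unlike \<^const>\<open>graph\<close>, it assigns the correct values to
  leading derivatives of all weights, by iterating the vector field from the lowest one.
\<close>

definition "\<psi> y c = (if c \<in> known then y (\<kappa> c)
  else if c \<in> C then (case (SOME (i, k). i < s \<and> c = lead i k) of (i, k) \<Rightarrow> (D ^^ k) (\<lambda>y. graph y (lead i 0)) y)
  else undefined)"

lemma psi_known: "c \<in> known \<Longrightarrow> \<psi> y c = y (\<kappa> c)"
  by (simp add: \<psi>_def)

lemma psi_lead:
  assumes "i < s"
  shows "\<psi> y (lead i k) = (D ^^ k) (\<lambda>y. graph y (lead i 0)) y"
proof -
  have "(SOME (i', k'). i' < s \<and> lead i k = lead i' k') = (i, k)"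
    by (rule some_equality) (use assms in \<open>auto simp: lead_eq_iff\<close>)
  thus ?thesis using lead_notin_known[OF assms] lead_in[OF assms] by (simp add: \<psi>_def)
qed

lemma psi_extensional: "\<psi> y \<in> extensional C"
  using known_subset by (auto simp: \<psi>_def extensional_def)

lemma psi_differential:
  assumes "c \<in> C"
  shows "differential_function E W (\<lambda>y. \<psi> y c)"
  using assms
proof (cases rule: coord_cases)
  case 1
  thus ?thesis using differential_function_coord[OF openin_W kappa_in[OF 1]] by (simp add: psi_known)
next
  case (2 i k)
  have "differential_function E W ((D ^^ k) (\<lambda>y. graph y (lead i 0)))"
    by (induction k) (auto intro: D_differential graph_differential lead_in 2(1))
  thus ?thesis using 2 by (simp add: psi_lead)
qed

lemma psi_graph:
  assumes y: "y \<in> W" and c: "c \<in> known \<union> leads A"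
  shows "\<psi> y c = graph y c"
proof (cases "c \<in> known")
  case True
  thus ?thesis by (simp add: psi_known graph_known)
next
  case False
  then obtain i k where ik: "c = lead i k" "i < s" "k + \<alpha> i \<le> A" using c by (auto simp: leads_def)
  have "\<forall>y\<in>W. \<psi> y (lead i k) = graph y (lead i k)"
    using ik(3)
  proof (induction k)
    case 0
    thus ?case using ik(2) by (simp add: psi_lead)
  next
    case (Suc k)
    show ?case
    proof
      fix y assume y: "y \<in> W"
      have "\<psi> y (lead i (Suc k)) = D (\<lambda>y. \<psi> y (lead i k)) y" using ik(2) by (simp add: psi_lead)
      also have "\<dots> = D (\<lambda>y. graph y (lead i k)) y" by (rule D_cong[OF y]) (use Suc in auto)
      also have "\<dots> = graph y (lead i (Suc k))" by (rule D_graph_lead[OF y ik(2)]) (use Suc in auto)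
      finally show "\<psi> y (lead i (Suc k)) = graph y (lead i (Suc k))" .
    qed
  qed
  thus ?thesis using y ik(1) by simp
qed

lemma psi_nbhd: "y \<in> W \<Longrightarrow> \<psi> y \<in> N"
  by (rule in_nbhd_of_graph[OF _ psi_extensional psi_graph])

lemma D_psi:
  assumes y: "y \<in> W" and c: "c \<in> C"
  shows "D (\<lambda>y. \<psi> y c) y = jet_field c (\<psi> y)"
  using c
proof (cases rule: coord_cases)
  case 1
  have "D (\<lambda>y. \<psi> y c) y = jet_field c (graph y)" using D_known[OF 1] 1 by (simp add: psi_known)
  also have "\<dots> = jet_field c (\<psi> y)"
    by (rule jet_field_known_eq[OF 1]) (use A in \<open>auto simp: psi_graph[OF y] lead_in_leads\<close>)
  finally show ?thesis .
next
  case (2 i k)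
  thus ?thesis by (simp add: psi_lead succ_lead)
qed

lemma d_t_psi:
  assumes f: "differential_function C U' f" and y: "y \<in> W" "\<psi> y \<in> U'"
  shows "derivation C jet_field f (\<psi> y) = D (\<lambda>y. f (\<psi> y)) y"
proof -
  have "D (\<lambda>y. f (\<psi> y)) y = derivation C (\<lambda>c _. D (\<lambda>y. \<psi> y c) y) f (\<psi> y)"
    by (rule D_compose[OF f y psi_extensional psi_differential])
  also have "\<dots> = derivation C (\<lambda>c _. jet_field c (\<psi> y)) f (\<psi> y)"
    unfolding derivation_def by (intro sum.cong) (auto simp: D_psi[OF y(1)])
  also have "\<dots> = derivation C jet_field f (\<psi> y)" by (rule derivation_at[symmetric])
  finally show ?thesis by simp
qed

lemma psi_U: "y \<in> W \<Longrightarrow> i < s \<Longrightarrow> \<psi> y \<in> U i"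
  by (rule regular_at_U[OF regular_nbhd[OF psi_nbhd]])

text \<open>
  The equations themselves hold because \<open>\<psi>\<close> agrees with the graph up to weight \<open>A\<close>; their derivatives
  hold because \<open>\<psi>\<close> intertwines \<open>d_t\<close> with \<open>D\<close>, and \<open>D\<close> of zero is zero.
\<close>

lemma prolong_psi:
  assumes "i < s"
  shows "\<forall>y\<in>W. prolong i k (\<psi> y) = 0"
proof (induction k)
  case 0
  show ?case
    by (intro ballI prolong_zero_of_graph[OF _ psi_extensional psi_graph assms]) (use A[OF assms] in auto)
next
  case (Suc k)
  show ?case
  proof
    fix y assume y: "y \<in> W"
    have "prolong i (Suc k) (\<psi> y) = D (\<lambda>y. prolong i k (\<psi> y)) y"
      unfolding prolong_Suc d_t_def by (rule d_t_psi[OF prolong[OF assms] y psi_U[OF y assms]])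
    also have "\<dots> = 0" by (rule D_zero[OF y]) (use Suc in auto)
    finally show "prolong i (Suc k) (\<psi> y) = 0" .
  qed
qed

definition "pts = points (system_diffiety n s U P) \<inter> N"

lemma pts_iff: "q \<in> pts \<longleftrightarrow> q \<in> N \<and> (\<forall>i k. i < s \<longrightarrow> prolong i k q = 0)"
  using nbhdD(1) regular_at_U[OF regular_nbhd]
  unfolding pts_def system_diffiety_def topspace_coord_space prolong_def by auto

lemma psi_pts: "y \<in> W \<Longrightarrow> \<psi> y \<in> pts"
  using psi_nbhd prolong_psi by (auto simp: pts_iff)

definition "\<phi> q = (\<lambda>b\<in>E. q (\<iota> b))"

lemma phi_W: "q \<in> N \<Longrightarrow> \<phi> q \<in> W"
  using nbhdD(2)[of q] X(2) kappa_in iota_kappa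
  by (auto simp: W_def cylinder_def \<phi>_def subset_iff)

lemma phi_psi:
  assumes "y \<in> W"
  shows "\<phi> (\<psi> y) = y"
proof
  fix b
  show "\<phi> (\<psi> y) b = y b"
  proof (cases "b \<in> E")
    case True
    thus ?thesis by (simp add: \<phi>_def psi_known[OF iota_in] kappa_iota)
  next
    case False
    thus ?thesis using W_ext[OF assms] by (simp add: \<phi>_def extensional_def)
  qed
qed

text \<open>
  Up to weight \<open>A\<close> the leading derivatives are given by the implicit functions. If two points agree up
  to weight \<open>w\<close>, then the partial derivatives of equations of weight \<open>w\<close> agree as well, and
  subtracting the equations of weight \<open>w + 1\<close> leaves a homogeneous linear system for the
  differences of the velocities of the leading derivatives of weight at most \<open>w\<close>.
\<close>

lemma pts_unique:
  assumes q: "q \<in> pts" "q' \<in> pts" and known_eq: "\<And>c. c \<in> known \<Longrightarrow> q c = q' c"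
  shows "q = q'"
proof -
  have qN: "q \<in> N" "q' \<in> N" using q by (auto simp: pts_iff)
  have lead_eq: "q c = q' c" if c: "c \<in> leads A" for c
  proof -
    have "q c = h c q" "q' c = h c q'"
      using solution[OF qN(1)] solution[OF qN(2)] q c by (auto simp: pts_iff)
    moreover have "h c q = h c q'" by (rule h_eq[OF c qN(1)]) (use known_eq X(2) in auto)
    ultimately show ?thesis by simp
  qed
  have main: "\<forall>i k. i < s \<longrightarrow> k + \<alpha> i \<le> w \<longrightarrow> q (lead i k) = q' (lead i k)" for w
  proof (induction w)
    case 0
    show ?case using lead_eq lead_in_leads by auto
  next
    case (Suc w)
    show ?case
    proof (intro allI impI)
      fix i k assume i: "i < s" and k: "k + \<alpha> i \<le> Suc w"
      show "q (lead i k) = q' (lead i k)"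
      proof (cases k)
        case 0
        thus ?thesis using lead_eq[of "lead i 0"] lead_in_leads[OF i, of 0 A] A[OF i] by simp
      next
        case (Suc k')
        define \<delta> where "\<delta> c = jet_field c q - jet_field c q'" for c
        have "\<delta> (lead i k') = 0"
        proof (rule kernel_trivial[OF regular_nbhd[OF qN(1)] _ _ i])
          show "k' + \<alpha> i < Suc w" using k Suc by simp
          show "\<delta> c = 0" if "c \<in> known" for c
          proof -
            have "jet_field c q = jet_field c q'"
              by (rule jet_field_known_eq[OF that known_eq]) (use lead_eq lead_in_leads A in auto)
            thus ?thesis by (simp add: \<delta>_def)
          qed
          fix i k assume i: "i < s" and k: "k + \<alpha> i < Suc w"
          have NU: "N \<subseteq> U i" using regular_at_U[OF regular_nbhd] i by auto
          have pd: "pdiff c (prolong i k) q = pdiff c (prolong i k) q'" if c: "c \<in> C" for c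
          proof (rule pdiff_indep[OF prolong[OF i] NU[unfolded nbhd_def] _ _ _ qN[unfolded nbhd_def] _ c,
                of "{lead i' k' |i' k'. i' < s \<and> k' + \<alpha> i' > w}"])
            show "finite (X \<union> leads A)" "X \<union> leads A \<subseteq> C"
              using X finite_leads leads_subset known_subset by auto
            show "pdiff c (prolong i k) p = 0"
              if "c \<in> {lead i' k' |i' k'. i' < s \<and> k' + \<alpha> i' > w}"
                "p \<in> cylinder C (X \<union> leads A) \<eta> (\<lambda>c. if c \<in> leads A then R else r1)" for c p
            proof -
              have "p \<in> U i" using NU that(2) unfolding nbhd_def by blast
              thus ?thesis using that(1) k pdiff_lead_above[OF i] by auto
            qed
            show "q c = q' c" if "c \<in> C" "c \<notin> {lead i' k' |i' k'. i' < s \<and> k' + \<alpha> i' > w}" for c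
              using that(1)
            proof (cases rule: coord_cases)
              case (2 i' k')
              hence "k' + \<alpha> i' \<le> w" using that(2) by fastforce
              thus ?thesis using Suc.IH 2 by simp
            qed (rule known_eq)
          qed
          have "derivation C (\<lambda>c _. jet_field c q) (prolong i k) q = prolong i (Suc k) q"
            unfolding prolong_Suc d_t_def by (rule derivation_at[symmetric])
          moreover have "derivation C (\<lambda>c _. jet_field c q') (prolong i k) q = prolong i (Suc k) q'"
          proof -
            have "derivation C (\<lambda>c _. jet_field c q') (prolong i k) q = derivation C (\<lambda>c _. jet_field c q') (prolong i k) q'"
              unfolding derivation_def by (intro sum.cong) (auto simp: pd)
            thus ?thesis unfolding prolong_Suc d_t_def by (simp add: derivation_at[of jet_field])
          qed
          ultimately show "derivation C (\<lambda>c _. \<delta> c) (prolong i k) q = 0"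
            unfolding \<delta>_def derivation_diff_field using q i by (simp add: pts_iff)
        qed
        thus ?thesis using Suc by (simp add: \<delta>_def succ_lead)
      qed
    qed
  qed
  show ?thesis
  proof
    fix c
    show "q c = q' c"
    proof (cases "c \<in> C")
      case True
      thus ?thesis
      proof (cases rule: coord_cases)
        case (2 i k)
        thus ?thesis using main[of "k + \<alpha> i"] by auto
      qed (rule known_eq)
    next
      case False
      thus ?thesis using nbhdD(1)[OF qN(1)] nbhdD(1)[OF qN(2)] by (simp add: extensional_def)
    qed
  qed
qed

lemma psi_phi:
  assumes "q \<in> pts"
  shows "\<psi> (\<phi> q) = q"
proof (rule pts_unique)
  have "q \<in> N" using assms by (simp add: pts_iff)
  thus "\<psi> (\<phi> q) \<in> pts" by (intro psi_pts phi_W)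
  show "\<psi> (\<phi> q) c = q c" if "c \<in> known" for c
    using that by (simp add: psi_known \<phi>_def kappa_in iota_kappa)
qed (rule assms)

lemma bij_phi: "bij_betw \<phi> pts W"
proof (rule bij_betwI[where g = \<psi>])
  show "\<phi> \<in> pts \<rightarrow> W" using phi_W by (auto simp: pts_iff)
  show "\<psi> \<in> W \<rightarrow> pts" using psi_pts by auto
qed (auto simp: psi_phi phi_psi)

lemma inv_phi: "y \<in> W \<Longrightarrow> inv_into pts \<phi> y = \<psi> y"
  using inv_into_f_eq[of \<phi> pts "\<psi> y" y] bij_phi psi_pts phi_psi by (auto simp: bij_betw_def)

text \<open>
  Near \<open>\<phi> p\<close>, along each coordinate, \<open>g\<close> coincides with \<open>f \<circ> \<psi>\<close>, to which the chain rule applies.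
\<close>

lemma derivation_pullback:
  assumes f: "differential_function C U' f" and g: "differential_function E V g"
    and eq: "\<And>p. p \<in> pts \<Longrightarrow> p \<in> U' \<Longrightarrow> \<phi> p \<in> V \<Longrightarrow> f p = g (\<phi> p)"
    and p: "p \<in> pts" "p \<in> U'" "\<phi> p \<in> V"
  shows "derivation C jet_field f p = derivation E vf g (\<phi> p)"
proof -
  define y where "y = \<phi> p"
  have y: "y \<in> W" "y \<in> V" using p phi_W by (auto simp: y_def pts_iff)
  have py: "p = \<psi> y" using psi_phi[OF p(1)] by (simp add: y_def)
  have "pdiff b (\<lambda>y. f (\<psi> y)) y = pdiff b g y" if b: "b \<in> E" for b
    unfolding pdiff_def
  proof (rule deriv_cong_ev[OF _ refl])
    have "openin (coord_space E) (W \<inter> V)"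
      by (intro openin_Int openin_W differential_function_open[OF g])
    hence 1: "\<forall>\<^sub>F t in nhds (y b). y(b := t) \<in> W \<inter> V"
      by (rule eventually_fun_upd_in_openin) (use y b in auto)
    have 2: "\<forall>\<^sub>F t in nhds (y b). \<psi> (y(b := t)) \<in> U'"
    proof (rule eventually_in_openin[OF differential_function_open[OF f] _ psi_extensional])
      show "isCont (\<lambda>t. \<psi> (y(b := t)) c) (y b)" if "c \<in> C" for c
        using differential_function_has_pdiff[OF psi_differential[OF that] y(1) b] by (rule DERIV_isCont)
      show "\<psi> (y(b := y b)) \<in> U'" using p(2) by (simp add: py)
    qed
    show "\<forall>\<^sub>F t in nhds (y b). f (\<psi> (y(b := t))) = g (y(b := t))"
      using 1 2
    proof eventually_elim
      case (elim t)
      hence "\<phi> (\<psi> (y(b := t))) = y(b := t)" by (simp add: phi_psi)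
      thus ?case using eq[OF psi_pts, of "y(b := t)"] elim by simp
    qed
  qed
  hence "derivation E vf (\<lambda>y. f (\<psi> y)) y = derivation E vf g y"
    unfolding derivation_def by (intro sum.cong) auto
  thus ?thesis
    using d_t_psi[OF f y(1)] p(2) by (simp add: py[symmetric] D_def y_def[symmetric])
qed

lemma has_representation: "has_representation (system_diffiety n s U P) \<eta> d"
  unfolding has_representation_def
proof (intro exI conjI)
  let ?D = "system_diffiety n s U P" and ?f = "\<lambda>a y. jet_field (\<iota> (State a)) (graph y)"
  have co: "coords ?D = C" by (simp add: system_diffiety_def)
  have D': "?D\<lparr>points := points ?D \<inter> N\<rparr> = \<lparr>coords = C, points = pts, vfield = jet_field\<rparr>"
    by (simp add: system_diffiety_def pts_def)
  show "openin (coord_space (coords ?D)) N" unfolding co by (rule openin_nbhd)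
  show "\<eta> \<in> N" by (rule eta_nbhd)
  show "openin (coord_space E) W" by (rule openin_W)
  show "\<forall>i<d. differential_function E W (?f i)"
  proof (intro allI impI)
    fix i assume "i < d"
    hence "State i \<in> E" by (auto simp: rep_coords_def)
    have "vf (State i) = ?f i" by (rule ext) (simp add: vf_def)
    thus "differential_function E W (?f i)" using vf_differential[OF \<open>State i \<in> E\<close>] by simp
  qed
  show "diffiety_iso (?D\<lparr>points := points ?D \<inter> N\<rparr>) \<lparr>coords = E, points = W, vfield = rep_field ?f\<rparr> \<phi>"
    unfolding D' diffiety_iso_def smooth_map_def diffiety.select_convs vf_def[symmetric]
  proof (intro conjI ballI allI impI)
    show "bij_betw \<phi> pts W" by (rule bij_phi)
    show "\<phi> ` pts \<subseteq> W" "inv_into pts \<phi> ` W \<subseteq> pts"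
      using bij_phi psi_pts by (auto simp: bij_betw_def inv_phi)
    show "\<exists>O' f. p \<in> O' \<and> differential_function C O' f \<and> (\<forall>q\<in>pts \<inter> O'. f q = \<phi> q b)"
      if "b \<in> E" "p \<in> pts" for b p
    proof (intro exI conjI)
      show "p \<in> N" using that by (simp add: pts_iff)
      show "differential_function C N (\<lambda>q. q (\<iota> b))"
        by (rule differential_function_coord[OF openin_nbhd]) (use iota_in that known_subset in auto)
    qed (use that in \<open>simp add: \<phi>_def\<close>)
    show "\<exists>O' f. y \<in> O' \<and> differential_function E O' f \<and> (\<forall>q\<in>W \<inter> O'. f q = inv_into pts \<phi> q c)"
      if "c \<in> C" "y \<in> W" for c y
      by (intro exI[of _ W] exI[of _ "\<lambda>y. \<psi> y c"] conjI) (use that psi_differential inv_phi in auto)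
    fix U' f V g p
    assume "differential_function C U' f \<and> differential_function E V g \<and>
      (\<forall>p\<in>pts \<inter> U'. \<phi> p \<in> V \<longrightarrow> f p = g (\<phi> p))" "p \<in> pts \<inter> U'" "\<phi> p \<in> V"
    thus "derivation C jet_field f p = derivation E vf g (\<phi> p)"
      by (intro derivation_pullback[of U' f V g]) auto
  qed
qed

end

section \<open>Counting the states\<close>

context weighted_system
begin

lemma known_iff:
  "c \<in> known \<longleftrightarrow> c = Time \<or> (\<exists>i l. i < s \<and> l < e i \<and> c = Jet (\<sigma> i) l) \<or>
     (\<exists>j l. j < n \<and> j \<notin> \<sigma> ` {..<s} \<and> c = Jet j l)"
proof (cases c)
  case Time
  thus ?thesis by (simp add: known_def lead_def)
next
  case (Jet j l)
  show ?thesis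
  proof (cases "j \<in> \<sigma> ` {..<s}")
    case True
    then obtain i where i: "i < s" "j = \<sigma> i" by auto
    have "c \<in> known \<longleftrightarrow> l < e i"
    proof
      assume k: "c \<in> known"
      show "l < e i"
      proof (rule ccontr)
        assume "\<not> l < e i"
        hence "c = lead i (l - e i)" by (simp add: Jet i lead_def)
        thus False using k lead_notin_known[OF i(1)] by simp
      qed
    next
      assume l: "l < e i"
      have "c \<in> C" using \<sigma>_less[OF i(1)] by (simp add: Jet i)
      thus "c \<in> known"
      proof (cases rule: coord_cases)
        case (2 i' k)
        have "Jet (\<sigma> i) l = Jet (\<sigma> i') (e i' + k)" using 2(2) unfolding Jet i(2) lead_def .
        hence eq: "\<sigma> i = \<sigma> i'" "l = e i' + k" by auto
        have "i = i'" by (rule inj_onD[OF inj_\<sigma> eq(1)]) (use i(1) 2(1) in auto)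
        thus ?thesis using eq(2) l by simp
      qed
    qed
    moreover have "(\<exists>i' l'. i' < s \<and> l' < e i' \<and> c = Jet (\<sigma> i') l') \<longleftrightarrow> l < e i"
    proof
      assume "\<exists>i' l'. i' < s \<and> l' < e i' \<and> c = Jet (\<sigma> i') l'"
      then obtain i' where i': "i' < s" "l < e i'" "\<sigma> i' = \<sigma> i" by (auto simp: Jet i(2))
      thus "l < e i" using inj_onD[OF inj_\<sigma>, of i' i] i(1) by simp
    next
      assume "l < e i"
      thus "\<exists>i' l'. i' < s \<and> l' < e i' \<and> c = Jet (\<sigma> i') l'"
        by (intro exI[of _ i] exI[of _ l]) (simp add: Jet i)
    qed
    moreover have "\<not> (\<exists>j' l'. j' < n \<and> j' \<notin> \<sigma> ` {..<s} \<and> c = Jet j' l')"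
      using True by (auto simp: Jet)
    ultimately show ?thesis using Jet by blast
  next
    case False
    hence "c \<noteq> lead i k" if "i < s" for i k using that by (auto simp: Jet lead_def)
    hence "c \<in> known \<longleftrightarrow> j < n" by (auto simp: known_def Jet)
    thus ?thesis using False by (auto simp: Jet)
  qed
qed

lemma representation_coordinates:
  obtains m \<iota> where "bij_betw \<iota> (rep_coords (\<Sum>i<s. e i) m) known" "\<iota> RTime = Time"
    "\<And>b. b < m \<Longrightarrow> \<exists>j. \<forall>l. \<iota> (Input b l) = Jet j l"
proof -
  define I where "I = (SIGMA i:{..<s}. {..<e i})"
  define m where "m = card ({..<n} - \<sigma> ` {..<s})"
  have "finite I" "card I = (\<Sum>i<s. e i)" by (auto simp: I_def)
  then obtain f where f: "bij_betw f {..<\<Sum>i<s. e i} I"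
    using ex_bij_betw_nat_finite[of I] by (auto simp: atLeast0LessThan)
  obtain g where g: "bij_betw g {..<m} ({..<n} - \<sigma> ` {..<s})"
    using ex_bij_betw_nat_finite[of "{..<n} - \<sigma> ` {..<s}"] by (auto simp: atLeast0LessThan m_def)
  define \<iota> where "\<iota> r = (case r of RTime \<Rightarrow> Time | State a \<Rightarrow> Jet (\<sigma> (fst (f a))) (snd (f a)) | Input b l \<Rightarrow> Jet (g b) l)" for r
  have fI: "fst (f a) < s" "snd (f a) < e (fst (f a))" if "a < (\<Sum>i<s. e i)" for a
  proof -
    have "f a \<in> I" using bij_betwE[OF f] that by blast
    thus "fst (f a) < s" "snd (f a) < e (fst (f a))" by (auto simp: I_def)
  qed
  have gI: "g b < n" "g b \<notin> \<sigma> ` {..<s}" if "b < m" for b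
    using bij_betwE[OF g] that by auto
  have inj: "x = y" if x: "x \<in> rep_coords (\<Sum>i<s. e i) m" and y: "y \<in> rep_coords (\<Sum>i<s. e i) m" and eq: "\<iota> x = \<iota> y" for x y
  proof (cases x)
    case RTime
    thus ?thesis using eq by (cases y) (auto simp: \<iota>_def)
  next
    case (State a)
    hence a: "a < (\<Sum>i<s. e i)" using x by (auto simp: rep_coords_def)
    show ?thesis
    proof (cases y)
      case (State b)
      hence b: "b < (\<Sum>i<s. e i)" using y by (auto simp: rep_coords_def)
      have "fst (f a) = fst (f b)" "snd (f a) = snd (f b)"
        using eq inj_onD[OF inj_\<sigma>, of "fst (f a)" "fst (f b)"] fI(1)[OF a] fI(1)[OF b]
        by (auto simp: \<iota>_def State \<open>x = State a\<close>)
      hence "f a = f b" by (rule prod_eqI)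
      hence "a = b" using inj_onD[OF bij_betw_imp_inj_on[OF f]] a b by auto
      thus ?thesis using State \<open>x = State a\<close> by simp
    next
      case (Input b l)
      hence b: "b < m" using y by (auto simp: rep_coords_def)
      have "\<sigma> (fst (f a)) = g b" using eq by (simp add: \<iota>_def State Input)
      thus ?thesis using gI(2)[OF b] fI(1)[OF a] by (metis image_eqI lessThan_iff)
    qed (use eq in \<open>simp add: \<iota>_def State\<close>)
  next
    case (Input b l)
    hence b: "b < m" using x by (auto simp: rep_coords_def)
    show ?thesis
    proof (cases y)
      case (State a)
      hence a: "a < (\<Sum>i<s. e i)" using y by (auto simp: rep_coords_def)
      have "\<sigma> (fst (f a)) = g b" using eq by (simp add: \<iota>_def State Input)
      thus ?thesis using gI(2)[OF b] fI(1)[OF a] by (metis image_eqI lessThan_iff)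
    next
      case (Input b' l')
      hence b': "b' < m" using y by (auto simp: rep_coords_def)
      have "g b = g b'" "l = l'" using eq by (auto simp: \<iota>_def Input \<open>x = Input b l\<close>)
      hence "b = b'" using inj_onD[OF bij_betw_imp_inj_on[OF g]] b b' by auto
      thus ?thesis using Input \<open>x = Input b l\<close> \<open>l = l'\<close> by simp
    qed (use eq in \<open>simp add: \<iota>_def Input\<close>)
  qed
  have sub: "\<iota> x \<in> known" if "x \<in> rep_coords (\<Sum>i<s. e i) m" for x
  proof (cases x)
    case RTime
    thus ?thesis by (simp add: \<iota>_def known_iff)
  next
    case (State a)
    hence "a < (\<Sum>i<s. e i)" using that by (auto simp: rep_coords_def)
    from fI[OF this] show ?thesis unfolding known_iff \<iota>_def State by auto
  next
    case (Input b l)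
    hence "b < m" using that by (auto simp: rep_coords_def)
    from gI[OF this] show ?thesis unfolding known_iff \<iota>_def Input by auto
  qed
  have sup: "\<exists>x\<in>rep_coords (\<Sum>i<s. e i) m. c = \<iota> x" if "c \<in> known" for c
    using that unfolding known_iff
  proof (elim disjE exE conjE)
    assume "c = Time"
    thus ?thesis by (intro bexI[of _ RTime]) (auto simp: \<iota>_def rep_coords_def)
  next
    fix i l assume il: "i < s" "l < e i" "c = Jet (\<sigma> i) l"
    hence "(i, l) \<in> f ` {..<\<Sum>i<s. e i}" using f by (auto simp: bij_betw_def I_def)
    then obtain a where "a < (\<Sum>i<s. e i)" "f a = (i, l)" by auto
    thus ?thesis using il by (intro bexI[of _ "State a"]) (auto simp: \<iota>_def rep_coords_def)
  next
    fix j l assume jl: "j < n" "j \<notin> \<sigma> ` {..<s}" "c = Jet j l"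
    hence "j \<in> g ` {..<m}" using g by (auto simp: bij_betw_def)
    then obtain b where "b < m" "g b = j" by auto
    thus ?thesis using jl by (intro bexI[of _ "Input b l"]) (auto simp: \<iota>_def rep_coords_def)
  qed
  show thesis
  proof (rule that)
    show "bij_betw \<iota> (rep_coords (\<Sum>i<s. e i) m) known"
      unfolding bij_betw_def
    proof (intro conjI inj_onI inj)
      show "\<iota> ` rep_coords (\<Sum>i<s. e i) m = known" using sub sup by blast
    qed
    show "\<iota> RTime = Time" by (simp add: \<iota>_def)
    show "\<exists>j. \<forall>l. \<iota> (Input b l) = Jet j l" for b by (simp add: \<iota>_def)
  qed
qed

lemma has_representation_sum: "has_representation (system_diffiety n s U P) \<eta> (\<Sum>i<s. e i)"
proof -
  obtain A X r1 R h where sol: "finite X" "X \<subseteq> known" "0 < r1" "r1 \<le> R" "\<And>i. i < s \<Longrightarrow> \<alpha> i \<le> A"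
    "\<And>c. c \<in> leads A \<Longrightarrow> majorized X \<eta> r1 (R / 2) (\<lambda>q. h c q - \<eta> c)"
    "\<And>q. q \<in> nbhd A X r1 R \<Longrightarrow> regular_at q"
    "\<And>q. q \<in> nbhd A X r1 R \<Longrightarrow>
      (\<forall>i k. i < s \<longrightarrow> k + \<alpha> i \<le> A \<longrightarrow> prolong i k q = 0) \<longleftrightarrow> (\<forall>c\<in>leads A. q c = h c q)"
    by (rule local_solution) (rule that)
  obtain m \<iota> where \<iota>: "bij_betw \<iota> (rep_coords (\<Sum>i<s. e i) m) known" "\<iota> RTime = Time"
    "\<And>b. b < m \<Longrightarrow> \<exists>j. \<forall>l. \<iota> (Input b l) = Jet j l"
    by (rule representation_coordinates) (rule that)
  interpret parametrized_system n s U P \<sigma> \<alpha> e \<eta> A X r1 R h "\<Sum>i<s. e i" m \<iota>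
    by unfold_locales (fact sol \<iota>)+
  show ?thesis by (rule has_representation)
qed

end

section \<open>The bound by the Jacobi number\<close>

lemma nonsingular_on_image:
  assumes "nonsingular_on I (\<sigma> ` I) M" "inj_on \<sigma> I" "\<And>i i'. i \<in> I \<Longrightarrow> i' \<in> I \<Longrightarrow> M' i i' = M i (\<sigma> i')"
  shows "nonsingular_on I I M'"
  unfolding nonsingular_on_def
proof (intro conjI allI impI)
  show "finite I" "finite I" using assms(1) by (auto simp: nonsingular_on_def)
  fix v assume v: "\<forall>i\<in>I. (\<Sum>j\<in>I. M' i j * v j) = 0"
  define u where "u j = v (inv_into I \<sigma> j)" for j
  have u: "u (\<sigma> i) = v i" if "i \<in> I" for i using assms(2) that by (simp add: u_def)
  have z: "(\<Sum>j\<in>\<sigma> ` I. M i j * u j) = 0" if "i \<in> I" for i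
  proof -
    have "(\<Sum>j\<in>\<sigma> ` I. M i j * u j) = (\<Sum>i'\<in>I. M i (\<sigma> i') * u (\<sigma> i'))"
      using assms(2) by (simp add: sum.reindex)
    also have "\<dots> = (\<Sum>i'\<in>I. M' i i' * v i')" by (intro sum.cong) (auto simp: u assms(3)[OF that])
    finally show ?thesis using v that by simp
  qed
  show "\<forall>j\<in>I. v j = 0"
  proof
    fix j assume "j \<in> I"
    thus "v j = 0" using nonsingular_onD[OF assms(1) z, of "\<sigma> j"] u by simp
  qed
qed (use assms(1) in \<open>auto simp: nonsingular_on_def\<close>)

text \<open>
  The order of \<open>P i\<close> in \<open>x_j\<close> is at most \<open>\<alpha> i + \<beta> j\<close> because \<open>\<beta> j\<close> is a maximum. The nonzero determinant
  yields a bijection \<open>\<sigma>\<close> along which the truncated entries are nonzero, so that equality holds there; the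
  orders \<open>e i\<close> along \<open>\<sigma>\<close> then add up to at most \<open>d\<close>.
\<close>

theorem proposition42:
  fixes n s d :: nat
    and U :: "nat \<Rightarrow> (jet_coord \<Rightarrow> real) set"
    and P :: "nat \<Rightarrow> (jet_coord \<Rightarrow> real) \<Rightarrow> real"
    and Y :: "nat set"
    and \<eta> :: "jet_coord \<Rightarrow> real"
  assumes "s \<le> n"
    and "\<And>i. i < s \<Longrightarrow> differential_function (jet_coords n) (U i) (P i)"
    and "\<eta> \<in> points (system_diffiety n s U P)"
    and "Y \<subseteq> {..<n}" and "card Y = s"
    and "saddle_jacobi_number n s (order_matrix U P) = jacobi_number s (order_matrix U P) Y"
    and "jacobi_number s (order_matrix U P) Y = ereal (real d)"
    and "truncated_det s U P Y \<eta> \<noteq> 0"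
  shows "defect (system_diffiety n s U P) \<eta> \<le> enat d"
proof -
  note P = assms(2) and \<eta> = assms(3)
  define a where "a = order_matrix U P"
  define \<alpha> where "\<alpha> = canon_alpha s a Y"
  define \<beta> where "\<beta> = canon_beta s a Y"
  define O' where "O' i j = jet_orders (U i) (P i) j" for i j
  define M where "M i j = (if a i j = ereal (real (\<alpha> i)) + \<beta> j then pdiff (Jet j (Max (O' i j))) (P i) \<eta> else 0)" for i j
  have finY: "finite Y" using assms(4) finite_subset by blast
  have \<eta>U: "\<eta> \<in> U i" if "i < s" for i using \<eta> that by (simp add: system_diffiety_def)
  have finO: "finite (O' i j)" if i: "i < s" and j: "j < n" for i j
  proof -
    obtain F where F: "finite F" "\<And>p c. p \<in> U i \<Longrightarrow> c \<in> jet_coords n \<Longrightarrow> pdiff c (P i) p \<noteq> 0 \<Longrightarrow> c \<in> F"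
      by (rule differential_function_support[OF P[OF i]]) blast
    have "Jet j ` O' i j \<subseteq> F" using F(2) j by (auto simp: O'_def jet_orders_def)
    hence "finite (Jet j ` O' i j)" using F(1) finite_subset by blast
    thus ?thesis by (rule finite_imageD) (auto simp: inj_on_def)
  qed
  have a_eq: "a i j = (if O' i j = {} then -\<infinity> else ereal (real (Max (O' i j))))" for i j
    by (simp add: a_def order_matrix_def jet_ord_def O'_def)
  have O'I: "k \<in> O' i j" if "p \<in> U i" "pdiff (Jet j k) (P i) p \<noteq> 0" for i j k p
    using that by (auto simp: O'_def jet_orders_def)
  let ?ys = "sorted_list_of_set Y"
  have ys: "bij_betw (\<lambda>c. ?ys ! c) {..<s} Y"
    using bij_betw_nth[of ?ys "{..<s}" Y] finY assms(5) by simp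
  have "truncated_det s U P Y \<eta> = Determinant.det (Matrix.mat s s (\<lambda>(i, c). M (id i) (?ys ! c)))"
    unfolding truncated_det_def Let_def M_def \<alpha>_def \<beta>_def O'_def a_def id_def ..
  hence "Determinant.det (Matrix.mat s s (\<lambda>(i, c). M (id i) (?ys ! c))) \<noteq> 0"
    using assms(8) by (rule subst)
  hence "nonsingular_on {..<s} Y M" by (rule iffD2[OF nonsingular_on_iff_det[OF bij_betw_id ys]])
  from nested_nonsingular[OF this, of \<alpha>] obtain \<sigma> where \<sigma>: "bij_betw \<sigma> {..<s} Y"
    "\<And>i. i < s \<Longrightarrow> M i (\<sigma> i) \<noteq> 0"
    and ns: "\<And>w. nonsingular_on {i\<in>{..<s}. \<alpha> i \<le> w} (\<sigma> ` {i\<in>{..<s}. \<alpha> i \<le> w}) M" by auto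
  have \<sigma>Y: "\<sigma> i \<in> Y" "\<sigma> i < n" if "i < s" for i
    using bij_betwE[OF \<sigma>(1)] that assms(4) by auto
  define e where "e i = Max (O' i (\<sigma> i))" for i
  have ae: "a i (\<sigma> i) = ereal (real (e i))" "\<beta> (\<sigma> i) = ereal (real (e i) - real (\<alpha> i))" if i: "i < s" for i
  proof -
    have M: "a i (\<sigma> i) = ereal (real (\<alpha> i)) + \<beta> (\<sigma> i)" "pdiff (Jet (\<sigma> i) (e i)) (P i) \<eta> \<noteq> 0"
      using \<sigma>(2)[OF i] by (auto simp: M_def e_def split: if_splits)
    have "e i \<in> O' i (\<sigma> i)" by (rule O'I[OF \<eta>U[OF i] M(2)])
    thus 1: "a i (\<sigma> i) = ereal (real (e i))" by (auto simp: a_eq e_def)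
    show "\<beta> (\<sigma> i) = ereal (real (e i) - real (\<alpha> i))"
      using M(1) unfolding 1 by (cases "\<beta> (\<sigma> i)") auto
  qed
  have ale: "a i j \<le> ereal (real (\<alpha> i)) + \<beta> j" if "i < s" for i j
  proof -
    have "a i j - ereal (real (\<alpha> i)) \<le> \<beta> j"
      unfolding \<beta>_def canon_beta_def \<alpha>_def[symmetric] using that by (intro Max_ge) auto
    thus ?thesis by (cases "a i j"; cases "\<beta> j") auto
  qed
  have Ole: "k + \<alpha> i' \<le> \<alpha> i + e i'" if i: "i < s" "i' < s" and k: "k \<in> O' i (\<sigma> i')" for i i' k
  proof -
    have "k \<le> Max (O' i (\<sigma> i'))" using k finO[OF i(1) \<sigma>Y(2)[OF i(2)]] by simp
    moreover have "ereal (real (Max (O' i (\<sigma> i')))) \<le> ereal (real (\<alpha> i)) + \<beta> (\<sigma> i')"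
    proof -
      have "O' i (\<sigma> i') \<noteq> {}" using k by blast
      thus ?thesis using ale[OF i(1), of "\<sigma> i'"] by (simp add: a_eq)
    qed
    ultimately show ?thesis unfolding ae(2)[OF i(2)] by simp
  qed
  \<comment> \<open>A nonzero entry requires order exactly \<open>\<alpha> i + \<beta> j\<close>; if the order is smaller, the partial derivative
    taken in the separant vanishes.\<close>
  have sep: "(if \<alpha> i' \<le> \<alpha> i + e i' then pdiff (Jet (\<sigma> i') (\<alpha> i + e i' - \<alpha> i')) (P i) \<eta> else 0) = M i (\<sigma> i')"
    (is "?l = _") if i: "i < s" "i' < s" for i i'
  proof (cases "O' i (\<sigma> i') = {}")
    case True
    hence "pdiff (Jet (\<sigma> i') k) (P i) \<eta> = 0" for k using O'I[OF \<eta>U[OF i(1)], of "\<sigma> i'" k] by auto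
    thus ?thesis by (simp add: M_def)
  next
    case False
    define k where "k = Max (O' i (\<sigma> i'))"
    have k: "k \<in> O' i (\<sigma> i')" "\<And>l. l \<in> O' i (\<sigma> i') \<Longrightarrow> l \<le> k"
      using False finO[OF i(1) \<sigma>Y(2)[OF i(2)]] by (auto simp: k_def)
    have a: "a i (\<sigma> i') = ereal (real k)" using False by (simp add: a_eq k_def)
    show ?thesis
    proof (cases "k + \<alpha> i' = \<alpha> i + e i'")
      case True
      hence "real k + real (\<alpha> i') = real (\<alpha> i) + real (e i')" by (metis of_nat_add)
      hence "M i (\<sigma> i') = pdiff (Jet (\<sigma> i') k) (P i) \<eta>"
        unfolding M_def a ae(2)[OF i(2)] by (simp add: k_def algebra_simps)
      moreover have "\<alpha> i' \<le> \<alpha> i + e i'" "\<alpha> i + e i' - \<alpha> i' = k" using True by auto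
      ultimately show ?thesis by simp
    next
      case ne: False
      hence "real k + real (\<alpha> i') \<noteq> real (\<alpha> i) + real (e i')" by (metis of_nat_add of_nat_eq_iff)
      hence M0: "M i (\<sigma> i') = 0" unfolding M_def a ae(2)[OF i(2)] by (simp add: algebra_simps)
      have "k + \<alpha> i' < \<alpha> i + e i'" using Ole[OF i k(1)] ne by simp
      hence "\<alpha> i + e i' - \<alpha> i' \<notin> O' i (\<sigma> i')" using k(2) by fastforce
      hence "pdiff (Jet (\<sigma> i') (\<alpha> i + e i' - \<alpha> i')) (P i) \<eta> = 0" using O'I[OF \<eta>U[OF i(1)]] by blast
      thus ?thesis using M0 by simp
    qed
  qed
  have inj: "inj_on \<sigma> {..<s}" using \<sigma>(1) by (rule bij_betw_imp_inj_on)
  interpret weighted_system n s U P \<sigma> \<alpha> e \<eta>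
  proof
    show "pdiff (Jet (\<sigma> i') k) (P i) p = 0"
      if "i < s" "i' < s" "p \<in> U i" "\<alpha> i + e i' < k + \<alpha> i'" for i i' p k
      using O'I[OF that(3)] Ole[OF that(1,2)] that(4) by fastforce
    fix w
    have I: "{i\<in>{..<s}. \<alpha> i \<le> w} = {i. i < s \<and> \<alpha> i \<le> w}" by auto
    show "nonsingular_on {i. i < s \<and> \<alpha> i \<le> w} {i. i < s \<and> \<alpha> i \<le> w}
      (\<lambda>i i'. if \<alpha> i' \<le> \<alpha> i + e i' then pdiff (Jet (\<sigma> i') (\<alpha> i + e i' - \<alpha> i')) (P i) \<eta> else 0)"
      by (rule nonsingular_on_image[OF ns[of w, unfolded I]]) (use inj sep in \<open>auto simp: inj_on_def\<close>)
  qed (use P \<eta> inj \<sigma>Y in auto)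
  have "(\<Sum>i<s. e i) \<le> d"
  proof -
    have "finite {\<Sum>i<s. a i (\<tau> i) |\<tau>. bij_betw \<tau> {..<s} Y}"
    proof (rule finite_subset)
      show "finite ((\<lambda>\<tau>. \<Sum>i<s. a i (\<tau> i)) ` ({..<s} \<rightarrow>\<^sub>E Y))"
        by (intro finite_imageI finite_PiE finY) auto
      show "{\<Sum>i<s. a i (\<tau> i) |\<tau>. bij_betw \<tau> {..<s} Y} \<subseteq> (\<lambda>\<tau>. \<Sum>i<s. a i (\<tau> i)) ` ({..<s} \<rightarrow>\<^sub>E Y)"
      proof clarify
        fix \<tau> assume "bij_betw \<tau> {..<s} Y"
        hence "restrict \<tau> {..<s} \<in> {..<s} \<rightarrow>\<^sub>E Y" by (auto dest: bij_betwE)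
        thus "(\<Sum>i<s. a i (\<tau> i)) \<in> (\<lambda>\<tau>. \<Sum>i<s. a i (\<tau> i)) ` ({..<s} \<rightarrow>\<^sub>E Y)"
          by (rule rev_image_eqI) simp
      qed
    qed
    hence "(\<Sum>i<s. a i (\<sigma> i)) \<le> jacobi_number s a Y"
      unfolding jacobi_number_def using \<sigma>(1) by (intro Max_ge) auto
    moreover have "(\<Sum>i<s. a i (\<sigma> i)) = ereal (real (\<Sum>i<s. e i))"
      by (simp add: ae(1) sum_ereal)
    ultimately have "ereal (real (\<Sum>i<s. e i)) \<le> ereal (real d)" using assms(7) by (simp add: a_def)
    thus ?thesis by (simp del: of_nat_sum)
  qed
  moreover have "defect (system_diffiety n s U P) \<eta> \<le> enat (\<Sum>i<s. e i)"
    unfolding defect_def by (rule INF_lower) (simp add: has_representation_sum)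
  ultimately show ?thesis by (meson enat_ord_simps(1) order_trans)
qed

end
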